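(* Let $X$ be a complex Banach space. Then $\mathcal{H}_\infty^+(X)=\mathfrak{D}_\infty(X)$ isometrically, i.e. the two spaces consist of the same Dirichlet series and the norms coincide: $\|D\|_{\mathcal{H}_\infty^+(X)}=\|D\|_{\mathfrak{D}_\infty(X)}$.
   Context: $\mathbb{N}_0=\mathbb{N}\cup\{0\}$; $\mathbb{Z}^{(\mathbb{N})}$ (resp. $\mathbb{N}_0^{(\mathbb{N})}$) is the set of eventually zero sequences of integers (resp. of elements of $\mathbb{N}_0$). $\mathfrak{p}=(\mathfrak{p}_1<\mathfrak{p}_2<\dots)$ is the sequence of primes and $\mathfrak{p}^\alpha=\prod_j\mathfrak{p}_j^{\alpha_j}$, so every $n\in\mathbb{N}$ equals $\mathfrak{p}^\alpha$ for a unique $\alpha\in\mathbb{N}_0^{(\mathbb{N})}$. $\mathbb{T}^{\mathbb{N}}$ is the infinite-dimensional torus with normalized Haar measure $d\omega$; $L_\infty(\mathbb{T}^{\mathbb{N}},X)$ is the space of essentially bounded (strongly) measurable functions. For $\alpha\in\mathbb{Z}^{(\mathbb{N})}$ put $\omega^\alpha=\prod_j\omega_j^{\alpha_j}$ and $\widehat f(\alpha)=\int_{\mathbb{T}^{\mathbb{N}}}f(\omega)\omega^{-\alpha}\,d\omega$. $H_\infty(\mathbb{T}^{\mathbb{N}},X)$ is the closed subspace of those $f\in L_\infty(\mathbb{T}^{\mathbb{N}},X)$ with $\widehat f(\alpha)=0$ for all $\alpha\in\mathbb{Z}^{(\mathbb{N})}\setminus\mathbb{N}_0^{(\mathbb{N})}$.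 A Dirichlet series in $X$ is a formal series $D=\sum_n a_n n^{-s}$ with $a_n\in X$, identified with its coefficient sequence. $\mathcal{H}_\infty(X)$ is the space of Dirichlet series $D=\sum_n a_nn^{-s}$ for which there is a (unique) $f\in H_\infty(\mathbb{T}^{\mathbb{N}},X)$ with $\widehat f(\alpha)=a_{\mathfrak{p}^\alpha}$ for all $\alpha\in\mathbb{N}_0^{(\mathbb{N})}$, with norm $\|D\|_{\mathcal{H}_\infty(X)}=\|f\|_\infty$. For $\varepsilon>0$, $D_\varepsilon=\sum_n \frac{a_n}{n^\varepsilon}n^{-s}$. $\mathcal{H}_\infty^+(X)$ is the space of Dirichlet series $D$ in $X$ such that $D_\varepsilon\in\mathcal{H}_\infty(X)$ for every $\varepsilon>0$ and $\|D\|_{\mathcal{H}_\infty^+(X)}:=\sup_{\varepsilon>0}\|D_\varepsilon\|_{\mathcal{H}_\infty(X)}<\infty$. $\mathbb{C}_0=\{s\in\mathbb{C}:\operatorname{Re}(s)>0\}$. $\mathfrak{D}_\infty(X)$ is the space of Dirichlet series $\sum_n a_nn^{-s}$ in $X$ which converge on $\mathbb{C}_0$ and whose limit function $D(s)$ is bounded (and then automatically holomorphic) on $\mathbb{C}_0$, with norm $\|D\|_{\mathfrak{D}_\infty(X)}=\sup_{s\in\mathbb{C}_0}\|D(s)\|_X$. *)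

theory Defs
  imports "HOL-Probability.Probability" "HOL-Computational_Algebra.Primes"
begin

section \<open>Complex Banach spaces\<close>

class complex_banach = banach +
  fixes scaleC :: "complex \<Rightarrow> 'a \<Rightarrow> 'a"  (infixr "*\<^sub>C" 75)
  assumes scaleC_add_right: "c *\<^sub>C (x + y) = c *\<^sub>C x + c *\<^sub>C y"
    and scaleC_add_left: "(c + d) *\<^sub>C x = c *\<^sub>C x + d *\<^sub>C x"
    and scaleC_scaleC: "c *\<^sub>C d *\<^sub>C x = (c * d) *\<^sub>C x"
    and scaleC_of_real: "complex_of_real r *\<^sub>C x = r *\<^sub>R x"
    and norm_scaleC: "norm (c *\<^sub>C x) = cmod c * norm x"

instantiation complex :: complex_banach
begin

definition scaleC_complex :: "complex \<Rightarrow> complex \<Rightarrow> complex"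
  where "scaleC_complex c z = c * z"

instance
  by standard (auto simp: scaleC_complex_def algebra_simps norm_mult scaleR_conv_of_real)

end


section \<open>Strong measurability and the Bochner integral\<close>

text \<open>
  The library's Bochner integral is restricted to second countable (hence separable) spaces.
  As the Banach spaces considered here are arbitrary, we restate its definition with strong
  measurability in place of Borel measurability; for separable spaces the two agree.
\<close>

definition strongly_measurable :: "'a measure \<Rightarrow> ('a \<Rightarrow> 'b::real_normed_vector) \<Rightarrow> bool" where
  "strongly_measurable M f \<longleftrightarrow>
     (\<exists>s. (\<forall>i. simple_function M (s i)) \<and> (\<forall>x\<in>space M. (\<lambda>i. s i x) \<longlonglongrightarrow> f x))"

definition has_strong_integral ::
  "'a measure \<Rightarrow> ('a \<Rightarrow> 'b::real_normed_vector) \<Rightarrow> 'b \<Rightarrow> bool" where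
  "has_strong_integral M f y \<longleftrightarrow>
     strongly_measurable M f \<and>
     (\<exists>s. (\<forall>i. Bochner_Integration.simple_bochner_integrable M (s i)) \<and>
          (\<lambda>i. \<integral>\<^sup>+x. ennreal (norm (f x - s i x)) \<partial>M) \<longlonglongrightarrow> 0 \<and>
          (\<lambda>i. Bochner_Integration.simple_bochner_integral M (s i)) \<longlonglongrightarrow> y)"

definition strong_integral :: "'a measure \<Rightarrow> ('a \<Rightarrow> 'b::real_normed_vector) \<Rightarrow> 'b" where
  "strong_integral M f = (THE y. has_strong_integral M f y)"

lemma strongly_measurable_iff_borel_measurable:
  fixes f :: "'a \<Rightarrow> 'b::{real_normed_vector, second_countable_topology}"
  shows "strongly_measurable M f \<longleftrightarrow> f \<in> borel_measurable M"
proof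
  assume "strongly_measurable M f"
  then obtain s where s: "\<And>i. simple_function M (s i)"
    and lim: "\<And>x. x \<in> space M \<Longrightarrow> (\<lambda>i. s i x) \<longlonglongrightarrow> f x"
    unfolding strongly_measurable_def by blast
  show "f \<in> borel_measurable M"
    by (rule borel_measurable_LIMSEQ_metric[OF borel_measurable_simple_function[OF s] lim])
next
  assume "f \<in> borel_measurable M"
  from borel_measurable_implies_sequence_metric[OF this, of 0]
  show "strongly_measurable M f"
    unfolding strongly_measurable_def by blast
qed

lemma has_strong_integral_iff_has_bochner_integral:
  fixes f :: "'a \<Rightarrow> 'b::{real_normed_vector, second_countable_topology}"
  shows "has_strong_integral M f y \<longleftrightarrow> has_bochner_integral M f y"
  unfolding has_strong_integral_def has_bochner_integral.simps
    strongly_measurable_iff_borel_measurable by auto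


section \<open>The infinite-dimensional torus\<close>

definition circle :: "complex measure" where
  "circle = distr (uniform_measure lborel {0..<1}) (restrict_space borel (sphere 0 1))
              (\<lambda>t. cis (2 * pi * t))"

definition torus :: "(nat \<Rightarrow> complex) measure" where
  "torus = PiM UNIV (\<lambda>_. circle)"

lemma measurable_cis_circle:
  "(\<lambda>t. cis (2 * pi * (t + c))) \<in> borel \<rightarrow>\<^sub>M restrict_space borel (sphere 0 1)"
  by (rule measurable_restrict_space2)
     (auto intro!: borel_measurable_continuous_onI continuous_intros)

lemma space_circle [simp]: "space circle = sphere 0 1"
  by (simp add: circle_def space_restrict_space)

lemma sets_circle [measurable_cong]: "sets circle = sets (restrict_space borel (sphere 0 1))"
  by (simp add: circle_def)

lemma space_torus: "space torus = {\<omega>. \<forall>j. cmod (\<omega> j) = 1}"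
  by (auto simp: torus_def space_PiM PiE_def Pi_def)

lemma prob_space_circle: "prob_space circle"
proof -
  have "prob_space (uniform_measure lborel {0..<1::real})"
    by (rule prob_space_uniform_measure) auto
  then show ?thesis
    unfolding circle_def
    using measurable_cis_circle[of 0] by (intro prob_space.prob_space_distr) simp_all
qed

lemma prob_space_torus: "prob_space torus"
  unfolding torus_def by (rule prob_space_PiM) (rule prob_space_circle)

lemma emeasure_circle:
  assumes "B \<in> sets circle"
  shows "emeasure circle B = emeasure lborel ({0..<1} \<inter> {t. cis (2 * pi * t) \<in> B})"
proof -
  have m: "(\<lambda>t. cis (2 * pi * t)) \<in> lborel \<rightarrow>\<^sub>M restrict_space borel (sphere 0 1)"
    using measurable_cis_circle[of 0] by simp
  have "{t. cis (2 * pi * t) \<in> B} \<in> sets lborel"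
    using measurable_sets[OF m, of B] assms by (simp add: sets_circle vimage_def)
  then show ?thesis
    unfolding circle_def using assms m
    by (subst emeasure_distr)
       (auto simp: sets_circle vimage_def emeasure_uniform_measure divide_ennreal_def)
qed

lemma circle_rotation_invariant:
  assumes \<eta>: "cmod \<eta> = 1"
  shows "distr circle circle (\<lambda>z. \<eta> * z) = circle"
proof (rule measure_eqI)
  have rot: "(\<lambda>z. \<eta> * z) \<in> circle \<rightarrow>\<^sub>M circle"
    unfolding measurable_cong_sets[OF sets_circle sets_circle]
    by (rule measurable_restrict_space3) (auto simp: norm_mult \<eta>)
  fix B assume "B \<in> sets (distr circle circle (\<lambda>z. \<eta> * z))"
  then have B: "B \<in> sets circle" by simp
  obtain \<theta> where \<theta>: "0 \<le> \<theta>" "\<theta> < 2 * pi" "\<eta> = cis \<theta>"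
    using Arg2pi[of \<eta>] \<eta> by (auto simp: cis_conv_exp is_Arg_def)
  define c where "c = \<theta> / (2 * pi)"
  have c: "0 \<le> c" "c < 1" "\<eta> = cis (2 * pi * c)"
    using \<theta> by (auto simp: c_def divide_simps)
  define A where "A = {t. cis (2 * pi * t) \<in> B}"
  have A [measurable]: "A \<in> sets borel"
    using measurable_sets[OF measurable_cis_circle[of 0], of B] B
    by (simp add: A_def sets_circle vimage_def)
  have per: "t + 1 \<in> A \<longleftrightarrow> t \<in> A" for t
    by (simp add: A_def distrib_left flip: cis_mult)
  have shift: "emeasure lborel ((\<lambda>t. d + t) -` S) = emeasure lborel S"
    if "S \<in> sets borel" for d :: real and S
    using that lborel_distr_plus[of d] emeasure_distr[of "(+) d" lborel borel S] by simp
  have "emeasure (distr circle circle (\<lambda>z. \<eta> * z)) B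
      = emeasure circle ((\<lambda>z. \<eta> * z) -` B \<inter> space circle)"
    using rot B by (rule emeasure_distr)
  also have "\<dots> = emeasure lborel ({0..<1} \<inter> {t. c + t \<in> A})"
    using measurable_sets[OF rot B]
    by (subst emeasure_circle) (auto simp: A_def c(3) cis_mult distrib_left)
  also have "{0..<1} \<inter> {t. c + t \<in> A} = (\<lambda>t. c + t) -` ({c..<1+c} \<inter> A)"
    by auto
  also have "emeasure lborel \<dots> = emeasure lborel ({c..<1+c} \<inter> A)"
    by (rule shift) measurable
  also have "{c..<1+c} \<inter> A = ({c..<1} \<inter> A) \<union> ({1..<1+c} \<inter> A)"
    using c by auto
  also have "emeasure lborel \<dots> = emeasure lborel ({c..<1} \<inter> A) + emeasure lborel ({1..<1+c} \<inter> A)"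
    by (rule plus_emeasure[symmetric]) auto
  also have "emeasure lborel ({1..<1+c} \<inter> A) = emeasure lborel ((\<lambda>t. 1 + t) -` ({1..<1+c} \<inter> A))"
    by (rule shift[symmetric]) measurable
  also have "(\<lambda>t. 1 + t) -` ({1..<1+c} \<inter> A) = {0..<c} \<inter> A"
    using per by (auto simp: add.commute)
  also have "emeasure lborel ({c..<1} \<inter> A) + emeasure lborel ({0..<c} \<inter> A)
      = emeasure lborel (({c..<1} \<inter> A) \<union> ({0..<c} \<inter> A))"
    by (rule plus_emeasure) auto
  also have "({c..<1} \<inter> A) \<union> ({0..<c} \<inter> A) = {0..<1} \<inter> A"
    using c by auto
  also have "emeasure lborel \<dots> = emeasure circle B"
    using B by (simp add: emeasure_circle A_def)
  finally show "emeasure (distr circle circle (\<lambda>z. \<eta> * z)) B = emeasure circle B" .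
qed simp

text \<open>
  Together with total mass one (shown above), the following rotation invariance identifies
  the product measure as the normalised Haar measure.
\<close>

lemma torus_rotation_invariant:
  assumes \<eta>: "\<eta> \<in> space torus"
  shows "distr torus torus (\<lambda>\<omega> j. \<eta> j * \<omega> j) = torus"
proof -
  interpret product_prob_space "\<lambda>_::nat. circle" UNIV
    by (rule product_prob_spaceI) (rule prob_space_circle)
  have \<eta>1: "cmod (\<eta> j) = 1" for j
    using \<eta> by (simp add: space_torus)
  have rot: "(\<lambda>z. \<eta> j * z) \<in> circle \<rightarrow>\<^sub>M circle" for j
    unfolding measurable_cong_sets[OF sets_circle sets_circle]
    by (rule measurable_restrict_space3) (auto simp: norm_mult \<eta>1)
  have rots: "(\<lambda>\<omega> j. \<eta> j * \<omega> j) \<in> torus \<rightarrow>\<^sub>M torus"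
    unfolding torus_def
  proof (rule measurable_PiM_single')
    show "(\<lambda>\<omega>. \<eta> j * \<omega> j) \<in> PiM UNIV (\<lambda>_. circle) \<rightarrow>\<^sub>M circle" for j
      using measurable_compose[OF measurable_component_singleton[of j UNIV "\<lambda>_. circle"] rot[of j]]
      by simp
  qed (auto simp: space_PiM norm_mult \<eta>1 PiE_iff)
  have "distr torus torus (\<lambda>\<omega> j. \<eta> j * \<omega> j) = PiM UNIV (\<lambda>_. circle)"
  proof (rule PiM_eq)
    fix J :: "nat set" and F
    assume J: "finite J" "J \<subseteq> UNIV" and F: "\<And>j. j \<in> J \<Longrightarrow> F j \<in> sets circle"
    let ?F = "\<lambda>j. (\<lambda>z. \<eta> j * z) -` F j \<inter> space circle"
    have "emb UNIV J (Pi\<^sub>E J F) \<in> sets torus"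
      unfolding torus_def using J F by (intro sets_PiM_I) auto
    then have "emeasure (distr torus torus (\<lambda>\<omega> j. \<eta> j * \<omega> j)) (emb UNIV J (Pi\<^sub>E J F))
        = emeasure torus ((\<lambda>\<omega> j. \<eta> j * \<omega> j) -` emb UNIV J (Pi\<^sub>E J F) \<inter> space torus)"
      by (rule emeasure_distr[OF rots])
    also have "(\<lambda>\<omega> j. \<eta> j * \<omega> j) -` emb UNIV J (Pi\<^sub>E J F) \<inter> space torus = emb UNIV J (Pi\<^sub>E J ?F)"
      by (auto simp: prod_emb_def space_torus PiE_iff norm_mult \<eta>1)
    also have "emeasure torus \<dots> = (\<Prod>j\<in>J. emeasure circle (?F j))"
      unfolding torus_def using J F measurable_sets[OF rot] by (intro emeasure_PiM_emb) auto
    also have "\<dots> = (\<Prod>j\<in>J. emeasure circle (F j))"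
      using F emeasure_distr[OF rot F] circle_rotation_invariant[OF \<eta>1]
      by (intro prod.cong) metis+
    finally show "emeasure (distr torus torus (\<lambda>\<omega> j. \<eta> j * \<omega> j)) (emb UNIV J (Pi\<^sub>E J F))
        = (\<Prod>j\<in>J. emeasure circle (F j))" .
  qed (simp add: torus_def)
  then show ?thesis by (simp add: torus_def)
qed


section \<open>Hardy space on the torus\<close>

definition eventually_zero :: "(nat \<Rightarrow> 'a::zero) set" where
  "eventually_zero = {\<alpha>. \<forall>\<^sub>F j in sequentially. \<alpha> j = 0}"

definition torus_monomial :: "(nat \<Rightarrow> int) \<Rightarrow> (nat \<Rightarrow> complex) \<Rightarrow> complex" where
  "torus_monomial \<alpha> \<omega> = (\<Prod>j | \<alpha> j \<noteq> 0. \<omega> j powi \<alpha> j)"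

definition fourier_coeff :: "((nat \<Rightarrow> complex) \<Rightarrow> 'x::complex_banach) \<Rightarrow> (nat \<Rightarrow> int) \<Rightarrow> 'x" where
  "fourier_coeff f \<alpha> = strong_integral torus (\<lambda>\<omega>. torus_monomial (\<lambda>j. - \<alpha> j) \<omega> *\<^sub>C f \<omega>)"

text \<open>Elements of the Lebesgue and Hardy spaces are represented by functions,
  not by almost-everywhere classes.\<close>

definition Linf_norm :: "((nat \<Rightarrow> complex) \<Rightarrow> 'x::complex_banach) \<Rightarrow> ereal" where
  "Linf_norm f = esssup torus (\<lambda>\<omega>. ereal (norm (f \<omega>)))"

definition Linf_torus :: "((nat \<Rightarrow> complex) \<Rightarrow> 'x::complex_banach) set" where
  "Linf_torus = {f. strongly_measurable torus f \<and> Linf_norm f < \<infinity>}"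

definition Hinf_torus :: "((nat \<Rightarrow> complex) \<Rightarrow> 'x::complex_banach) set" where
  "Hinf_torus = {f \<in> Linf_torus.
     \<forall>\<alpha> \<in> eventually_zero. (\<exists>j. \<alpha> j < 0) \<longrightarrow> fourier_coeff f \<alpha> = 0}"


section \<open>Spaces of Dirichlet series\<close>

text \<open>A Dirichlet series is its coefficient sequence; the unused index \<open>0\<close> carries the
  value \<open>0\<close>.\<close>

definition dirichlet_series :: "(nat \<Rightarrow> 'x::complex_banach) set" where
  "dirichlet_series = {a. a 0 = 0}"

definition prime_power :: "(nat \<Rightarrow> nat) \<Rightarrow> nat" where
  "prime_power \<alpha> = (\<Prod>j | \<alpha> j \<noteq> 0. enumerate {p. prime p} j ^ \<alpha> j)"

definition represents :: "((nat \<Rightarrow> complex) \<Rightarrow> 'x::complex_banach) \<Rightarrow> (nat \<Rightarrow> 'x) \<Rightarrow> bool" where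
  "represents f a \<longleftrightarrow> f \<in> Hinf_torus \<and>
     (\<forall>\<alpha> \<in> eventually_zero. fourier_coeff f (\<lambda>j. int (\<alpha> j)) = a (prime_power \<alpha>))"

definition Hinf :: "(nat \<Rightarrow> 'x::complex_banach) set" where
  "Hinf = {a \<in> dirichlet_series. \<exists>f. represents f a}"

text \<open>The representing function is unique up to null sets, so the choice is immaterial.\<close>

definition Hinf_norm :: "(nat \<Rightarrow> 'x::complex_banach) \<Rightarrow> ereal" where
  "Hinf_norm a = Linf_norm (SOME f. represents f a)"

definition translate :: "real \<Rightarrow> (nat \<Rightarrow> 'x::complex_banach) \<Rightarrow> nat \<Rightarrow> 'x" where
  "translate \<epsilon> a n = a n /\<^sub>R (real n powr \<epsilon>)"

definition Hinf_plus_norm :: "(nat \<Rightarrow> 'x::complex_banach) \<Rightarrow> ereal" where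
  "Hinf_plus_norm a = (SUP \<epsilon>\<in>{0<..}. Hinf_norm (translate \<epsilon> a))"

definition Hinf_plus :: "(nat \<Rightarrow> 'x::complex_banach) set" where
  "Hinf_plus = {a \<in> dirichlet_series.
     (\<forall>\<epsilon>>0. translate \<epsilon> a \<in> Hinf) \<and> Hinf_plus_norm a < \<infinity>}"

definition dirichlet_term :: "(nat \<Rightarrow> 'x::complex_banach) \<Rightarrow> complex \<Rightarrow> nat \<Rightarrow> 'x" where
  "dirichlet_term a s n = (of_nat n powr (- s)) *\<^sub>C a n"

definition right_half_plane :: "complex set" where
  "right_half_plane = {s. Re s > 0}"

definition Dinf_norm :: "(nat \<Rightarrow> 'x::complex_banach) \<Rightarrow> ereal" where
  "Dinf_norm a = (SUP s\<in>right_half_plane. ereal (norm (\<Sum>n. dirichlet_term a s n)))"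

definition Dinf :: "(nat \<Rightarrow> 'x::complex_banach) set" where
  "Dinf = {a \<in> dirichlet_series.
     (\<forall>s\<in>right_half_plane. summable (dirichlet_term a s)) \<and>
     bounded ((\<lambda>s. \<Sum>n. dirichlet_term a s n) ` right_half_plane)}"

end

theory Submission
  imports Defs
begin

text \<open>
  The two spaces are linked by Bohr's transform. Along the flow \<open>t \<mapsto> (p\<^sub>j\<^sup>-\<^sup>i\<^sup>t)\<^sub>j\<close> on the torus, the
  monomial whose exponents are the prime exponents of \<open>n\<close> takes the value \<open>n\<^sup>-\<^sup>i\<^sup>t\<close>. Kronecker's
  theorem says that this flow is dense, because the numbers \<open>ln p\<^sub>j\<close> are linearly independent over
  the integers. Hence a polynomial on the torus is bounded by the supremum of the corresponding
  Dirichlet polynomial over a vertical line (\<open>norm_torus_polynomial_le\<close>). The remaining issue in both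
  inclusions is convergence: neither the Fourier series of a bounded function nor a Dirichlet series
  that converges conditionally is under control through its partial sums alone.

  The tool for this is an estimate of Bohr's type: if \<open>\<Sum> c\<^sub>n n\<^sup>-\<^sup>i\<^sup>t\<close> is a Dirichlet polynomial with norm at
  most \<open>M\<close> for all real \<open>t\<close>, then its partial sums up to \<open>N\<close> have norm at most \<open>C N\<^sup>\<delta> M\<close>, where \<open>C\<close>
  depends on \<open>\<delta> > 0\<close> alone (\<open>norm_partial_sum_le_of_bounded_dirichlet_polynomial\<close>). It comes from
  integrating the polynomial against a kernel whose Fourier transform is 1 on \<open>[0, ln N]\<close> and 0 beyond
  \<open>ln (N + 1)\<close>, so that it cuts the sum off exactly after \<open>N\<close>. Summation by parts turns this growth
  into a bound for the tails after a shift of the line by any \<open>\<epsilon> > \<delta>\<close>. Besides \<open>\<delta>\<close>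
  and \<open>\<epsilon>\<close> it depends on \<open>M\<close> only, so it is uniform over all polynomials and all points of the line
  (\<open>uniform_dirichlet_tail_bound\<close>).

  From Hardy functions to Dirichlet series: Fejer means on the torus replace a function \<open>f\<close> in
  \<open>H\<^sub>\<infinity>\<close> by Dirichlet polynomials that are bounded by the norm of \<open>f\<close> and whose coefficients tend to
  those of \<open>f\<close> (\<open>norm_fejer_dirichlet_polynomial_le\<close>, \<open>fejer_weight_tendsto_1\<close>). The uniform tail
  bound passes to the limit. It gives convergence of the Dirichlet series in the open half plane, and
  the bound by the norm of \<open>f\<close> survives (\<open>dirichlet_series_converges_of_Hardy\<close>).

  From Dirichlet series to Hardy functions: averaging the limit function over a vertical line against a
  Gaussian yields a series with rapidly decaying coefficients, bounded up to a constant like the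
  original one. The estimate for partial sums applies to it and survives when the width of the
  Gaussian tends to 0, so the Dirichlet series converges uniformly on every line \<open>Re s = \<epsilon>\<close>
  (\<open>dirichlet_series_uniform_tails\<close>). By density of the flow the associated polynomials converge
  uniformly on the torus, and their limit represents the translated series without increasing the norm
  (\<open>torus_series_represents\<close>).

  Finally, a bounded function on the torus is determined almost everywhere by its Fourier coefficients
  (\<open>Linf_norm_eqI_fourier_coeff\<close>), so the norm of a series may be computed from any function that
  represents it, and the two inequalities between the norms combine to an equality. Vector-valued
  integrals enter these estimates only through the triangle inequality for integrals, which makes
  scalar kernels act on polynomials with values in \<open>X\<close> (\<open>norm_sum_integral_scaleC_le\<close>).
\<close>

section \<open>Strongly measurable functions and their integrals\<close>

lemma bounded_bilinear_scaleC:
  "bounded_bilinear (scaleC :: complex \<Rightarrow> 'x \<Rightarrow> 'x::complex_banach)"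
proof
  fix r :: real and a :: complex and b :: 'x
  show "(r *\<^sub>R a) *\<^sub>C b = r *\<^sub>R (a *\<^sub>C b)"
    by (simp only: scaleC_of_real[of r "a *\<^sub>C b", symmetric] scaleC_scaleC scaleR_conv_of_real[of r a])
  show "a *\<^sub>C (r *\<^sub>R b) = r *\<^sub>R (a *\<^sub>C b)"
    by (simp only: scaleC_of_real[of r "a *\<^sub>C b", symmetric] scaleC_of_real[of r b, symmetric]
        scaleC_scaleC mult.commute)
  show "\<exists>K. \<forall>(a::complex) (b::'x). norm (a *\<^sub>C b) \<le> norm a * norm b * K"
    by (rule exI[of _ 1]) (simp add: norm_scaleC)
qed (simp_all add: scaleC_add_left scaleC_add_right)

interpretation scaleC: bounded_bilinear "scaleC :: complex \<Rightarrow> 'x \<Rightarrow> 'x::complex_banach"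
  by (rule bounded_bilinear_scaleC)

lemma scaleC_one [simp]: "1 *\<^sub>C x = (x :: 'x::complex_banach)"
  using scaleC_of_real[of 1 x] by simp

text \<open>
  Pointwise limits of simple functions are preserved by every operation that is sequentially
  continuous, which covers sums, differences, norms and products with scalar functions.
\<close>

lemma strongly_measurable_compose2:
  assumes "strongly_measurable M f" "strongly_measurable M g"
    and "\<And>x y u v. u \<longlonglongrightarrow> x \<Longrightarrow> v \<longlonglongrightarrow> y \<Longrightarrow> (\<lambda>i::nat. p (u i) (v i)) \<longlonglongrightarrow> p x y"
  shows "strongly_measurable M (\<lambda>x. p (f x) (g x))"
proof -
  obtain s where s: "\<And>i. simple_function M (s i)" "\<And>x. x \<in> space M \<Longrightarrow> (\<lambda>i. s i x) \<longlonglongrightarrow> f x"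
    using assms(1) unfolding strongly_measurable_def by blast
  obtain t where t: "\<And>i. simple_function M (t i)" "\<And>x. x \<in> space M \<Longrightarrow> (\<lambda>i. t i x) \<longlonglongrightarrow> g x"
    using assms(2) unfolding strongly_measurable_def by blast
  show ?thesis
    unfolding strongly_measurable_def
  proof (intro exI[of _ "\<lambda>i x. p (s i x) (t i x)"] conjI allI ballI)
    show "simple_function M (\<lambda>x. p (s i x) (t i x))" for i
      by (rule simple_function_compose2[OF s(1) t(1)])
    show "(\<lambda>i. p (s i x) (t i x)) \<longlonglongrightarrow> p (f x) (g x)" if "x \<in> space M" for x
      by (rule assms(3)[OF s(2)[OF that] t(2)[OF that]])
  qed
qed

lemma strongly_measurable_simple: "simple_function M s \<Longrightarrow> strongly_measurable M s"
  unfolding strongly_measurable_def by (intro exI[of _ "\<lambda>_. s"]) auto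

lemma strongly_measurable_const: "strongly_measurable M (\<lambda>_. c)"
  by (intro strongly_measurable_simple) auto

lemma strongly_measurable_add:
  "strongly_measurable M f \<Longrightarrow> strongly_measurable M g \<Longrightarrow> strongly_measurable M (\<lambda>x. f x + g x)"
  by (rule strongly_measurable_compose2[where p = "(+)"]) (auto intro: tendsto_intros)

lemma strongly_measurable_diff:
  "strongly_measurable M f \<Longrightarrow> strongly_measurable M g \<Longrightarrow> strongly_measurable M (\<lambda>x. f x - g x)"
  by (rule strongly_measurable_compose2[where p = "(-)"]) (auto intro: tendsto_intros)

lemma strongly_measurable_scaleC:
  fixes f :: "'a \<Rightarrow> 'x::complex_banach"
  assumes "g \<in> borel_measurable M" "strongly_measurable M f"
  shows "strongly_measurable M (\<lambda>x. g x *\<^sub>C f x)"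
  by (rule strongly_measurable_compose2[where p = scaleC])
     (use assms in \<open>auto simp: strongly_measurable_iff_borel_measurable intro: scaleC.tendsto\<close>)

lemma strongly_measurable_sum:
  "(\<And>i. i \<in> I \<Longrightarrow> strongly_measurable M (f i)) \<Longrightarrow> strongly_measurable M (\<lambda>x. \<Sum>i\<in>I. f i x)"
  by (induction I rule: infinite_finite_induct)
     (auto intro: strongly_measurable_const strongly_measurable_add)

lemma borel_measurable_norm_strongly_measurable:
  assumes "strongly_measurable M f"
  shows "(\<lambda>x. norm (f x)) \<in> borel_measurable M"
proof -
  have "strongly_measurable M (\<lambda>x. norm (f x))"
    by (rule strongly_measurable_compose2[OF assms assms, where p = "\<lambda>x _. norm x"])
       (rule tendsto_norm)
  then show ?thesis by (simp add: strongly_measurable_iff_borel_measurable)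
qed

abbreviation (input) simple_integrable :: "'a measure \<Rightarrow> ('a \<Rightarrow> 'b::real_vector) \<Rightarrow> bool" where
  "simple_integrable \<equiv> Bochner_Integration.simple_bochner_integrable"

abbreviation (input) simple_integral_of :: "'a measure \<Rightarrow> ('a \<Rightarrow> 'b::real_vector) \<Rightarrow> 'b" where
  "simple_integral_of \<equiv> Bochner_Integration.simple_bochner_integral"

lemma simple_bochner_integral_norm_le_nn_integral:
  assumes "simple_integrable M s"
  shows "ennreal (norm (simple_integral_of M s)) \<le> (\<integral>\<^sup>+x. ennreal (norm (s x)) \<partial>M)"
proof -
  have "simple_integrable M (\<lambda>x. norm (s x))"
    by (rule simple_bochner_integrable_compose2[where p = "\<lambda>x _. norm x", OF _ assms assms]) simp
  then have "ennreal (simple_integral_of M (\<lambda>x. norm (s x))) = (\<integral>\<^sup>+x. ennreal (norm (s x)) \<partial>M)"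
    by (rule simple_bochner_integral_eq_nn_integral) simp
  then show ?thesis
    using simple_bochner_integral_norm_bound[OF assms] by (metis ennreal_leI)
qed

text \<open>
  The inequality holds for simple functions and passes to the limit, since the integrals of
  \<open>\<parallel>f - s\<^sub>i\<parallel>\<close> tend to 0. Applied to differences, it yields uniqueness of the integral.
\<close>

lemma has_strong_integral_norm_le:
  fixes f :: "'a \<Rightarrow> 'b::real_normed_vector"
  assumes "has_strong_integral M f y"
  shows "ennreal (norm y) \<le> (\<integral>\<^sup>+x. ennreal (norm (f x)) \<partial>M)"
proof -
  obtain s where f: "strongly_measurable M f"
    and s: "\<And>i. simple_integrable M (s i)"
    and 1: "(\<lambda>i. \<integral>\<^sup>+x. ennreal (norm (f x - s i x)) \<partial>M) \<longlonglongrightarrow> 0"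
    and 2: "(\<lambda>i. simple_integral_of M (s i)) \<longlonglongrightarrow> y"
    using assms unfolding has_strong_integral_def by blast
  have sm: "strongly_measurable M (s i)" for i
    using s[of i] by (auto elim: simple_bochner_integrable.cases intro: strongly_measurable_simple)
  note [measurable] = borel_measurable_norm_strongly_measurable[OF f]
    borel_measurable_norm_strongly_measurable[OF strongly_measurable_diff[OF f sm]]
  have le: "ennreal (norm (simple_integral_of M (s i)))
      \<le> (\<integral>\<^sup>+x. ennreal (norm (f x)) \<partial>M) + (\<integral>\<^sup>+x. ennreal (norm (f x - s i x)) \<partial>M)" for i
  proof -
    have "ennreal (norm (simple_integral_of M (s i))) \<le> (\<integral>\<^sup>+x. ennreal (norm (s i x)) \<partial>M)"
      by (rule simple_bochner_integral_norm_le_nn_integral[OF s])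
    also have "\<dots> \<le> (\<integral>\<^sup>+x. ennreal (norm (f x)) + ennreal (norm (f x - s i x)) \<partial>M)"
    proof (rule nn_integral_mono)
      fix x
      have "norm (s i x) \<le> norm (f x) + norm (f x - s i x)"
        by (metis add.commute norm_minus_commute norm_triangle_sub)
      then show "ennreal (norm (s i x)) \<le> ennreal (norm (f x)) + ennreal (norm (f x - s i x))"
        by (simp flip: ennreal_plus)
    qed
    also have "\<dots> = (\<integral>\<^sup>+x. ennreal (norm (f x)) \<partial>M) + (\<integral>\<^sup>+x. ennreal (norm (f x - s i x)) \<partial>M)"
      by (rule nn_integral_add) auto
    finally show ?thesis .
  qed
  have lim: "(\<lambda>i. (\<integral>\<^sup>+x. ennreal (norm (f x)) \<partial>M) + (\<integral>\<^sup>+x. ennreal (norm (f x - s i x)) \<partial>M))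
      \<longlonglongrightarrow> (\<integral>\<^sup>+x. ennreal (norm (f x)) \<partial>M) + 0"
    by (intro tendsto_add tendsto_const 1)
  have "(\<lambda>i. ennreal (norm (simple_integral_of M (s i)))) \<longlonglongrightarrow> ennreal (norm y)"
    using 2 by (intro tendsto_ennrealI tendsto_norm)
  from LIMSEQ_le[OF this lim] le show ?thesis by auto
qed

lemma has_strong_integral_add:
  fixes f g :: "'a \<Rightarrow> 'b::real_normed_vector"
  assumes "has_strong_integral M f y" "has_strong_integral M g z"
  shows "has_strong_integral M (\<lambda>x. f x + g x) (y + z)"
proof -
  obtain s where f: "strongly_measurable M f"
    and s: "\<And>i. simple_integrable M (s i)"
    and 1: "(\<lambda>i. \<integral>\<^sup>+x. ennreal (norm (f x - s i x)) \<partial>M) \<longlonglongrightarrow> 0"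
    and 2: "(\<lambda>i. simple_integral_of M (s i)) \<longlonglongrightarrow> y"
    using assms(1) unfolding has_strong_integral_def by blast
  obtain t where g: "strongly_measurable M g"
    and t: "\<And>i. simple_integrable M (t i)"
    and 3: "(\<lambda>i. \<integral>\<^sup>+x. ennreal (norm (g x - t i x)) \<partial>M) \<longlonglongrightarrow> 0"
    and 4: "(\<lambda>i. simple_integral_of M (t i)) \<longlonglongrightarrow> z"
    using assms(2) unfolding has_strong_integral_def by blast
  have sm: "strongly_measurable M (s i)" "strongly_measurable M (t i)" for i
    using s[of i] t[of i] by (auto elim: simple_bochner_integrable.cases intro: strongly_measurable_simple)
  note [measurable] = borel_measurable_norm_strongly_measurable[OF strongly_measurable_diff[OF f sm(1)]]
    borel_measurable_norm_strongly_measurable[OF strongly_measurable_diff[OF g sm(2)]]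
  have le: "(\<integral>\<^sup>+x. ennreal (norm (f x + g x - (s i x + t i x))) \<partial>M)
      \<le> (\<integral>\<^sup>+x. ennreal (norm (f x - s i x)) \<partial>M) + (\<integral>\<^sup>+x. ennreal (norm (g x - t i x)) \<partial>M)" for i
  proof -
    have "(\<integral>\<^sup>+x. ennreal (norm (f x + g x - (s i x + t i x))) \<partial>M)
        \<le> (\<integral>\<^sup>+x. ennreal (norm (f x - s i x)) + ennreal (norm (g x - t i x)) \<partial>M)"
      by (auto intro!: nn_integral_mono norm_diff_triangle_ineq simp flip: ennreal_plus)
    also have "\<dots> = (\<integral>\<^sup>+x. ennreal (norm (f x - s i x)) \<partial>M) + (\<integral>\<^sup>+x. ennreal (norm (g x - t i x)) \<partial>M)"
      by (rule nn_integral_add) auto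
    finally show ?thesis .
  qed
  have "(\<lambda>i. \<integral>\<^sup>+x. ennreal (norm (f x + g x - (s i x + t i x))) \<partial>M) \<longlonglongrightarrow> 0"
    by (rule tendsto_sandwich[OF _ _ tendsto_const tendsto_add[OF 1 3, simplified]])
       (auto intro!: always_eventually le)
  moreover have "(\<lambda>i. simple_integral_of M (\<lambda>x. s i x + t i x)) \<longlonglongrightarrow> y + z"
    by (simp add: simple_bochner_integral_add s t tendsto_add 2 4)
  moreover have "simple_integrable M (\<lambda>x. s i x + t i x)" for i
    by (rule simple_bochner_integrable_compose2[OF _ s t]) simp
  ultimately show ?thesis
    unfolding has_strong_integral_def using strongly_measurable_add[OF f g]
    by (intro conjI exI[of _ "\<lambda>i x. s i x + t i x"]) auto
qed

lemma has_strong_integral_bounded_linear: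
  fixes f :: "'a \<Rightarrow> 'b::real_normed_vector" and T :: "'b \<Rightarrow> 'c::real_normed_vector"
  assumes T: "bounded_linear T" and "has_strong_integral M f y"
  shows "has_strong_integral M (\<lambda>x. T (f x)) (T y)"
proof -
  interpret T: bounded_linear T by fact
  obtain K where K: "K > 0" "\<And>x. norm (T x) \<le> norm x * K"
    using T.pos_bounded by blast
  obtain s where f: "strongly_measurable M f"
    and s: "\<And>i. simple_integrable M (s i)"
    and 1: "(\<lambda>i. \<integral>\<^sup>+x. ennreal (norm (f x - s i x)) \<partial>M) \<longlonglongrightarrow> 0"
    and 2: "(\<lambda>i. simple_integral_of M (s i)) \<longlonglongrightarrow> y"
    using assms unfolding has_strong_integral_def by blast
  have sm: "strongly_measurable M (s i)" for i
    using s[of i] by (auto elim: simple_bochner_integrable.cases intro: strongly_measurable_simple)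
  note [measurable] = borel_measurable_norm_strongly_measurable[OF strongly_measurable_diff[OF f sm]]
  have le: "(\<integral>\<^sup>+x. ennreal (norm (T (f x) - T (s i x))) \<partial>M)
      \<le> ennreal K * (\<integral>\<^sup>+x. ennreal (norm (f x - s i x)) \<partial>M)" for i
  proof -
    have "(\<integral>\<^sup>+x. ennreal (norm (T (f x) - T (s i x))) \<partial>M)
        \<le> (\<integral>\<^sup>+x. ennreal K * ennreal (norm (f x - s i x)) \<partial>M)"
      using K by (auto intro!: nn_integral_mono ennreal_leI simp: mult.commute simp flip: ennreal_mult T.diff)
    then show ?thesis by (simp add: nn_integral_cmult)
  qed
  have "(\<lambda>i. ennreal K * (\<integral>\<^sup>+x. ennreal (norm (f x - s i x)) \<partial>M)) \<longlonglongrightarrow> ennreal K * 0"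
    by (rule ennreal_tendsto_cmult[OF _ 1]) simp
  then have L: "(\<lambda>i. ennreal K * (\<integral>\<^sup>+x. ennreal (norm (f x - s i x)) \<partial>M)) \<longlonglongrightarrow> 0"
    by simp
  have "(\<lambda>i. \<integral>\<^sup>+x. ennreal (norm (T (f x) - T (s i x))) \<partial>M) \<longlonglongrightarrow> 0"
    by (rule tendsto_sandwich[OF _ _ tendsto_const L]) (auto intro!: always_eventually le)
  moreover have "(\<lambda>i. simple_integral_of M (\<lambda>x. T (s i x))) \<longlonglongrightarrow> T y"
    by (simp add: simple_bochner_integral_linear[OF T.linear_axioms s] T.tendsto 2)
  moreover have "simple_integrable M (\<lambda>x. T (s i x))" for i
    by (rule simple_bochner_integrable_compose2[OF _ s s, where p = "\<lambda>x _. T x"]) simp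
  moreover have "strongly_measurable M (\<lambda>x. T (f x))"
    by (rule strongly_measurable_compose2[OF f f, where p = "\<lambda>x _. T x"]) (rule T.tendsto)
  ultimately show ?thesis
    unfolding has_strong_integral_def by (intro conjI exI[of _ "\<lambda>i x. T (s i x)"]) auto
qed

lemma has_strong_integral_zero: "has_strong_integral M (\<lambda>_. 0) 0"
  using has_strong_integral_bounded_linear[OF bounded_linear_zero, of M "\<lambda>_. 0::real" 0]
  by (simp add: has_strong_integral_iff_has_bochner_integral has_bochner_integral_zero)

lemma has_strong_integral_scaleC:
  fixes f :: "'a \<Rightarrow> 'x::complex_banach"
  shows "has_strong_integral M f y \<Longrightarrow> has_strong_integral M (\<lambda>x. c *\<^sub>C f x) (c *\<^sub>C y)"
  by (rule has_strong_integral_bounded_linear[OF scaleC.bounded_linear_right])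

lemma has_strong_integral_diff:
  assumes "has_strong_integral M f y" "has_strong_integral M g z"
  shows "has_strong_integral M (\<lambda>x. f x - g x) (y - z)"
  using has_strong_integral_add[OF assms(1)
      has_strong_integral_bounded_linear[OF bounded_linear_minus[OF bounded_linear_ident] assms(2)]]
  by simp

lemma has_strong_integral_sum:
  "(\<And>i. i \<in> I \<Longrightarrow> has_strong_integral M (f i) (y i)) \<Longrightarrow>
    has_strong_integral M (\<lambda>x. \<Sum>i\<in>I. f i x) (\<Sum>i\<in>I. y i)"
  by (induction I rule: infinite_finite_induct)
     (auto intro: has_strong_integral_zero has_strong_integral_add)

lemma has_strong_integral_scalar:
  fixes b :: "'x::complex_banach"
  assumes "integrable M g"
  shows "has_strong_integral M (\<lambda>x. g x *\<^sub>C b) (integral\<^sup>L M g *\<^sub>C b)"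
  using assms
  by (intro has_strong_integral_bounded_linear[OF scaleC.bounded_linear_left])
     (simp add: has_strong_integral_iff_has_bochner_integral has_bochner_integral_integrable)

lemma has_strong_integral_unique:
  assumes "has_strong_integral M f y" "has_strong_integral M f z"
  shows "y = z"
  using has_strong_integral_norm_le[OF has_strong_integral_diff[OF assms]] by simp

lemma strong_integral_eqI: "has_strong_integral M f y \<Longrightarrow> strong_integral M f = y"
  unfolding strong_integral_def by (blast intro: has_strong_integral_unique)

lemma has_strong_integral_norm_le_integral:
  assumes "has_strong_integral M f y" and "integrable M h" and "AE x in M. norm (f x) \<le> h x"
  shows "norm y \<le> integral\<^sup>L M h"
proof -
  have nn: "AE x in M. 0 \<le> h x"
    using assms(3) by eventually_elim (meson norm_ge_zero order_trans)
  have "ennreal (norm y) \<le> (\<integral>\<^sup>+x. ennreal (norm (f x)) \<partial>M)"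
    by (rule has_strong_integral_norm_le[OF assms(1)])
  also have "\<dots> \<le> (\<integral>\<^sup>+x. ennreal (h x) \<partial>M)"
    using assms(3) by (intro nn_integral_mono_AE) (auto elim!: eventually_mono intro: ennreal_leI)
  also have "\<dots> = ennreal (integral\<^sup>L M h)"
    by (rule nn_integral_eq_integral[OF assms(2) nn])
  finally show ?thesis
    using nn by (simp add: integral_nonneg_AE)
qed

text \<open>
  The form in which vector-valued integration is used: a bound for a finite sum with vector
  coefficients, valid pointwise under scalar integrands, carries over to the sum of the integrals.
\<close>

lemma norm_sum_integral_scaleC_le:
  fixes c :: "'i \<Rightarrow> 'x::complex_banach"
  assumes g: "\<And>i. i \<in> I \<Longrightarrow> integrable M (g i)" and h: "integrable M h"
    and le: "AE x in M. norm (\<Sum>i\<in>I. g i x *\<^sub>C c i) \<le> h x"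
  shows "norm (\<Sum>i\<in>I. integral\<^sup>L M (g i) *\<^sub>C c i) \<le> integral\<^sup>L M h"
  by (rule has_strong_integral_norm_le_integral[OF has_strong_integral_sum h le])
     (rule has_strong_integral_scalar[OF g])

text \<open>
  Cutting the approximating simple functions off at norm \<open>C + 1\<close> does not disturb their convergence to
  \<open>f\<close>, and makes dominated convergence applicable. The integrals of the cut-off functions then form a
  Cauchy sequence.
\<close>

lemma has_strong_integral_exists_bounded:
  fixes f :: "'a \<Rightarrow> 'x::banach"
  assumes M: "finite_measure M" and f: "strongly_measurable M f" and bd: "AE x in M. norm (f x) \<le> C"
  shows "\<exists>y. has_strong_integral M f y"
proof -
  interpret finite_measure M by fact
  obtain s where s: "\<And>i. simple_function M (s i)" and lim: "\<And>x. x \<in> space M \<Longrightarrow> (\<lambda>i. s i x) \<longlonglongrightarrow> f x"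
    using f unfolding strongly_measurable_def by blast
  define t where "t i x = (if norm (s i x) \<le> C + 1 then s i x else 0)" for i x
  have t: "simple_function M (t i)" for i
    unfolding t_def by (rule simple_function_compose1[OF s, where g = "\<lambda>y. if norm y \<le> C + 1 then y else 0"])
  have tb: "simple_integrable M (t i)" for i
    by (rule simple_bochner_integrable.intros[OF t]) simp
  note [measurable] = borel_measurable_norm_strongly_measurable
    [OF strongly_measurable_diff[OF f strongly_measurable_simple[OF t]]]
    borel_measurable_norm_strongly_measurable[OF strongly_measurable_diff[OF 
      strongly_measurable_simple[OF t] strongly_measurable_simple[OF t]]]
  have tlim: "(\<lambda>i. t i x) \<longlonglongrightarrow> f x" if "x \<in> space M" "norm (f x) \<le> C" for x
  proof -
    have "eventually (\<lambda>i. norm (s i x) < C + 1) sequentially"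
      using tendsto_norm[OF lim[OF that(1)]] that(2) by (intro order_tendstoD) auto
    then have "eventually (\<lambda>i. t i x = s i x) sequentially"
      by eventually_elim (simp add: t_def)
    then show ?thesis
      using lim[OF that(1)] by (simp add: tendsto_cong)
  qed
  have 1: "(\<lambda>i. \<integral>\<^sup>+x. ennreal (norm (f x - t i x)) \<partial>M) \<longlonglongrightarrow> (\<integral>\<^sup>+x. 0 \<partial>M)"
  proof (rule nn_integral_dominated_convergence)
    show "(\<integral>\<^sup>+x. ennreal (2 * \<bar>C\<bar> + 1) \<partial>M) < \<infinity>"
      by (simp add: ennreal_mult_less_top emeasure_eq_measure)
    show "AE x in M. ennreal (norm (f x - t i x)) \<le> ennreal (2 * \<bar>C\<bar> + 1)" for i
      using bd
    proof eventually_elim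
      case (elim x)
      have "norm (t i x) \<le> \<bar>C\<bar> + 1" by (auto simp: t_def)
      then show ?case
        using elim norm_triangle_ineq4[of "f x" "t i x"] by (intro ennreal_leI) linarith
    qed
    show "AE x in M. (\<lambda>i. ennreal (norm (f x - t i x))) \<longlonglongrightarrow> 0"
      using bd AE_space
    proof eventually_elim
      case (elim x)
      have "(\<lambda>i. ennreal (norm (f x - t i x))) \<longlonglongrightarrow> ennreal (norm (f x - f x))"
        by (intro tendsto_intros tlim elim)
      then show ?case by simp
    qed
  qed auto
  define I where "I i = simple_integral_of M (t i)" for i
  have diff: "ennreal (norm (I i - I j)) \<le> (\<integral>\<^sup>+x. ennreal (norm (f x - t i x)) \<partial>M) + (\<integral>\<^sup>+x. ennreal (norm (f x - t j x)) \<partial>M)"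
    for i j
  proof -
    have "ennreal (norm (I i - I j)) \<le> (\<integral>\<^sup>+x. ennreal (norm (t i x - t j x)) \<partial>M)"
      using simple_bochner_integral_norm_le_nn_integral[OF simple_bochner_integrable_compose2[OF _ tb[of i] tb[of j], of "(-)"]]
      by (simp add: I_def simple_bochner_integral_diff tb)
    also have "\<dots> \<le> (\<integral>\<^sup>+x. ennreal (norm (f x - t i x)) + ennreal (norm (f x - t j x)) \<partial>M)"
    proof (rule nn_integral_mono)
      fix x
      have "norm (t i x - t j x) \<le> norm (f x - t i x) + norm (f x - t j x)"
        by (metis dual_order.refl norm_diff_triangle_le norm_minus_commute)
      then show "ennreal (norm (t i x - t j x)) \<le> ennreal (norm (f x - t i x)) + ennreal (norm (f x - t j x))"
        by (simp flip: ennreal_plus)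
    qed
    also have "\<dots> = (\<integral>\<^sup>+x. ennreal (norm (f x - t i x)) \<partial>M) + (\<integral>\<^sup>+x. ennreal (norm (f x - t j x)) \<partial>M)"
      by (rule nn_integral_add) auto
    finally show ?thesis .
  qed
  have "Cauchy I"
  proof (rule metric_CauchyI)
    fix e :: real assume "e > 0"
    then have "0 < ennreal (e / 2)" by simp
    with 1 have "eventually (\<lambda>i. (\<integral>\<^sup>+x. ennreal (norm (f x - t i x)) \<partial>M) < ennreal (e / 2)) sequentially"
      by (intro order_tendstoD) auto
    then obtain N where N: "\<And>i. i \<ge> N \<Longrightarrow> (\<integral>\<^sup>+x. ennreal (norm (f x - t i x)) \<partial>M) < ennreal (e / 2)"
      by (auto simp: eventually_sequentially)
    have "dist (I i) (I j) < e" if "i \<ge> N" "j \<ge> N" for i j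
    proof -
      have "ennreal (norm (I i - I j)) < ennreal (e / 2) + ennreal (e / 2)"
        using diff[of i j] N[OF that(1)] N[OF that(2)] by (meson add_strict_mono le_less_trans)
      also have "\<dots> = ennreal e" using \<open>e > 0\<close> by (simp flip: ennreal_plus)
      finally show ?thesis by (simp add: dist_norm ennreal_less_iff)
    qed
    then show "\<exists>N. \<forall>i\<ge>N. \<forall>j\<ge>N. dist (I i) (I j) < e" by blast
  qed
  then obtain y where "I \<longlonglongrightarrow> y"
    using Cauchy_convergent convergent_def by blast
  then show ?thesis
    unfolding has_strong_integral_def using f tb 1 unfolding I_def by auto
qed


section \<open>Monomials on the torus and uniqueness of Fourier coefficients\<close>

lemma finite_nonzero_iff_eventually_zero: "\<alpha> \<in> eventually_zero \<longleftrightarrow> finite {j. \<alpha> j \<noteq> 0}"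
  by (simp add: eventually_zero_def flip: cofinite_eq_sequentially eventually_cofinite)

lemma torus_monomial_eq_prod:
  "finite S \<Longrightarrow> {j. \<alpha> j \<noteq> 0} \<subseteq> S \<Longrightarrow> torus_monomial \<alpha> \<omega> = (\<Prod>j\<in>S. \<omega> j powi \<alpha> j)"
  unfolding torus_monomial_def by (rule prod.mono_neutral_left) auto

lemma torus_monomial_0 [simp]: "torus_monomial (\<lambda>_. 0) \<omega> = 1"
  by (simp add: torus_monomial_def)

lemma torus_monomial_add:
  assumes "\<alpha> \<in> eventually_zero" "\<beta> \<in> eventually_zero" "\<omega> \<in> space torus"
  shows "torus_monomial (\<lambda>j. \<alpha> j + \<beta> j) \<omega> = torus_monomial \<alpha> \<omega> * torus_monomial \<beta> \<omega>"
proof -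
  let ?S = "{j. \<alpha> j \<noteq> 0} \<union> {j. \<beta> j \<noteq> 0}"
  have S: "finite ?S" using assms(1,2) by (simp add: finite_nonzero_iff_eventually_zero)
  have nz: "\<omega> j \<noteq> 0" for j
    using assms(3) unfolding space_torus by (metis (mono_tags) mem_Collect_eq norm_zero zero_neq_one)
  have "torus_monomial (\<lambda>j. \<alpha> j + \<beta> j) \<omega> = (\<Prod>j\<in>?S. \<omega> j powi (\<alpha> j + \<beta> j))"
    by (rule torus_monomial_eq_prod[OF S]) auto
  also have "\<dots> = (\<Prod>j\<in>?S. \<omega> j powi \<alpha> j) * (\<Prod>j\<in>?S. \<omega> j powi \<beta> j)"
    by (simp add: power_int_add nz prod.distrib)
  also have "\<dots> = torus_monomial \<alpha> \<omega> * torus_monomial \<beta> \<omega>"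
    using torus_monomial_eq_prod[OF S, of \<alpha> \<omega>] torus_monomial_eq_prod[OF S, of \<beta> \<omega>] by auto
  finally show ?thesis .
qed

lemma norm_torus_monomial: "\<omega> \<in> space torus \<Longrightarrow> cmod (torus_monomial \<alpha> \<omega>) = 1"
  by (simp add: torus_monomial_def space_torus norm_power_int flip: prod_norm)

lemma torus_monomial_mult:
  "torus_monomial \<alpha> (\<lambda>j. \<eta> j * \<omega> j) = torus_monomial \<alpha> \<eta> * torus_monomial \<alpha> \<omega>"
  by (simp add: torus_monomial_def power_int_mult_distrib prod.distrib)

lemma torus_monomial_uminus:
  assumes "\<omega> \<in> space torus"
  shows "torus_monomial (\<lambda>j. - \<alpha> j) \<omega> = cnj (torus_monomial \<alpha> \<omega>)"
proof -
  have "torus_monomial (\<lambda>j. - \<alpha> j) \<omega> = inverse (torus_monomial \<alpha> \<omega>)"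
    by (simp add: torus_monomial_def power_int_minus prod_inversef[unfolded comp_def])
  also have "\<dots> = cnj (torus_monomial \<alpha> \<omega>)"
    using norm_torus_monomial[OF assms, of \<alpha>]
    by (intro inverse_unique) (simp flip: complex_norm_square)
  finally show ?thesis .
qed

lemma measurable_torus_component [measurable]: "(\<lambda>\<omega>. \<omega> j) \<in> borel_measurable torus"
proof -
  have "(\<lambda>\<omega>. \<omega> j) \<in> torus \<rightarrow>\<^sub>M circle"
    unfolding torus_def by (rule measurable_component_singleton) simp
  moreover have "(\<lambda>z. z) \<in> borel_measurable circle"
    unfolding measurable_cong_sets[OF sets_circle refl] by (rule measurable_restrict_space1) simp
  ultimately show ?thesis by (rule measurable_compose)
qed

lemma measurable_torus_monomial [measurable]: "torus_monomial \<alpha> \<in> borel_measurable torus"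
  unfolding torus_monomial_def power_int_def by measurable

lemma integrable_torus_bounded:
  fixes g :: "(nat \<Rightarrow> complex) \<Rightarrow> 'b::{banach, second_countable_topology}"
  assumes "g \<in> borel_measurable torus" "\<And>\<omega>. \<omega> \<in> space torus \<Longrightarrow> norm (g \<omega>) \<le> C"
  shows "integrable torus g"
proof -
  interpret prob_space torus by (rule prob_space_torus)
  show ?thesis
    by (rule integrable_const_bound[where B = C]) (use assms in auto)
qed

lemma integrable_torus_monomial: "integrable torus (torus_monomial \<alpha>)"
  by (rule integrable_torus_bounded[where C = 1]) (simp_all add: norm_torus_monomial)

text \<open>
  Rotation invariance of the measure multiplies the integral by \<open>\<eta>\<^sup>\<alpha>\<close> for every \<open>\<eta>\<close> in the torus, and for
  \<open>\<alpha> \<noteq> 0\<close> some \<open>\<eta>\<close> makes this factor \<open>-1\<close>.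
\<close>

lemma integral_torus_monomial:
  assumes "\<alpha> \<in> eventually_zero"
  shows "integral\<^sup>L torus (torus_monomial \<alpha>) = (if \<alpha> = (\<lambda>_. 0) then 1 else 0)"
proof (cases "\<alpha> = (\<lambda>_. 0)")
  case True
  have "integral\<^sup>L torus (torus_monomial (\<lambda>_. 0)) = (\<integral>\<omega>. 1 \<partial>torus)"
    by (rule Bochner_Integration.integral_cong) simp_all
  then show ?thesis using True prob_space.prob_space[OF prob_space_torus] by simp
next
  case False
  then obtain k where k: "\<alpha> k \<noteq> 0" by auto
  \<comment> \<open>Raising \<open>\<eta>\<^sub>k\<close> to the power \<open>\<alpha>\<^sub>k\<close> gives \<open>-1\<close>.\<close>
  define \<eta> where "\<eta> j = (if j = k then cis (pi / \<alpha> k) else 1)" for j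
  have \<eta>: "\<eta> \<in> space torus" by (simp add: \<eta>_def space_torus)
  have "torus_monomial \<alpha> \<eta> = (\<Prod>j\<in>{j. \<alpha> j \<noteq> 0}. if j = k then cis (pi / \<alpha> k) powi \<alpha> k else 1)"
    unfolding torus_monomial_def by (rule prod.cong) (auto simp: \<eta>_def)
  also have "\<dots> = -1"
    using assms k by (simp add: finite_nonzero_iff_eventually_zero cis_power_int)
  finally have m: "torus_monomial \<alpha> \<eta> = -1" .
  have "(\<lambda>z. \<eta> j * z) \<in> circle \<rightarrow>\<^sub>M circle" for j
    unfolding measurable_cong_sets[OF sets_circle sets_circle]
    by (rule measurable_restrict_space3) (use \<eta> in \<open>auto simp: norm_mult space_torus\<close>)
  from measurable_compose[OF measurable_component_singleton[of _ UNIV "\<lambda>_. circle"] this]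
  have rots: "(\<lambda>\<omega> j. \<eta> j * \<omega> j) \<in> torus \<rightarrow>\<^sub>M torus"
    unfolding torus_def
    by (intro measurable_PiM_single') (use \<eta> in \<open>auto simp: space_PiM norm_mult PiE_iff space_torus\<close>)
  have "integral\<^sup>L torus (torus_monomial \<alpha>) = integral\<^sup>L (distr torus torus (\<lambda>\<omega> j. \<eta> j * \<omega> j)) (torus_monomial \<alpha>)"
    by (simp add: torus_rotation_invariant[OF \<eta>])
  also have "\<dots> = (\<integral>\<omega>. torus_monomial \<alpha> (\<lambda>j. \<eta> j * \<omega> j) \<partial>torus)"
    by (rule integral_distr[OF rots]) simp
  also have "\<dots> = - integral\<^sup>L torus (torus_monomial \<alpha>)"
    by (simp add: torus_monomial_mult m)
  finally show ?thesis using False by simp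
qed

lemma has_strong_integral_indicator:
  fixes y :: "'x::complex_banach"
  assumes "A \<in> sets M" "emeasure M A < \<infinity>"
  shows "has_strong_integral M (\<lambda>x. indicator A x *\<^sub>C y) (measure M A *\<^sub>R y)"
proof -
  have "has_strong_integral M (\<lambda>x. indicator A x *\<^sub>R y) (measure M A *\<^sub>R y)"
    using has_bochner_integral_real_indicator[OF assms]
    by (intro has_strong_integral_bounded_linear[OF bounded_linear_scaleR_left])
       (simp add: has_strong_integral_iff_has_bochner_integral)
  moreover have "(\<lambda>x. indicator A x *\<^sub>R y) = (\<lambda>x. indicator A x *\<^sub>C y)"
    by (auto simp: indicator_def scaleC.zero_left)
  ultimately show ?thesis by simp
qed

lemma has_strong_integral_cong:
  assumes "\<And>x. x \<in> space M \<Longrightarrow> f x = g x" and "has_strong_integral M f y"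
  shows "has_strong_integral M g y"
proof -
  have "strongly_measurable M g"
    using assms unfolding has_strong_integral_def strongly_measurable_def by auto
  moreover have "(\<integral>\<^sup>+x. ennreal (norm (f x - s x)) \<partial>M) = (\<integral>\<^sup>+x. ennreal (norm (g x - s x)) \<partial>M)" for s
    by (rule nn_integral_cong) (simp add: assms(1))
  ultimately show ?thesis
    using assms(2) unfolding has_strong_integral_def by simp
qed

text \<open>
  For a simple function \<open>s\<close>, comparing the integrals of \<open>s\<close> and \<open>f\<close> over the sets where \<open>s\<close> is constant
  shows that \<open>\<parallel>s\<parallel>\<close> has integral at most that of \<open>\<parallel>f - s\<parallel>\<close>. With \<open>s\<close> approximating \<open>f\<close>, the
  integral of \<open>\<parallel>f\<parallel>\<close> vanishes.
\<close>

lemma AE_zero_if_indicator_integrals_zero: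
  fixes f :: "'a \<Rightarrow> 'x::complex_banach"
  assumes M: "finite_measure M" and f: "strongly_measurable M f" and bd: "AE x in M. norm (f x) \<le> C"
    and zero: "\<And>A. A \<in> sets M \<Longrightarrow> has_strong_integral M (\<lambda>x. indicator A x *\<^sub>C f x) 0"
  shows "AE x in M. f x = 0"
proof -
  interpret finite_measure M by fact
  obtain s where s: "\<And>i::nat. simple_function M (s i)"
    and 1: "(\<lambda>i. \<integral>\<^sup>+x. ennreal (norm (f x - s i x)) \<partial>M) \<longlonglongrightarrow> 0"
    using has_strong_integral_exists_bounded[OF M f bd]
    unfolding has_strong_integral_def by (meson simple_bochner_integrable.cases)
  note meas [measurable] = borel_measurable_norm_strongly_measurable[OF f]
    borel_measurable_norm_strongly_measurable
    [OF strongly_measurable_diff[OF f strongly_measurable_simple[OF s]]]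
    borel_measurable_norm_strongly_measurable[OF strongly_measurable_simple[OF s]]
  have le: "(\<integral>\<^sup>+x. ennreal (norm (s i x)) \<partial>M) \<le> (\<integral>\<^sup>+x. ennreal (norm (f x - s i x)) \<partial>M)" for i
  proof -
    let ?Y = "s i ` space M"
    let ?A = "\<lambda>y. {x \<in> space M. s i x = y}"
    have Y: "finite ?Y" using s[of i] by (simp add: simple_function_def)
    have A [measurable]: "?A y \<in> sets M" for y
      using measurable_sets[OF measurable_simple_function[OF s[of i]], of "{y}"]
      by (simp add: vimage_def Int_def conj_commute)
    \<comment> \<open>The level sets of \<open>s\<^sub>i\<close> partition the space.\<close>
    have split: "h x = (\<Sum>y\<in>?Y. h x * indicator (?A y) x)" if "x \<in> space M" for x and h :: "'a \<Rightarrow> ennreal"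
    proof -
      have "(\<Sum>y\<in>?Y. h x * indicator (?A y) x) = (\<Sum>y\<in>?Y. if y = s i x then h x else 0)"
        using that by (intro sum.cong) (auto simp: indicator_def)
      then show ?thesis using that Y by simp
    qed
    have "(\<integral>\<^sup>+x. ennreal (norm (s i x)) \<partial>M) = (\<integral>\<^sup>+x. (\<Sum>y\<in>?Y. ennreal (norm (s i x)) * indicator (?A y) x) \<partial>M)"
      by (rule nn_integral_cong) (rule split)
    also have "\<dots> = (\<Sum>y\<in>?Y. \<integral>\<^sup>+x. ennreal (norm (s i x)) * indicator (?A y) x \<partial>M)"
      by (rule nn_integral_sum) auto
    also have "\<dots> \<le> (\<Sum>y\<in>?Y. \<integral>\<^sup>+x. ennreal (norm (f x - s i x)) * indicator (?A y) x \<partial>M)"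
    proof (rule sum_mono)
      fix y
      have "has_strong_integral M (\<lambda>x. indicator (?A y) x *\<^sub>C f x - indicator (?A y) x *\<^sub>C y)
          (0 - measure M (?A y) *\<^sub>R y)"
        by (rule has_strong_integral_diff[OF zero[OF A] has_strong_integral_indicator[OF A]])
           (simp add: emeasure_eq_measure)
      from has_strong_integral_norm_le[OF this]
      have "ennreal (measure M (?A y) * norm y) \<le> (\<integral>\<^sup>+x. ennreal (norm (indicator (?A y) x *\<^sub>C f x - indicator (?A y) x *\<^sub>C y)) \<partial>M)"
        by simp
      also have "\<dots> = (\<integral>\<^sup>+x. ennreal (norm (f x - s i x)) * indicator (?A y) x \<partial>M)"
        by (rule nn_integral_cong) (auto simp: indicator_def scaleC.zero_left)
      finally have "ennreal (measure M (?A y) * norm y) \<le> (\<integral>\<^sup>+x. ennreal (norm (f x - s i x)) * indicator (?A y) x \<partial>M)" .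
      moreover have "(\<integral>\<^sup>+x. ennreal (norm (s i x)) * indicator (?A y) x \<partial>M) = (\<integral>\<^sup>+x. ennreal (norm y) * indicator (?A y) x \<partial>M)"
        by (rule nn_integral_cong) (auto simp: indicator_def)
      ultimately show "(\<integral>\<^sup>+x. ennreal (norm (s i x)) * indicator (?A y) x \<partial>M)
          \<le> (\<integral>\<^sup>+x. ennreal (norm (f x - s i x)) * indicator (?A y) x \<partial>M)"
        by (simp add: nn_integral_cmult_indicator emeasure_eq_measure ennreal_mult mult.commute)
    qed
    also have "\<dots> = (\<integral>\<^sup>+x. (\<Sum>y\<in>?Y. ennreal (norm (f x - s i x)) * indicator (?A y) x) \<partial>M)"
      by (rule nn_integral_sum[symmetric]) auto
    also have "\<dots> = (\<integral>\<^sup>+x. ennreal (norm (f x - s i x)) \<partial>M)"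
      by (rule nn_integral_cong) (rule split[symmetric])
    finally show ?thesis .
  qed
  have "(\<integral>\<^sup>+x. ennreal (norm (f x)) \<partial>M) \<le> (\<integral>\<^sup>+x. ennreal (norm (f x - s i x)) \<partial>M) + (\<integral>\<^sup>+x. ennreal (norm (f x - s i x)) \<partial>M)" for i
  proof -
    have "(\<integral>\<^sup>+x. ennreal (norm (f x)) \<partial>M) \<le> (\<integral>\<^sup>+x. ennreal (norm (f x - s i x)) + ennreal (norm (s i x)) \<partial>M)"
    proof (rule nn_integral_mono)
      fix x
      have "norm (f x) \<le> norm (f x - s i x) + norm (s i x)"
        by (metis diff_add_cancel norm_triangle_ineq)
      then show "ennreal (norm (f x)) \<le> ennreal (norm (f x - s i x)) + ennreal (norm (s i x))"
        by (simp flip: ennreal_plus)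
    qed
    also have "\<dots> = (\<integral>\<^sup>+x. ennreal (norm (f x - s i x)) \<partial>M) + (\<integral>\<^sup>+x. ennreal (norm (s i x)) \<partial>M)"
      by (rule nn_integral_add) auto
    finally show ?thesis using le[of i] by (meson add_left_mono order_trans)
  qed
  with tendsto_add[OF 1 1] have "(\<integral>\<^sup>+x. ennreal (norm (f x)) \<partial>M) \<le> 0 + 0"
    by (intro LIMSEQ_le_const) auto
  then have "AE x in M. ennreal (norm (f x)) = 0"
    by (subst (asm) add_0_right, subst (asm) le_zero_eq, subst (asm) nn_integral_0_iff_AE) auto
  then show ?thesis by (auto elim: eventually_mono)
qed

text \<open>
  To show that \<open>f\<close> vanishes if all its Fourier coefficients do, the bounded functions \<open>h\<close> with
  \<open>\<integral> h f = 0\<close> are enlarged from the monomials to the indicators of all measurable sets.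
\<close>

definition annihilates :: "((nat \<Rightarrow> complex) \<Rightarrow> complex) \<Rightarrow> ((nat \<Rightarrow> complex) \<Rightarrow> 'x::complex_banach) \<Rightarrow> bool" where
  "annihilates h f \<longleftrightarrow> h \<in> borel_measurable torus \<and> (\<exists>B. \<forall>\<omega>\<in>space torus. cmod (h \<omega>) \<le> B) \<and>
     has_strong_integral torus (\<lambda>\<omega>. h \<omega> *\<^sub>C f \<omega>) 0"

lemma annihilates_cong:
  assumes "\<And>\<omega>. \<omega> \<in> space torus \<Longrightarrow> g \<omega> = h \<omega>" "annihilates g f"
  shows "annihilates h f"
proof -
  have "h \<in> borel_measurable torus"
    using assms measurable_cong[of torus g h borel] by (auto simp: annihilates_def)
  moreover have "has_strong_integral torus (\<lambda>\<omega>. h \<omega> *\<^sub>C f \<omega>) 0"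
    by (rule has_strong_integral_cong[of _ "\<lambda>\<omega>. g \<omega> *\<^sub>C f \<omega>"]) (use assms in \<open>auto simp: annihilates_def\<close>)
  ultimately show ?thesis
    using assms unfolding annihilates_def by auto
qed

lemma annihilates_add:
  assumes "annihilates g f" "annihilates h f"
  shows "annihilates (\<lambda>\<omega>. g \<omega> + h \<omega>) f"
proof -
  obtain B1 where B1: "\<And>\<omega>. \<omega>\<in>space torus \<Longrightarrow> cmod (g \<omega>) \<le> B1" using assms(1) by (auto simp: annihilates_def)
  obtain B2 where B2: "\<And>\<omega>. \<omega>\<in>space torus \<Longrightarrow> cmod (h \<omega>) \<le> B2" using assms(2) by (auto simp: annihilates_def)
  have "\<forall>\<omega>\<in>space torus. cmod (g \<omega> + h \<omega>) \<le> B1 + B2"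
    using B1 B2 by (auto intro: norm_triangle_mono)
  moreover have "has_strong_integral torus (\<lambda>\<omega>. (g \<omega> + h \<omega>) *\<^sub>C f \<omega>) 0"
    using has_strong_integral_add[of torus "\<lambda>\<omega>. g \<omega> *\<^sub>C f \<omega>" 0 "\<lambda>\<omega>. h \<omega> *\<^sub>C f \<omega>" 0] assms
    by (simp add: annihilates_def scaleC_add_left)
  ultimately show ?thesis
    using assms unfolding annihilates_def by auto
qed

lemma annihilates_cmult:
  assumes "annihilates h f"
  shows "annihilates (\<lambda>\<omega>. c * h \<omega>) f"
proof -
  obtain B where "\<forall>\<omega>\<in>space torus. cmod (h \<omega>) \<le> B" using assms by (auto simp: annihilates_def)
  then have "\<forall>\<omega>\<in>space torus. cmod (c * h \<omega>) \<le> cmod c * B"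
    by (auto simp: norm_mult intro: mult_left_mono)
  moreover have "has_strong_integral torus (\<lambda>\<omega>. (c * h \<omega>) *\<^sub>C f \<omega>) 0"
    using has_strong_integral_scaleC[of torus "\<lambda>\<omega>. h \<omega> *\<^sub>C f \<omega>" 0 c] assms
    by (simp add: annihilates_def scaleC_scaleC scaleC.zero_right)
  ultimately show ?thesis
    using assms unfolding annihilates_def by auto
qed

text \<open>
  Bounded pointwise convergence suffices because the norm of \<open>\<integral> (k - h\<^sub>n) f\<close> is at most a multiple of
  the integral of \<open>\<bar>k - h\<^sub>n\<bar>\<close>.
\<close>

lemma annihilates_lim:
  fixes f :: "(nat \<Rightarrow> complex) \<Rightarrow> 'x::complex_banach"
  assumes f: "strongly_measurable torus f" "AE \<omega> in torus. norm (f \<omega>) \<le> C"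
    and h: "\<And>n::nat. annihilates (h n) f" and B: "\<And>n \<omega>. \<omega> \<in> space torus \<Longrightarrow> cmod (h n \<omega>) \<le> B"
    and lim: "\<And>\<omega>. \<omega> \<in> space torus \<Longrightarrow> (\<lambda>n. h n \<omega>) \<longlonglongrightarrow> k \<omega>"
  shows "annihilates k f"
proof -
  interpret prob_space torus by (rule prob_space_torus)
  have hm [measurable]: "h n \<in> borel_measurable torus" for n using h by (simp add: annihilates_def)
  have km [measurable]: "k \<in> borel_measurable torus"
    by (rule borel_measurable_LIMSEQ_metric[OF hm lim])
  have kB: "cmod (k \<omega>) \<le> B" if "\<omega> \<in> space torus" for \<omega>
    by (rule LIMSEQ_le_const2[OF tendsto_norm[OF lim[OF that]]]) (use B[OF that] in auto)
  have B0: "B \<ge> 0" by (rule order_trans[OF norm_ge_zero B[of "\<lambda>_. 1" 0]]) (simp add: space_torus)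
  have AEb: "AE \<omega> in torus. norm (k \<omega> *\<^sub>C f \<omega>) \<le> B * C"
    using f(2) AE_space
  proof eventually_elim
    case (elim \<omega>)
    then show ?case using kB[of \<omega>] B0 by (auto simp: norm_scaleC intro!: mult_mono)
  qed
  obtain y where y: "has_strong_integral torus (\<lambda>\<omega>. k \<omega> *\<^sub>C f \<omega>) y"
    using has_strong_integral_exists_bounded[OF finite_measure_axioms strongly_measurable_scaleC[OF km f(1)] AEb] by blast
  have int: "integrable torus (\<lambda>\<omega>. \<bar>C\<bar> * cmod (k \<omega> - h n \<omega>))" for n
  proof (rule integrable_torus_bounded)
    show "norm (\<bar>C\<bar> * cmod (k \<omega> - h n \<omega>)) \<le> \<bar>C\<bar> * (B + B)" if "\<omega> \<in> space torus" for \<omega>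
      using norm_triangle_ineq4[of "k \<omega>" "h n \<omega>"] kB[OF that] B[OF that, of n]
      by (auto simp: abs_mult intro!: mult_left_mono)
  qed measurable
  have le: "norm y \<le> (\<integral>\<omega>. \<bar>C\<bar> * cmod (k \<omega> - h n \<omega>) \<partial>torus)" for n
  proof (rule has_strong_integral_norm_le_integral[OF _ int])
    show "has_strong_integral torus (\<lambda>\<omega>. (k \<omega> - h n \<omega>) *\<^sub>C f \<omega>) y"
      using has_strong_integral_diff[OF y, of "\<lambda>\<omega>. h n \<omega> *\<^sub>C f \<omega>" 0] h[of n]
      by (simp add: annihilates_def scaleC.diff_left)
    show "AE \<omega> in torus. norm ((k \<omega> - h n \<omega>) *\<^sub>C f \<omega>) \<le> \<bar>C\<bar> * cmod (k \<omega> - h n \<omega>)"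
      using f(2) by eventually_elim (auto simp: norm_scaleC mult.commute[of "\<bar>C\<bar>"] intro!: mult_left_mono)
  qed
  have "(\<lambda>n. \<integral>\<omega>. \<bar>C\<bar> * cmod (k \<omega> - h n \<omega>) \<partial>torus) \<longlonglongrightarrow> (\<integral>\<omega>. \<bar>C\<bar> * cmod (k \<omega> - k \<omega>) \<partial>torus)"
  proof (rule integral_dominated_convergence[where w = "\<lambda>_. \<bar>C\<bar> * (B + B)"])
    show "AE \<omega> in torus. (\<lambda>n. \<bar>C\<bar> * cmod (k \<omega> - h n \<omega>)) \<longlonglongrightarrow> \<bar>C\<bar> * cmod (k \<omega> - k \<omega>)"
      using lim by (intro AE_I2 tendsto_intros)
    show "AE \<omega> in torus. norm (\<bar>C\<bar> * cmod (k \<omega> - h n \<omega>)) \<le> \<bar>C\<bar> * (B + B)" for n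
    proof (rule AE_I2)
      fix \<omega> assume that: "\<omega> \<in> space torus"
      show "norm (\<bar>C\<bar> * cmod (k \<omega> - h n \<omega>)) \<le> \<bar>C\<bar> * (B + B)"
        using norm_triangle_ineq4[of "k \<omega>" "h n \<omega>"] kB[OF that] B[OF that, of n]
        by (auto simp: abs_mult intro!: mult_left_mono)
    qed
  qed auto
  then have L: "(\<lambda>n. \<integral>\<omega>. \<bar>C\<bar> * cmod (k \<omega> - h n \<omega>) \<partial>torus) \<longlonglongrightarrow> 0"
    by simp
  have "norm y \<le> 0"
    by (rule LIMSEQ_le_const[OF L]) (use le in blast)
  then show ?thesis
    using y km kB by (auto simp: annihilates_def)
qed

text \<open>
  Annihilation is not stable under products. Multipliers are: a multiplier maps the functions \<open>g\<close> for
  which \<open>g\<close> times every monomial annihilates \<open>f\<close> into themselves. They form an algebra that contains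
  the coordinates and is closed under bounded limits, so that the sets with multiplier indicator form a
  sigma-algebra.
\<close>

definition multiplier :: "((nat \<Rightarrow> complex) \<Rightarrow> 'x::complex_banach) \<Rightarrow> ((nat \<Rightarrow> complex) \<Rightarrow> complex) \<Rightarrow> bool" where
  "multiplier f m \<longleftrightarrow> m \<in> borel_measurable torus \<and> (\<exists>B. \<forall>\<omega>\<in>space torus. cmod (m \<omega>) \<le> B) \<and>
     (\<forall>g. (\<forall>\<alpha>\<in>eventually_zero. annihilates (\<lambda>\<omega>. g \<omega> * torus_monomial \<alpha> \<omega>) f) \<longrightarrow>
       (\<forall>\<alpha>\<in>eventually_zero. annihilates (\<lambda>\<omega>. m \<omega> * g \<omega> * torus_monomial \<alpha> \<omega>) f))"

lemma multiplier_cong: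
  assumes "\<And>\<omega>. \<omega> \<in> space torus \<Longrightarrow> m \<omega> = n \<omega>" "multiplier f m"
  shows "multiplier f n"
proof -
  have "n \<in> borel_measurable torus"
    using assms measurable_cong[of torus m n borel] by (auto simp: multiplier_def)
  moreover have "annihilates (\<lambda>\<omega>. n \<omega> * g \<omega> * torus_monomial \<alpha> \<omega>) f"
    if "\<forall>\<alpha>\<in>eventually_zero. annihilates (\<lambda>\<omega>. g \<omega> * torus_monomial \<alpha> \<omega>) f" "\<alpha> \<in> eventually_zero" for g \<alpha>
    by (rule annihilates_cong[of "\<lambda>\<omega>. m \<omega> * g \<omega> * torus_monomial \<alpha> \<omega>"])
       (use assms that in \<open>auto simp: multiplier_def\<close>)
  ultimately show ?thesis
    using assms unfolding multiplier_def by auto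
qed

lemma multiplier_const: "multiplier f (\<lambda>_. c)"
  unfolding multiplier_def by (auto simp: mult.assoc intro!: annihilates_cmult)

lemma multiplier_add:
  assumes "multiplier f m" "multiplier f n"
  shows "multiplier f (\<lambda>\<omega>. m \<omega> + n \<omega>)"
proof -
  obtain B1 where B1: "\<And>\<omega>. \<omega>\<in>space torus \<Longrightarrow> cmod (m \<omega>) \<le> B1" using assms(1) by (auto simp: multiplier_def)
  obtain B2 where B2: "\<And>\<omega>. \<omega>\<in>space torus \<Longrightarrow> cmod (n \<omega>) \<le> B2" using assms(2) by (auto simp: multiplier_def)
  have "\<forall>\<omega>\<in>space torus. cmod (m \<omega> + n \<omega>) \<le> B1 + B2"
    using B1 B2 by (auto intro: norm_triangle_mono)
  then show ?thesis
    using assms unfolding multiplier_def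
    by (auto simp: distrib_right intro!: annihilates_add)
qed

lemma multiplier_mult:
  assumes "multiplier f m" "multiplier f n"
  shows "multiplier f (\<lambda>\<omega>. m \<omega> * n \<omega>)"
proof -
  obtain B1 where B1: "\<And>\<omega>. \<omega>\<in>space torus \<Longrightarrow> cmod (m \<omega>) \<le> B1" using assms(1) by (auto simp: multiplier_def)
  obtain B2 where B2: "\<And>\<omega>. \<omega>\<in>space torus \<Longrightarrow> cmod (n \<omega>) \<le> B2" using assms(2) by (auto simp: multiplier_def)
  have "\<forall>\<omega>\<in>space torus. cmod (m \<omega> * n \<omega>) \<le> \<bar>B1\<bar> * \<bar>B2\<bar>"
    using B1 B2 by (fastforce simp: norm_mult intro!: mult_mono)
  moreover have "annihilates (\<lambda>\<omega>. (m \<omega> * n \<omega>) * g \<omega> * torus_monomial \<alpha> \<omega>) f"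
    if g: "\<forall>\<alpha>\<in>eventually_zero. annihilates (\<lambda>\<omega>. g \<omega> * torus_monomial \<alpha> \<omega>) f" and \<alpha>: "\<alpha> \<in> eventually_zero" for g \<alpha>
  proof -
    have "\<forall>\<alpha>\<in>eventually_zero. annihilates (\<lambda>\<omega>. n \<omega> * g \<omega> * torus_monomial \<alpha> \<omega>) f"
      using assms(2) g unfolding multiplier_def by blast
    then have "annihilates (\<lambda>\<omega>. m \<omega> * (n \<omega> * g \<omega>) * torus_monomial \<alpha> \<omega>) f"
      using assms(1)[unfolded multiplier_def, THEN conjunct2, THEN conjunct2, rule_format, of "\<lambda>\<omega>. n \<omega> * g \<omega>" \<alpha>] \<alpha> by blast
    then show ?thesis by (simp add: mult.assoc)
  qed
  ultimately show ?thesis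
    using assms unfolding multiplier_def by auto
qed

lemma multiplier_torus_monomial:
  assumes "\<beta> \<in> eventually_zero"
  shows "multiplier f (torus_monomial \<beta>)"
proof -
  have "annihilates (\<lambda>\<omega>. torus_monomial \<beta> \<omega> * g \<omega> * torus_monomial \<alpha> \<omega>) f"
    if g: "\<forall>\<alpha>\<in>eventually_zero. annihilates (\<lambda>\<omega>. g \<omega> * torus_monomial \<alpha> \<omega>) f" and \<alpha>: "\<alpha> \<in> eventually_zero" for g \<alpha>
  proof (rule annihilates_cong)
    show "annihilates (\<lambda>\<omega>. g \<omega> * torus_monomial (\<lambda>j. \<beta> j + \<alpha> j) \<omega>) f"
      using assms \<alpha> by (intro g[rule_format]) (auto simp: eventually_zero_def elim: eventually_elim2)
  qed (use assms \<alpha> in \<open>simp add: torus_monomial_add\<close>)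
  then show ?thesis
    unfolding multiplier_def by (auto intro!: exI[of _ 1] simp: norm_torus_monomial)
qed

lemma multiplier_lim:
  fixes f :: "(nat \<Rightarrow> complex) \<Rightarrow> 'x::complex_banach"
  assumes f: "strongly_measurable torus f" "AE \<omega> in torus. norm (f \<omega>) \<le> C"
    and m: "\<And>n::nat. multiplier f (m n)" and B: "\<And>n \<omega>. \<omega> \<in> space torus \<Longrightarrow> cmod (m n \<omega>) \<le> B"
    and lim: "\<And>\<omega>. \<omega> \<in> space torus \<Longrightarrow> (\<lambda>n. m n \<omega>) \<longlonglongrightarrow> k \<omega>"
  shows "multiplier f k"
proof -
  have mm [measurable]: "m n \<in> borel_measurable torus" for n using m by (simp add: multiplier_def)
  have km: "k \<in> borel_measurable torus"
    by (rule borel_measurable_LIMSEQ_metric[OF mm lim])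
  have kB: "cmod (k \<omega>) \<le> B" if "\<omega> \<in> space torus" for \<omega>
    by (rule LIMSEQ_le_const2[OF tendsto_norm[OF lim[OF that]]]) (use B[OF that] in auto)
  have "annihilates (\<lambda>\<omega>. k \<omega> * g \<omega> * torus_monomial \<alpha> \<omega>) f"
    if g: "\<forall>\<alpha>\<in>eventually_zero. annihilates (\<lambda>\<omega>. g \<omega> * torus_monomial \<alpha> \<omega>) f" and \<alpha>: "\<alpha> \<in> eventually_zero" for g \<alpha>
  proof -
    obtain B' where B': "\<And>\<omega>. \<omega> \<in> space torus \<Longrightarrow> cmod (g \<omega> * torus_monomial \<alpha> \<omega>) \<le> B'"
      using g[rule_format, OF \<alpha>] by (auto simp: annihilates_def)
    have B0: "B \<ge> 0" by (rule order_trans[OF norm_ge_zero B[of "\<lambda>_. 1" 0]]) (simp add: space_torus)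
    show ?thesis
    proof (rule annihilates_lim[OF f])
      show "annihilates (\<lambda>\<omega>. m n \<omega> * g \<omega> * torus_monomial \<alpha> \<omega>) f" for n
        using m g \<alpha> unfolding multiplier_def by blast
      show "cmod (m n \<omega> * g \<omega> * torus_monomial \<alpha> \<omega>) \<le> B * B'" if "\<omega> \<in> space torus" for n \<omega>
        using B[OF that, of n] B'[OF that] B0 by (auto simp: norm_mult mult.assoc intro!: mult_mono)
      show "(\<lambda>n. m n \<omega> * g \<omega> * torus_monomial \<alpha> \<omega>) \<longlonglongrightarrow> k \<omega> * g \<omega> * torus_monomial \<alpha> \<omega>"
        if "\<omega> \<in> space torus" for \<omega>
        by (intro tendsto_intros lim that)
    qed
  qed
  then show ?thesis
    using km kB unfolding multiplier_def by blast
qed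

text \<open>
  On the unit circle the conjugate of a coordinate is its inverse, hence again a monomial. So real and
  imaginary parts of the coordinates are multipliers.
\<close>

lemma multiplier_real_polynomial:
  assumes "real_polynomial_function p"
  shows "multiplier f (\<lambda>\<omega>. of_real (p (\<omega> j :: complex)))"
  using assms
proof induction
  case (linear p)
  let ?e = "\<lambda>i. if i = j then 1 else (0::int)"
  have e: "?e \<in> eventually_zero" "(\<lambda>i. - ?e i) \<in> eventually_zero"
    by (auto simp: finite_nonzero_iff_eventually_zero)
  have te: "torus_monomial ?e \<omega> = \<omega> j" for \<omega>
  proof -
    have "{i. ?e i \<noteq> 0} = {j}" by auto
    then show ?thesis by (simp add: torus_monomial_def)
  qed
  have lin: "p z = Re z * p 1 + Im z * p \<i>" for z
  proof -
    interpret bounded_linear p by fact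
    have "p z = p (Re z *\<^sub>R 1 + Im z *\<^sub>R \<i>)"
      by (rule arg_cong[where f = p]) (simp add: complex_eq_iff)
    then show ?thesis by (simp only: add scaleR real_scaleR_def)
  qed
  have "multiplier f (\<lambda>\<omega>. (of_real (p 1) / 2 - \<i> / 2 * of_real (p \<i>)) * torus_monomial ?e \<omega>
      + (of_real (p 1) / 2 + \<i> / 2 * of_real (p \<i>)) * torus_monomial (\<lambda>i. - ?e i) \<omega>)"
    by (intro multiplier_add multiplier_mult multiplier_const multiplier_torus_monomial e)
  then show ?case
  proof (rule multiplier_cong[rotated])
    fix \<omega> assume w: "\<omega> \<in> space torus"
    show "(of_real (p 1) / 2 - \<i> / 2 * of_real (p \<i>)) * torus_monomial ?e \<omega>
      + (of_real (p 1) / 2 + \<i> / 2 * of_real (p \<i>)) * torus_monomial (\<lambda>i. - ?e i) \<omega> = complex_of_real (p (\<omega> j))"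
      unfolding torus_monomial_uminus[OF w] te lin[of "\<omega> j"] by (simp add: complex_eq_iff algebra_simps)
  qed
next
  case (const c)
  show ?case by (rule multiplier_const)
next
  case (add p q)
  then show ?case using multiplier_add by (simp add: of_real_add)
next
  case (mult p q)
  then show ?case using multiplier_mult by (simp add: of_real_mult)
qed

text \<open>
  By the Stone-Weierstrass theorem on the unit circle.
\<close>

lemma multiplier_continuous:
  fixes f :: "(nat \<Rightarrow> complex) \<Rightarrow> 'x::complex_banach"
  assumes f: "strongly_measurable torus f" "AE \<omega> in torus. norm (f \<omega>) \<le> C"
    and u: "continuous_on (sphere 0 1) u"
  shows "multiplier f (\<lambda>\<omega>. of_real (u (\<omega> j)))"
proof -
  have "\<exists>p. real_polynomial_function p \<and> (\<forall>z\<in>sphere 0 1. \<bar>u z - p z\<bar> < 1 / Suc n)" for n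
    by (rule Stone_Weierstrass_real_polynomial_function[OF compact_sphere u, of "1 / Suc n"]) auto
  then obtain p where p: "\<And>n. real_polynomial_function (p n)"
    "\<And>n z. z \<in> sphere 0 1 \<Longrightarrow> \<bar>u z - p n z\<bar> < 1 / Suc n" by metis
  obtain B where B: "\<And>z. z \<in> sphere 0 1 \<Longrightarrow> \<bar>u z\<bar> \<le> B"
    using compact_imp_bounded[OF compact_continuous_image[OF u compact_sphere]]
    unfolding bounded_iff by (metis imageI real_norm_def)
  have sp: "\<omega> j \<in> sphere 0 1" if "\<omega> \<in> space torus" for \<omega> using that by (simp add: space_torus)
  show ?thesis
  proof (rule multiplier_lim[OF f])
    show "multiplier f (\<lambda>\<omega>. of_real (p n (\<omega> j)))" for n by (rule multiplier_real_polynomial[OF p(1)])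
    show "cmod (of_real (p n (\<omega> j))) \<le> B + 1" if "\<omega> \<in> space torus" for n \<omega>
    proof -
      have "1 / real (Suc n) \<le> 1" by simp
      then show ?thesis
        using B[OF sp[OF that]] p(2)[OF sp[OF that], of n] unfolding norm_of_real by linarith
    qed
    show "(\<lambda>n. complex_of_real (p n (\<omega> j))) \<longlonglongrightarrow> of_real (u (\<omega> j))" if "\<omega> \<in> space torus" for \<omega>
    proof (rule tendsto_of_real, rule LIM_zero_cancel, rule tendsto_rabs_zero_cancel)
      have L: "(\<lambda>n. 1 / real (Suc n)) \<longlonglongrightarrow> 0" by (rule LIMSEQ_Suc[OF lim_1_over_n])
      show "(\<lambda>n. \<bar>p n (\<omega> j) - u (\<omega> j)\<bar>) \<longlonglongrightarrow> 0"
        by (rule tendsto_sandwich[OF _ _ tendsto_const L])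
           (use p(2)[OF sp[OF that]] in \<open>auto intro!: always_eventually less_imp_le simp: abs_minus_commute\<close>)
    qed
  qed
qed

lemma multiplier_indicator_compl:
  assumes "multiplier f (\<lambda>\<omega>. indicator A (q \<omega>))"
  shows "multiplier f (\<lambda>\<omega>. indicator (- A) (q \<omega>))"
proof -
  have "multiplier f (\<lambda>\<omega>. 1 + (-1) * indicator A (q \<omega>))"
    by (intro multiplier_add multiplier_mult multiplier_const assms)
  then show ?thesis by (rule multiplier_cong[rotated]) (simp add: indicator_def)
qed

lemma multiplier_indicator_UN:
  fixes f :: "(nat \<Rightarrow> complex) \<Rightarrow> 'x::complex_banach" and A :: "nat \<Rightarrow> 'a set"
  assumes f: "strongly_measurable torus f" "AE \<omega> in torus. norm (f \<omega>) \<le> C"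
    and A: "\<And>i. multiplier f (\<lambda>\<omega>. indicator (A i) (q \<omega>))"
  shows "multiplier f (\<lambda>\<omega>. indicator (\<Union>i. A i) (q \<omega>))"
proof (rule multiplier_lim[OF f])
  show "multiplier f (\<lambda>\<omega>. indicator (\<Union>i<n. A i) (q \<omega>))" for n
  proof (induction n)
    case 0
    then show ?case using multiplier_const[of f 0] by simp
  next
    case (Suc n)
    have "multiplier f (\<lambda>\<omega>. indicator (\<Union>i<n. A i) (q \<omega>) + indicator (A n) (q \<omega>) +
      (-1) * (indicator (\<Union>i<n. A i) (q \<omega>) * indicator (A n) (q \<omega>)))"
      by (intro multiplier_add multiplier_mult multiplier_const Suc A)
    then show ?case
      by (rule multiplier_cong[rotated]) (auto simp: indicator_def lessThan_Suc)
  qed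
  show "cmod (indicator (\<Union>i<n. A i) (q \<omega>)) \<le> 1" for n \<omega> by (simp add: indicator_def)
  show "(\<lambda>n. indicator (\<Union>i<n. A i) (q \<omega>) :: complex) \<longlonglongrightarrow> indicator (\<Union>i. A i) (q \<omega>)" for \<omega>
    by (rule LIMSEQ_indicator_UN)
qed

text \<open>
  The indicator of a closed set is the decreasing limit of the continuous functions
  \<open>max 0 (1 - n d(z, S))\<close>, and closed sets generate the Borel sets.
\<close>

lemma multiplier_indicator_component:
  fixes f :: "(nat \<Rightarrow> complex) \<Rightarrow> 'x::complex_banach"
  assumes f: "strongly_measurable torus f" "AE \<omega> in torus. norm (f \<omega>) \<le> C"
    and B: "B \<in> sets (borel :: complex measure)"
  shows "multiplier f (\<lambda>\<omega>. indicator B (\<omega> j))"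
proof -
  have "B \<in> sigma_sets UNIV (Collect closed)"
    using B unfolding borel_eq_closed by simp
  then show ?thesis
  proof induction
    case (Basic S)
    show ?case
    proof (cases "S = {}")
      case True
      then show ?thesis using multiplier_const[of f 0] by simp
    next
      case False
      define u where "u n z = max 0 (1 - real n * infdist z S)" for n z
      show ?thesis
      proof (rule multiplier_lim[OF f])
        show "multiplier f (\<lambda>\<omega>. of_real (u n (\<omega> j)))" for n
          by (rule multiplier_continuous[OF f]) (auto simp: u_def intro!: continuous_intros)
        show "cmod (of_real (u n (\<omega> j))) \<le> 1" for n \<omega>
          by (auto simp: u_def infdist_nonneg)
        show "(\<lambda>n. complex_of_real (u n (\<omega> j))) \<longlonglongrightarrow> indicator S (\<omega> j)" for \<omega>
        proof (cases "\<omega> j \<in> S")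
          case True
          then show ?thesis by (simp add: u_def)
        next
          case out: False
          have pos: "infdist (\<omega> j) S > 0"
            using Basic False out by (metis infdist_nonneg in_closed_iff_infdist_zero less_le mem_Collect_eq)
          obtain N where N: "1 < real N * infdist (\<omega> j) S"
            using reals_Archimedean3[OF pos] by blast
          have "u n (\<omega> j) = 0" if "n \<ge> N" for n
          proof -
            have "real N * infdist (\<omega> j) S \<le> real n * infdist (\<omega> j) S"
              using that pos by (intro mult_right_mono) auto
            then show ?thesis using N by (simp add: u_def)
          qed
          then have "eventually (\<lambda>n. complex_of_real (u n (\<omega> j)) = 0) sequentially"
            by (auto simp: eventually_sequentially)
          then show ?thesis using out by (simp add: tendsto_eventually)
        qed
      qed
    qed
  next
    case Empty
    show ?case using multiplier_const[of f 0] by simp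
  next
    case (Compl S)
    then show ?case using multiplier_indicator_compl[of f S "\<lambda>\<omega>. \<omega> j"] by (simp add: Compl_eq_Diff_UNIV)
  next
    case (Union A)
    then show ?case by (intro multiplier_indicator_UN[OF f])
  qed
qed

text \<open>
  The product sigma-algebra is generated by the conditions on single coordinates.
\<close>

lemma multiplier_indicator:
  fixes f :: "(nat \<Rightarrow> complex) \<Rightarrow> 'x::complex_banach"
  assumes f: "strongly_measurable torus f" "AE \<omega> in torus. norm (f \<omega>) \<le> C"
    and A: "A \<in> sets torus"
  shows "multiplier f (indicator A)"
proof -
  have "A \<in> sigma_sets (space torus) {{\<omega> \<in> space torus. \<omega> i \<in> B} | i B. B \<in> sets circle}"
    using A unfolding torus_def sets_PiM_single by (simp add: space_PiM)
  then show ?thesis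
  proof induction
    case (Basic S)
    then obtain i B where "S = {\<omega> \<in> space torus. \<omega> i \<in> B}" "B \<in> sets circle" by blast
    moreover from this obtain B' where "B = sphere 0 1 \<inter> B'" "B' \<in> sets borel"
      unfolding sets_circle sets_restrict_space by blast
    ultimately have S: "S = {\<omega> \<in> space torus. \<omega> i \<in> B' \<inter> sphere 0 1}" "B' \<in> sets borel"
      by auto
    show ?case
      by (rule multiplier_cong[OF _ multiplier_indicator_component[OF f S(2), of i]])
         (auto simp: S(1) indicator_def space_torus)
  next
    case Empty
    have "indicator {} = (\<lambda>_::nat \<Rightarrow> complex. 0::complex)" by auto
    then show ?case using multiplier_const[of f 0] by simp
  next
    case (Compl S)
    show ?case
      by (rule multiplier_cong[OF _ multiplier_indicator_compl[of f S "\<lambda>\<omega>. \<omega>"]])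
         (use Compl in \<open>auto simp: indicator_def\<close>)
  next
    case (Union A)
    then show ?case using multiplier_indicator_UN[OF f, of A "\<lambda>\<omega>. \<omega>"] by simp
  qed
qed

lemma Linf_torusD:
  assumes "f \<in> Linf_torus"
  obtains C where "strongly_measurable torus f" "AE \<omega> in torus. norm (f \<omega>) \<le> C" "Linf_norm f = ereal C" "C \<ge> 0"
proof -
  interpret prob_space torus by (rule prob_space_torus)
  have sm: "strongly_measurable torus f" and fin: "Linf_norm f < \<infinity>"
    using assms by (auto simp: Linf_torus_def)
  have AE1: "AE \<omega> in torus. ereal (norm (f \<omega>)) \<le> Linf_norm f"
    unfolding Linf_norm_def by (rule esssup_AE)
  then have "AE \<omega> in torus. 0 \<le> Linf_norm f"
    by eventually_elim (metis ereal_less_eq(5) norm_ge_zero order_trans)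
  then have nn: "0 \<le> Linf_norm f" by simp
  then obtain C where C: "Linf_norm f = ereal C"
    using fin by (cases "Linf_norm f") auto
  show ?thesis
    by (rule that[OF sm _ C]) (use AE1 nn C in auto)
qed

lemma has_strong_integral_fourier_coeff:
  assumes "f \<in> Linf_torus"
  shows "has_strong_integral torus (\<lambda>\<omega>. torus_monomial (\<lambda>j. - \<alpha> j) \<omega> *\<^sub>C f \<omega>) (fourier_coeff f \<alpha>)"
proof -
  obtain C where C: "strongly_measurable torus f" "AE \<omega> in torus. norm (f \<omega>) \<le> C"
    using Linf_torusD[OF assms] by metis
  have "AE \<omega> in torus. norm (torus_monomial (\<lambda>j. - \<alpha> j) \<omega> *\<^sub>C f \<omega>) \<le> C"
    using C(2) AE_space by eventually_elim (simp add: norm_scaleC norm_torus_monomial)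
  then obtain y where "has_strong_integral torus (\<lambda>\<omega>. torus_monomial (\<lambda>j. - \<alpha> j) \<omega> *\<^sub>C f \<omega>) y"
    using has_strong_integral_exists_bounded[OF prob_space.finite_measure[OF prob_space_torus]
        strongly_measurable_scaleC[OF measurable_torus_monomial C(1)]] by blast
  then show ?thesis by (simp add: fourier_coeff_def strong_integral_eqI)
qed

text \<open>
  Vanishing coefficients mean that the constant 1 lies in the space on which multipliers act. Hence
  the indicator of every measurable set annihilates \<open>f\<close>.
\<close>

lemma AE_zero_if_fourier_coeffs_zero:
  fixes f :: "(nat \<Rightarrow> complex) \<Rightarrow> 'x::complex_banach"
  assumes f: "strongly_measurable torus f" "AE \<omega> in torus. norm (f \<omega>) \<le> C"
    and zero: "\<And>\<alpha>. \<alpha> \<in> eventually_zero \<Longrightarrow> has_strong_integral torus (\<lambda>\<omega>. torus_monomial \<alpha> \<omega> *\<^sub>C f \<omega>) 0"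
  shows "AE \<omega> in torus. f \<omega> = 0"
proof (rule AE_zero_if_indicator_integrals_zero[OF prob_space.finite_measure[OF prob_space_torus] f])
  fix A assume A: "A \<in> sets torus"
  have "\<forall>\<alpha>\<in>eventually_zero. annihilates (\<lambda>\<omega>. 1 * torus_monomial \<alpha> \<omega>) f"
    using zero by (auto simp: annihilates_def norm_torus_monomial intro!: exI[of _ 1])
  then have "\<forall>\<alpha>\<in>eventually_zero. annihilates (\<lambda>\<omega>. indicator A \<omega> * 1 * torus_monomial \<alpha> \<omega>) f"
    using multiplier_indicator[OF f A, unfolded multiplier_def, THEN conjunct2, THEN conjunct2, rule_format, of "\<lambda>_. 1"]
    by blast
  moreover have "(\<lambda>_. 0) \<in> (eventually_zero :: (nat \<Rightarrow> int) set)" by (simp add: eventually_zero_def)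
  ultimately have "annihilates (\<lambda>\<omega>. indicator A \<omega> * 1 * torus_monomial (\<lambda>_. 0) \<omega>) f" by blast
  then show "has_strong_integral torus (\<lambda>\<omega>. indicator A \<omega> *\<^sub>C f \<omega>) 0"
    by (simp add: annihilates_def)
qed

lemma Linf_norm_eqI_fourier_coeff:
  fixes f g :: "(nat \<Rightarrow> complex) \<Rightarrow> 'x::complex_banach"
  assumes f: "f \<in> Linf_torus" and g: "g \<in> Linf_torus"
    and eq: "\<And>\<alpha>. \<alpha> \<in> eventually_zero \<Longrightarrow> fourier_coeff f \<alpha> = fourier_coeff g \<alpha>"
  shows "Linf_norm f = Linf_norm g"
proof -
  obtain C where C: "strongly_measurable torus f" "AE \<omega> in torus. norm (f \<omega>) \<le> C"
    using Linf_torusD[OF f] by metis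
  obtain D where D: "strongly_measurable torus g" "AE \<omega> in torus. norm (g \<omega>) \<le> D"
    using Linf_torusD[OF g] by metis
  have sm: "strongly_measurable torus (\<lambda>\<omega>. f \<omega> - g \<omega>)"
    by (rule strongly_measurable_diff[OF C(1) D(1)])
  have bd: "AE \<omega> in torus. norm (f \<omega> - g \<omega>) \<le> C + D"
    using C(2) D(2) by eventually_elim (meson add_mono norm_triangle_ineq4 order_trans)
  have "has_strong_integral torus (\<lambda>\<omega>. torus_monomial \<alpha> \<omega> *\<^sub>C (f \<omega> - g \<omega>)) 0" if "\<alpha> \<in> eventually_zero" for \<alpha>
  proof -
    have "(\<lambda>j. - \<alpha> j) \<in> eventually_zero" using that by (simp add: eventually_zero_def)
    from eq[OF this] show ?thesis
      using has_strong_integral_diff[OF has_strong_integral_fourier_coeff[OF f, of "\<lambda>j. - \<alpha> j"]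
          has_strong_integral_fourier_coeff[OF g, of "\<lambda>j. - \<alpha> j"]]
      by (simp add: scaleC.diff_right)
  qed
  from AE_zero_if_fourier_coeffs_zero[OF sm bd this]
  have "AE \<omega> in torus. ereal (norm (f \<omega>)) = ereal (norm (g \<omega>))"
    by (auto elim: eventually_mono)
  then show ?thesis
    unfolding Linf_norm_def
    using borel_measurable_norm_strongly_measurable[OF C(1)] borel_measurable_norm_strongly_measurable[OF D(1)]
    by (intro esssup_AE_cong) auto
qed


section \<open>Prime exponents and Kronecker's theorem\<close>

text \<open>
  This is \<open>n\<^sup>-\<^sup>i\<^sup>t\<close> for \<open>n \<ge> 1\<close>.
\<close>

abbreviation unit_power :: "real \<Rightarrow> nat \<Rightarrow> complex" where
  "unit_power t n \<equiv> cis (- t * ln (real n))"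

abbreviation nth_prime :: "nat \<Rightarrow> nat" where
  "nth_prime j \<equiv> enumerate {p. prime p} j"

definition prime_exponents :: "nat \<Rightarrow> nat \<Rightarrow> nat" where
  "prime_exponents n j = multiplicity (nth_prime j) n"

lemma bij_nth_prime: "bij_betw nth_prime UNIV {p::nat. prime p}"
  by (rule bij_enumerate[OF primes_infinite])

lemma prime_nth_prime: "prime (nth_prime j)"
  using bij_betwE[OF bij_nth_prime] by blast

lemma inj_nth_prime: "inj nth_prime"
  using bij_nth_prime by (rule bij_betw_imp_inj_on)

lemma nth_prime_gt_1: "1 < nth_prime j"
  by (rule prime_gt_1_nat[OF prime_nth_prime])

lemma bij_betw_prime_exponents_support:
  assumes "n > 0"
  shows "bij_betw nth_prime {j. prime_exponents n j \<noteq> 0} (prime_factors n)"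
proof -
  have "nth_prime ` {j. prime_exponents n j \<noteq> 0} = prime_factors n"
  proof (intro equalityI subsetI)
    fix p assume "p \<in> nth_prime ` {j. prime_exponents n j \<noteq> 0}"
    then show "p \<in> prime_factors n"
      by (auto simp: prime_exponents_def prime_factors_multiplicity prime_nth_prime)
  next
    fix p assume p: "p \<in> prime_factors n"
    then have "p \<in> range nth_prime"
      using bij_nth_prime by (auto simp: bij_betw_def)
    then show "p \<in> nth_prime ` {j. prime_exponents n j \<noteq> 0}"
      using p by (auto simp: prime_exponents_def prime_factors_multiplicity)
  qed
  then show ?thesis
    using inj_nth_prime by (auto simp: bij_betw_def intro: inj_on_subset)
qed

lemma finite_prime_exponents_support: "n > 0 \<Longrightarrow> finite {j. prime_exponents n j \<noteq> 0}"
  by (metis List.finite_set bij_betw_finite bij_betw_prime_exponents_support finite_set_mset)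

lemma prime_exponents_eventually_zero: "n > 0 \<Longrightarrow> prime_exponents n \<in> eventually_zero"
  using finite_nonzero_iff_eventually_zero finite_prime_exponents_support by blast

lemma prime_power_prime_exponents:
  assumes "n > 0"
  shows "prime_power (prime_exponents n) = n"
proof -
  have "prime_power (prime_exponents n) = (\<Prod>j\<in>{j. prime_exponents n j \<noteq> 0}. nth_prime j ^ multiplicity (nth_prime j) n)"
    unfolding prime_power_def prime_exponents_def ..
  also have "\<dots> = (\<Prod>p\<in>prime_factors n. p ^ multiplicity p n)"
    by (rule prod.reindex_bij_betw[OF bij_betw_prime_exponents_support[OF assms]])
  also have "\<dots> = n"
    using assms by (simp add: prod_prime_factors)
  finally show ?thesis .
qed

lemma prime_power_pos: "prime_power \<alpha> > 0"
  unfolding prime_power_def by (rule prod_pos) (use nth_prime_gt_1 in \<open>auto intro: less_trans\<close>)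

lemma prime_exponents_prime_power:
  assumes "\<alpha> \<in> eventually_zero"
  shows "prime_exponents (prime_power \<alpha>) = \<alpha>"
proof
  fix i
  let ?S = "{j. \<alpha> j \<noteq> 0}"
  have fin: "finite (nth_prime ` ?S)" using assms by (simp add: finite_nonzero_iff_eventually_zero)
  have "prime_power \<alpha> = (\<Prod>p\<in>nth_prime ` ?S. p ^ \<alpha> (inv nth_prime p))"
    by (subst prod.reindex[OF inj_on_subset[OF inj_nth_prime subset_UNIV]])
       (simp add: prime_power_def inv_f_f[OF inj_nth_prime])
  then have "prime_exponents (prime_power \<alpha>) i = multiplicity (nth_prime i) (\<Prod>p\<in>nth_prime ` ?S. p ^ \<alpha> (inv nth_prime p))"
    by (simp only: prime_exponents_def)
  also have "\<dots> = (if nth_prime i \<in> nth_prime ` ?S then \<alpha> (inv nth_prime (nth_prime i)) else 0)"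
    by (rule multiplicity_prod_prime_powers[OF fin]) (use prime_nth_prime in auto)
  also have "\<dots> = \<alpha> i"
    unfolding inj_image_mem_iff[OF inj_nth_prime] inv_f_f[OF inj_nth_prime] by simp
  finally show "prime_exponents (prime_power \<alpha>) i = \<alpha> i" .
qed

lemma ln_prime_power:
  assumes "finite S" "{j. \<alpha> j \<noteq> 0} \<subseteq> S"
  shows "ln (real (prime_power \<alpha>)) = (\<Sum>j\<in>S. real (\<alpha> j) * ln (real (nth_prime j)))"
proof -
  have pos: "real (nth_prime j) > 0" for j using nth_prime_gt_1[of j] by simp
  have "prime_power \<alpha> = (\<Prod>j\<in>S. nth_prime j ^ \<alpha> j)"
    unfolding prime_power_def by (rule prod.mono_neutral_left) (use assms in auto)
  then have "ln (real (prime_power \<alpha>)) = ln (\<Prod>j\<in>S. real (nth_prime j) ^ \<alpha> j)"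
    by simp
  also have "\<dots> = (\<Sum>j\<in>S. ln (real (nth_prime j) ^ \<alpha> j))"
    using assms pos by (intro ln_prod) auto
  also have "\<dots> = (\<Sum>j\<in>S. real (\<alpha> j) * ln (real (nth_prime j)))"
    using pos by (simp add: ln_realpow)
  finally show ?thesis .
qed

text \<open>
  Moving the negative coefficients to the other side turns the relation into an equality of two
  products of prime powers, and prime factorisation is unique.
\<close>

lemma ln_prime_combination_eq_0:
  fixes k :: "nat \<Rightarrow> int"
  assumes S: "finite S" and 0: "(\<Sum>j\<in>S. of_int (k j) * ln (real (nth_prime j))) = 0" and "i \<in> S"
  shows "k i = 0"
proof -
  define \<alpha> where "\<alpha> j = (if j \<in> S then nat (k j) else 0)" for j
  define \<beta> where "\<beta> j = (if j \<in> S then nat (- k j) else 0)" for j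
  have supp: "{j. \<alpha> j \<noteq> 0} \<subseteq> S" "{j. \<beta> j \<noteq> 0} \<subseteq> S" by (auto simp: \<alpha>_def \<beta>_def split: if_splits)
  have ez: "\<alpha> \<in> eventually_zero" "\<beta> \<in> eventually_zero"
    using supp S by (auto simp: finite_nonzero_iff_eventually_zero intro: finite_subset)
  have "ln (real (prime_power \<alpha>)) - ln (real (prime_power \<beta>))
      = (\<Sum>j\<in>S. (real (\<alpha> j) - real (\<beta> j)) * ln (real (nth_prime j)))"
    unfolding ln_prime_power[OF S supp(1)] ln_prime_power[OF S supp(2)]
    by (simp add: sum_subtractf left_diff_distrib)
  also have "\<dots> = (\<Sum>j\<in>S. of_int (k j) * ln (real (nth_prime j)))"
    by (rule sum.cong) (auto simp: \<alpha>_def \<beta>_def)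
  finally have "ln (real (prime_power \<alpha>)) = ln (real (prime_power \<beta>))" using 0 by simp
  then have "prime_power \<alpha> = prime_power \<beta>"
    using prime_power_pos[of \<alpha>] prime_power_pos[of \<beta>] by simp
  then have "\<alpha> = \<beta>"
    using prime_exponents_prime_power ez by metis
  then have "\<alpha> i = \<beta> i" by simp
  then show ?thesis using \<open>i \<in> S\<close> by (auto simp: \<alpha>_def \<beta>_def)
qed

text \<open>
  For \<open>n \<ge> 1\<close> the value at \<open>n\<close> of the completely multiplicative function with value \<open>\<omega>\<^sub>j\<close> at the \<open>j\<close>-th prime.
\<close>

definition dirichlet_character :: "nat \<Rightarrow> (nat \<Rightarrow> complex) \<Rightarrow> complex" where
  "dirichlet_character n \<omega> = torus_monomial (\<lambda>j. int (prime_exponents n j)) \<omega>"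

text \<open>
  The flow \<open>t \<mapsto> (p\<^sub>j\<^sup>-\<^sup>i\<^sup>t)\<^sub>j\<close>.
\<close>

definition kronecker_flow :: "real \<Rightarrow> nat \<Rightarrow> complex" where
  "kronecker_flow t j = cis (- t * ln (real (nth_prime j)))"

lemma kronecker_flow_in_torus: "kronecker_flow t \<in> space torus"
  by (simp add: kronecker_flow_def space_torus)

lemma dirichlet_character_eq_prod:
  assumes "finite S" "{j. prime_exponents n j \<noteq> 0} \<subseteq> S"
  shows "dirichlet_character n \<omega> = (\<Prod>j\<in>S. \<omega> j ^ prime_exponents n j)"
  unfolding dirichlet_character_def by (subst torus_monomial_eq_prod[OF assms(1)]) (use assms in auto)

lemma dirichlet_character_flow:
  assumes "n > 0"
  shows "dirichlet_character n (kronecker_flow t) = cis (- t * ln (real n))"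
proof -
  let ?S = "{j. prime_exponents n j \<noteq> 0}"
  have S: "finite ?S" by (rule finite_prime_exponents_support[OF assms])
  have "dirichlet_character n (kronecker_flow t) = (\<Prod>j\<in>?S. cis (real (prime_exponents n j) * (- t * ln (real (nth_prime j)))))"
    unfolding dirichlet_character_eq_prod[OF S order_refl] kronecker_flow_def Complex.DeMoivre ..
  also have "\<dots> = cis (\<Sum>j\<in>?S. real (prime_exponents n j) * (- t * ln (real (nth_prime j))))"
    by (induction rule: finite_induct[OF S]) (simp_all add: cis_mult)
  also have "(\<Sum>j\<in>?S. real (prime_exponents n j) * (- t * ln (real (nth_prime j))))
      = - t * (\<Sum>j\<in>?S. real (prime_exponents n j) * ln (real (nth_prime j)))"
    by (subst sum_distrib_left) (rule sum.cong, auto)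
  also have "\<dots> = - t * ln (real n)"
    using ln_prime_power[OF S order_refl] prime_power_prime_exponents[OF assms] by simp
  finally show ?thesis .
qed

lemma inj_ln_nth_prime: "inj (\<lambda>j. ln (real (nth_prime j)))"
proof (rule injI)
  fix i j assume "ln (real (nth_prime i)) = ln (real (nth_prime j))"
  then have "nth_prime i = nth_prime j"
    using nth_prime_gt_1[of i] nth_prime_gt_1[of j] by simp
  then show "i = j" using inj_nth_prime by (auto dest: injD)
qed

lemma independent_ln_nth_prime:
  "module.independent (\<lambda>r. (*) (real_of_int r)) ((\<lambda>j. ln (real (nth_prime j))) ` {..<n})"
proof -
  interpret Modules.module "(\<lambda>r. (*) (real_of_int r))"
    by (simp add: Modules.module.intro distrib_left mult.commute)
  show ?thesis
    unfolding independent_explicit_module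
  proof (intro allI impI)
    fix T u v
    assume T: "finite T" "T \<subseteq> (\<lambda>j. ln (real (nth_prime j))) ` {..<n}"
      and 0: "(\<Sum>v\<in>T. real_of_int (u v) * v) = 0" and v: "v \<in> T"
    obtain S where S: "T = (\<lambda>j. ln (real (nth_prime j))) ` S" "finite S"
      using T by (meson finite_subset_image)
    obtain i where i: "i \<in> S" "v = ln (real (nth_prime i))" using v S by auto
    have "(\<Sum>j\<in>S. of_int (u (ln (real (nth_prime j)))) * ln (real (nth_prime j))) = 0"
      using 0 unfolding S by (subst (asm) sum.reindex) (auto intro: inj_on_subset[OF inj_ln_nth_prime])
    from ln_prime_combination_eq_0[OF S(2) this i(1)] show "u v = 0" by (simp add: i(2))
  qed
qed

text \<open>
  Kronecker's theorem approximates finitely many coordinates at once up to an arbitrary error. A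
  polynomial on the torus depends on finitely many coordinates, so convergence of these is enough.
\<close>

lemma kronecker_flow_dense:
  assumes "\<omega> \<in> space torus"
  obtains t where "\<And>j. j < J \<Longrightarrow> (\<lambda>k::nat. kronecker_flow (t k) j) \<longlonglongrightarrow> \<omega> j"
proof -
  define \<alpha> where "\<alpha> j = Arg (\<omega> j) / (2 * pi)" for j
  have \<omega>: "\<omega> j = cis (2 * pi * \<alpha> j)" for j
  proof -
    have "cmod (\<omega> j) = 1" using assms by (simp add: space_torus)
    then show ?thesis
      using cis_Arg[of "\<omega> j"] by (cases "\<omega> j = 0") (simp_all add: \<alpha>_def sgn_div_norm)
  qed
  have inj: "inj_on (\<lambda>j. ln (real (nth_prime j))) {..<J}"
    by (rule inj_on_subset[OF inj_ln_nth_prime]) simp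
  have "\<exists>t h. \<forall>j<J. \<bar>t * ln (real (nth_prime j)) - of_int (h j) - \<alpha> j\<bar> < 1 / Suc k" for k
    by (rule Kronecker_thm_1[OF independent_ln_nth_prime inj, of "1 / Suc k" \<alpha>]) auto
  then obtain t h where th: "\<And>k j. j < J \<Longrightarrow> \<bar>t k * ln (real (nth_prime j)) - of_int (h k j :: int) - \<alpha> j\<bar> < 1 / Suc k"
    by metis
  show ?thesis
  \<comment> \<open>Kronecker works modulo 1 with frequencies \<open>ln p\<^sub>j\<close>, the flow modulo \<open>2\<pi>\<close> with \<open>- ln p\<^sub>j\<close>.\<close>
  proof (rule that[of "\<lambda>k. - 2 * pi * t k"])
    fix j assume j: "j < J"
    let ?x = "\<lambda>k. t k * ln (real (nth_prime j)) - of_int (h k j)"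
    have L: "(\<lambda>k. 1 / real (Suc k)) \<longlonglongrightarrow> 0" by (rule LIMSEQ_Suc[OF lim_1_over_n])
    have "(\<lambda>k. \<bar>?x k - \<alpha> j\<bar>) \<longlonglongrightarrow> 0"
      by (rule tendsto_sandwich[OF _ _ tendsto_const L])
         (use th[OF j] in \<open>auto intro!: always_eventually less_imp_le\<close>)
    then have "?x \<longlonglongrightarrow> \<alpha> j" by (rule LIM_zero_cancel[OF tendsto_rabs_zero_cancel])
    then have "(\<lambda>k. cis (2 * pi * ?x k)) \<longlonglongrightarrow> \<omega> j"
      unfolding \<omega> cis_conv_exp by (intro tendsto_intros)
    moreover have "cis (2 * pi * ?x k) = kronecker_flow (- 2 * pi * t k) j" for k
    proof -
      have "cis (2 * pi * ?x k) = cis (2 * pi * (t k * ln (real (nth_prime j)))) * cis (2 * pi * (- of_int (h k j)))"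
        by (simp add: cis_mult algebra_simps)
      also have "cis (2 * pi * (- of_int (h k j))) = 1"
        by (rule cis_multiple_2pi) simp
      finally show ?thesis by (simp add: kronecker_flow_def mult.assoc)
    qed
    ultimately show "(\<lambda>k. kronecker_flow (- 2 * pi * t k) j) \<longlonglongrightarrow> \<omega> j" by simp
  qed
qed

text \<open>
  Values at arbitrary points of the torus are limits of values along the flow, where the polynomial is
  a Dirichlet polynomial on the imaginary axis.
\<close>

lemma norm_torus_polynomial_le:
  fixes c :: "nat \<Rightarrow> 'x::complex_banach"
  assumes I: "finite I" "0 \<notin> I" and M: "\<And>t. norm (\<Sum>n\<in>I. unit_power t n *\<^sub>C c n) \<le> M"
    and \<omega>: "\<omega> \<in> space torus"
  shows "norm (\<Sum>n\<in>I. dirichlet_character n \<omega> *\<^sub>C c n) \<le> M"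
proof -
  have pos: "n > 0" if "n \<in> I" for n using that I by (cases n) auto
  have "finite (\<Union>n\<in>I. {j. prime_exponents n j \<noteq> 0})"
    by (rule finite_UN_I[OF I(1)]) (rule finite_prime_exponents_support[OF pos])
  then obtain J where J: "(\<Union>n\<in>I. {j. prime_exponents n j \<noteq> 0}) \<subseteq> {..<J}"
    using finite_nat_bounded by blast
  obtain t where t: "\<And>j. j < J \<Longrightarrow> (\<lambda>k::nat. kronecker_flow (t k) j) \<longlonglongrightarrow> \<omega> j"
    using kronecker_flow_dense[OF \<omega>] by blast
  have "(\<lambda>k. dirichlet_character n (kronecker_flow (t k))) \<longlonglongrightarrow> dirichlet_character n \<omega>" if "n \<in> I" for n
  proof -
    have sub: "{j. prime_exponents n j \<noteq> 0} \<subseteq> {..<J}" using J that by blast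
    then show ?thesis
      unfolding dirichlet_character_eq_prod[OF finite_lessThan sub]
      by (intro tendsto_prod tendsto_power t) simp
  qed
  then have "(\<lambda>k. norm (\<Sum>n\<in>I. dirichlet_character n (kronecker_flow (t k)) *\<^sub>C c n))
      \<longlonglongrightarrow> norm (\<Sum>n\<in>I. dirichlet_character n \<omega> *\<^sub>C c n)"
    by (intro tendsto_norm tendsto_sum scaleC.tendsto tendsto_const)
  moreover have "norm (\<Sum>n\<in>I. dirichlet_character n (kronecker_flow (t k)) *\<^sub>C c n) \<le> M" for k
  proof -
    have "(\<Sum>n\<in>I. dirichlet_character n (kronecker_flow (t k)) *\<^sub>C c n) = (\<Sum>n\<in>I. cis (- t k * ln (real n)) *\<^sub>C c n)"
      by (rule sum.cong) (simp_all add: dirichlet_character_flow pos)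
    then show ?thesis using M[of "t k"] by simp
  qed
  ultimately show ?thesis by (intro LIMSEQ_le_const2) auto
qed


section \<open>Fejer means of Hardy functions\<close>

lemma scaleC_of_real_mult: "(of_real r * z) *\<^sub>C x = r *\<^sub>R z *\<^sub>C (x :: 'x::complex_banach)"
  by (simp only: scaleC_of_real[symmetric, of _ "z *\<^sub>C x"] scaleC_scaleC)

definition exponent_box :: "nat \<Rightarrow> (nat \<Rightarrow> nat) set" where
  "exponent_box m = PiE_dflt {..<m} 0 (\<lambda>_. {..m})"

text \<open>
  The Fourier coefficient, at the exponents of \<open>n\<close>, of the Fejer kernel
  \<open>\<bar>\<Sum>\<^bsub>\<gamma>\<in>B\<^esub> \<omega>\<^sup>\<gamma>\<bar>\<^sup>2 / card B\<close> with \<open>B\<close> the box of exponents: the proportion of \<open>\<gamma> \<in> B\<close> that stay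
  in \<open>B\<close> when shifted by these exponents.
\<close>

definition fejer_weight :: "nat \<Rightarrow> nat \<Rightarrow> real" where
  "fejer_weight m n = real (card {\<gamma> \<in> exponent_box m. (\<lambda>j. \<gamma> j + prime_exponents n j) \<in> exponent_box m})
     / real (card (exponent_box m))"

lemma finite_exponent_box: "finite (exponent_box m)"
  unfolding exponent_box_def by (rule finite_PiE_dflt) auto

lemma card_exponent_box: "card (exponent_box m) = Suc m ^ m"
  unfolding exponent_box_def by (subst card_PiE_dflt) auto

lemma exponent_box_iff: "\<gamma> \<in> exponent_box m \<longleftrightarrow> (\<forall>j. \<gamma> j \<le> (if j < m then m else 0))"
  by (auto simp: exponent_box_def PiE_dflt_def)

lemma exponent_box_eventually_zero:
  assumes "\<gamma> \<in> exponent_box m"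
  shows "\<gamma> \<in> eventually_zero"
proof -
  have "\<forall>j\<ge>m. \<gamma> j = 0"
    using assms by (metis exponent_box_iff le_zero_eq not_le)
  then show ?thesis by (auto simp: eventually_zero_def eventually_sequentially)
qed

lemma exponent_box_downward_closed:
  "\<gamma> \<in> exponent_box m \<Longrightarrow> (\<And>j. \<delta> j \<le> \<gamma> j) \<Longrightarrow> \<delta> \<in> exponent_box m"
  unfolding exponent_box_iff by (blast intro: order_trans)

text \<open>
  Once the box has more coordinates than \<open>n\<close> has prime places, the weight is the product of the numbers
  \<open>1 - e\<^sub>j / (m + 1)\<close> over the prime exponents \<open>e\<^sub>j\<close> of \<open>n\<close>.
\<close>

lemma fejer_weight_tendsto_1:
  assumes "n > 0"
  shows "(\<lambda>m. fejer_weight m n) \<longlonglongrightarrow> 1"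
proof -
  let ?S = "{j. prime_exponents n j \<noteq> 0}"
  have S: "finite ?S" by (rule finite_prime_exponents_support[OF assms])
  then obtain J where J: "?S \<subseteq> {..<J}" using finite_nat_bounded by blast
  have eq: "fejer_weight m n = (\<Prod>j\<in>?S. real (Suc m - prime_exponents n j) / real (Suc m))" if "m \<ge> J" for m
  proof -
    have out: "prime_exponents n j = 0" if "\<not> j < m" for j
      using that \<open>m \<ge> J\<close> J by (metis (mono_tags, lifting) lessThan_iff less_le_trans mem_Collect_eq subsetD)
    have pointwise: "\<gamma> j \<le> (if j < m then m else 0) \<and> \<gamma> j + prime_exponents n j \<le> (if j < m then m else 0)
        \<longleftrightarrow> (j \<in> {..<m} \<longrightarrow> \<gamma> j \<in> {..<Suc m - prime_exponents n j}) \<and> (j \<notin> {..<m} \<longrightarrow> \<gamma> j = 0)" for \<gamma> j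
      using out[of j] by auto
    have "{\<gamma> \<in> exponent_box m. (\<lambda>j. \<gamma> j + prime_exponents n j) \<in> exponent_box m}
        = PiE_dflt {..<m} 0 (\<lambda>j. {..<Suc m - prime_exponents n j})"
      unfolding PiE_dflt_def pointwise[symmetric] exponent_box_iff by blast
    then have "card {\<gamma> \<in> exponent_box m. (\<lambda>j. \<gamma> j + prime_exponents n j) \<in> exponent_box m}
        = (\<Prod>j<m. Suc m - prime_exponents n j)"
      by (simp add: card_PiE_dflt)
    then have "fejer_weight m n = (\<Prod>j<m. real (Suc m - prime_exponents n j) / real (Suc m))"
      unfolding fejer_weight_def card_exponent_box by (simp add: prod_dividef)
    also have "\<dots> = (\<Prod>j\<in>?S. real (Suc m - prime_exponents n j) / real (Suc m))"
      using J that by (intro prod.mono_neutral_right) auto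
    finally show ?thesis .
  qed
  have "(\<lambda>m. \<Prod>j\<in>?S. real (Suc m - prime_exponents n j) / real (Suc m)) \<longlonglongrightarrow> (\<Prod>j\<in>?S. 1)"
  proof (rule tendsto_prod)
    fix j
    have "(\<lambda>m. 1 - real (prime_exponents n j) * (1 / real (Suc m))) \<longlonglongrightarrow> 1 - real (prime_exponents n j) * 0"
      by (intro tendsto_diff tendsto_mult tendsto_const LIMSEQ_Suc[OF lim_1_over_n])
    moreover have "eventually (\<lambda>m. 1 - real (prime_exponents n j) * (1 / real (Suc m))
        = real (Suc m - prime_exponents n j) / real (Suc m)) sequentially"
      unfolding eventually_sequentially
      by (intro exI[of _ "prime_exponents n j"]) (auto simp: of_nat_diff field_simps)
    ultimately show "(\<lambda>m. real (Suc m - prime_exponents n j) / real (Suc m)) \<longlonglongrightarrow> 1"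
      by (simp add: tendsto_cong)
  qed
  moreover have "eventually (\<lambda>m. (\<Prod>j\<in>?S. real (Suc m - prime_exponents n j) / real (Suc m)) = fejer_weight m n) sequentially"
    unfolding eventually_sequentially by (intro exI[of _ J] allI impI eq[symmetric])
  ultimately show ?thesis by (simp add: tendsto_cong)
qed

text \<open>
  The sum is \<open>\<integral> f(\<eta>) \<bar>Q(\<eta>)\<bar>\<^sup>2 d\<eta>\<close>, where \<open>Q(\<eta>) = \<Sum>\<^bsub>\<beta>\<in>B\<^esub> \<omega>\<^sup>\<beta> \<eta>\<^sup>-\<^sup>\<beta>\<close>. The weight \<open>\<bar>Q\<bar>\<^sup>2\<close> is nonnegative, and its
  integral is \<open>card B\<close> by orthogonality of the monomials.
\<close>

lemma norm_fourier_box_average_le: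
  fixes f :: "(nat \<Rightarrow> complex) \<Rightarrow> 'x::complex_banach"
  assumes f: "f \<in> Linf_torus" "Linf_norm f = ereal C"
    and B: "finite B" "B \<subseteq> eventually_zero" and \<omega>: "\<omega> \<in> space torus"
  shows "norm (\<Sum>\<beta>\<in>B. \<Sum>\<gamma>\<in>B. torus_monomial (\<lambda>j. \<beta> j - \<gamma> j) \<omega> *\<^sub>C fourier_coeff f (\<lambda>j. \<beta> j - \<gamma> j))
    \<le> real (card B) * C"
proof -
  obtain C' where C': "strongly_measurable torus f" "AE \<eta> in torus. norm (f \<eta>) \<le> C'" "Linf_norm f = ereal C'"
    using Linf_torusD[OF f(1)] by metis
  then have AE: "AE \<eta> in torus. norm (f \<eta>) \<le> C" using f(2) by simp
  define q where "q \<beta> \<gamma> \<eta> = torus_monomial (\<lambda>j. \<beta> j - \<gamma> j) \<omega> * torus_monomial (\<lambda>j. - (\<beta> j - \<gamma> j)) \<eta>" for \<beta> \<gamma> \<eta>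
  define Q where "Q \<eta> = (\<Sum>\<beta>\<in>B. torus_monomial \<beta> \<omega> * cnj (torus_monomial \<beta> \<eta>))" for \<eta>
  have ezm: "(\<lambda>j. - \<alpha> j) \<in> eventually_zero" if "\<alpha> \<in> eventually_zero" for \<alpha> :: "nat \<Rightarrow> int"
    using that by (simp add: eventually_zero_def)
  have split: "torus_monomial (\<lambda>j. \<beta> j - \<gamma> j) \<eta> = torus_monomial \<beta> \<eta> * cnj (torus_monomial \<gamma> \<eta>)"
    if "\<beta> \<in> eventually_zero" "\<gamma> \<in> eventually_zero" "\<eta> \<in> space torus" for \<beta> \<gamma> \<eta>
    using torus_monomial_add[OF that(1) ezm[OF that(2)] that(3)] torus_monomial_uminus[OF that(3)] by simp
  have q: "q \<beta> \<gamma> \<eta> = (torus_monomial \<beta> \<omega> * cnj (torus_monomial \<beta> \<eta>)) * cnj (torus_monomial \<gamma> \<omega> * cnj (torus_monomial \<gamma> \<eta>))"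
    if "\<beta> \<in> B" "\<gamma> \<in> B" "\<eta> \<in> space torus" for \<beta> \<gamma> \<eta>
  proof -
    have "\<beta> \<in> eventually_zero" "\<gamma> \<in> eventually_zero" using that B by auto
    then show ?thesis
      unfolding q_def using split[of \<beta> \<gamma> \<omega>] split[of \<gamma> \<beta> \<eta>] that \<omega> by simp
  qed
  \<comment> \<open>Together with its conjugate, \<open>Q\<close> factorises the double sum of the kernel.\<close>
  have sumq: "(\<Sum>\<beta>\<in>B. \<Sum>\<gamma>\<in>B. q \<beta> \<gamma> \<eta>) = of_real ((cmod (Q \<eta>))\<^sup>2)" if "\<eta> \<in> space torus" for \<eta>
    using that by (simp add: q complex_norm_square Q_def sum_product cnj_sum flip: of_real_power)
  have "has_strong_integral torus (\<lambda>\<eta>. \<Sum>\<beta>\<in>B. \<Sum>\<gamma>\<in>B. torus_monomial (\<lambda>j. \<beta> j - \<gamma> j) \<omega> *\<^sub>C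
      (torus_monomial (\<lambda>j. - (\<beta> j - \<gamma> j)) \<eta> *\<^sub>C f \<eta>))
      (\<Sum>\<beta>\<in>B. \<Sum>\<gamma>\<in>B. torus_monomial (\<lambda>j. \<beta> j - \<gamma> j) \<omega> *\<^sub>C fourier_coeff f (\<lambda>j. \<beta> j - \<gamma> j))"
    by (intro has_strong_integral_sum has_strong_integral_scaleC has_strong_integral_fourier_coeff f)
  then have hsi: "has_strong_integral torus (\<lambda>\<eta>. (\<Sum>\<beta>\<in>B. \<Sum>\<gamma>\<in>B. q \<beta> \<gamma> \<eta>) *\<^sub>C f \<eta>)
      (\<Sum>\<beta>\<in>B. \<Sum>\<gamma>\<in>B. torus_monomial (\<lambda>j. \<beta> j - \<gamma> j) \<omega> *\<^sub>C fourier_coeff f (\<lambda>j. \<beta> j - \<gamma> j))"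
    by (simp add: q_def scaleC_scaleC scaleC.sum_left)
  have intq: "has_bochner_integral torus (\<lambda>\<eta>. \<Sum>\<beta>\<in>B. \<Sum>\<gamma>\<in>B. q \<beta> \<gamma> \<eta>) (of_nat (card B))"
  proof -
    have "has_bochner_integral torus (\<lambda>\<eta>. q \<beta> \<gamma> \<eta>) (if \<gamma> = \<beta> then 1 else 0)" if "\<beta> \<in> B" "\<gamma> \<in> B" for \<beta> \<gamma>
    proof -
      have "\<beta> \<in> eventually_zero" "\<gamma> \<in> eventually_zero" using that B by auto
      then have ez: "(\<lambda>j. - (\<beta> j - \<gamma> j)) \<in> eventually_zero"
        unfolding eventually_zero_def mem_Collect_eq by (rule eventually_elim2) simp
      have eq: "(\<lambda>j. - (\<beta> j - \<gamma> j)) = (\<lambda>_. 0) \<longleftrightarrow> \<gamma> = \<beta>" by (auto simp: fun_eq_iff)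
      have "has_bochner_integral torus (torus_monomial (\<lambda>j. - (\<beta> j - \<gamma> j))) (if \<gamma> = \<beta> then 1 else 0)"
        using has_bochner_integral_integrable[OF integrable_torus_monomial, of "\<lambda>j. - (\<beta> j - \<gamma> j)"]
        unfolding integral_torus_monomial[OF ez] eq .
      from has_bochner_integral_mult_right[OF this, of "torus_monomial (\<lambda>j. \<beta> j - \<gamma> j) \<omega>"]
      show ?thesis by (auto simp: q_def split: if_splits)
    qed
    then have "has_bochner_integral torus (\<lambda>\<eta>. \<Sum>\<beta>\<in>B. \<Sum>\<gamma>\<in>B. q \<beta> \<gamma> \<eta>) (\<Sum>\<beta>\<in>B. \<Sum>\<gamma>\<in>B. if \<gamma> = \<beta> then 1 else 0)"
      by (intro has_bochner_integral_sum)
    moreover have "(\<Sum>\<beta>\<in>B. \<Sum>\<gamma>\<in>B. if \<gamma> = \<beta> then 1 else 0) = (of_nat (card B) :: complex)"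
      using B by simp
    ultimately show ?thesis by simp
  qed
  have int: "has_bochner_integral torus (\<lambda>\<eta>. Re (\<Sum>\<beta>\<in>B. \<Sum>\<gamma>\<in>B. q \<beta> \<gamma> \<eta>) * C) (real (card B) * C)"
    using has_bochner_integral_mult_left[OF has_bochner_integral_bounded_linear[OF bounded_linear_Re intq], of C]
    by simp
  have "AE \<eta> in torus. norm ((\<Sum>\<beta>\<in>B. \<Sum>\<gamma>\<in>B. q \<beta> \<gamma> \<eta>) *\<^sub>C f \<eta>) \<le> Re (\<Sum>\<beta>\<in>B. \<Sum>\<gamma>\<in>B. q \<beta> \<gamma> \<eta>) * C"
    using AE AE_space
    by eventually_elim (simp add: sumq norm_scaleC mult_left_mono del: of_real_power)
  from has_strong_integral_norm_le_integral[OF hsi _ this] int show ?thesis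
    unfolding has_bochner_integral_iff by metis
qed

text \<open>
  In the double sum over the box only the differences \<open>\<beta> - \<gamma>\<close> with nonnegative entries survive. Each
  of them is the exponent sequence of one number \<open>n\<close>, and grouping by \<open>n\<close> produces the Fejer weights.
\<close>

lemma norm_fejer_sum_le:
  fixes f :: "(nat \<Rightarrow> complex) \<Rightarrow> 'x::complex_banach"
  assumes f: "represents f b" "Linf_norm f = ereal C" and \<omega>: "\<omega> \<in> space torus"
  shows "norm (\<Sum>n\<in>prime_power ` exponent_box m. (fejer_weight m n * dirichlet_character n \<omega>) *\<^sub>C b n) \<le> C"
proof -
  let ?E = "exponent_box m"
  let ?i = "\<lambda>\<gamma>::nat \<Rightarrow> nat. (\<lambda>j. int (\<gamma> j))"
  let ?B = "?i ` ?E"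
  define G where "G \<delta> = torus_monomial (?i \<delta>) \<omega> *\<^sub>C b (prime_power \<delta>)" for \<delta>
  have inj: "inj ?i" by (auto simp: inj_def fun_eq_iff)
  have ez: "?i \<gamma> \<in> eventually_zero" if "\<gamma> \<in> ?E" for \<gamma>
    using exponent_box_eventually_zero[OF that] by (simp add: eventually_zero_def)
  have Linf: "f \<in> Linf_torus" using f(1) by (simp add: represents_def Hinf_torus_def)
  have term_eq: "torus_monomial (\<lambda>j. int (\<beta> j) - int (\<gamma> j)) \<omega> *\<^sub>C fourier_coeff f (\<lambda>j. int (\<beta> j) - int (\<gamma> j))
      = (if \<gamma> \<le> \<beta> then G (\<lambda>j. \<beta> j - \<gamma> j) else 0)" if "\<beta> \<in> ?E" "\<gamma> \<in> ?E" for \<beta> \<gamma>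
  proof (cases "\<gamma> \<le> \<beta>")
    case True
    have eq: "(\<lambda>j. int (\<beta> j) - int (\<gamma> j)) = ?i (\<lambda>j. \<beta> j - \<gamma> j)"
      using True by (auto simp: le_fun_def of_nat_diff)
    have "(\<lambda>j. \<beta> j - \<gamma> j) \<in> ?E" by (rule exponent_box_downward_closed[OF that(1)]) simp
    then show ?thesis
      using f(1) True exponent_box_eventually_zero unfolding represents_def G_def eq by simp
  next
    case False
    then obtain i where "\<beta> i < \<gamma> i" by (auto simp: le_fun_def not_le)
    then have "\<exists>j. int (\<beta> j) - int (\<gamma> j) < 0" by (intro exI[of _ i]) simp
    moreover have "(\<lambda>j. int (\<beta> j) - int (\<gamma> j)) \<in> eventually_zero"
      using ez[OF that(1)] ez[OF that(2)] unfolding eventually_zero_def by (auto elim: eventually_elim2)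
    ultimately have "fourier_coeff f (\<lambda>j. int (\<beta> j) - int (\<gamma> j)) = 0"
      using f(1) by (auto simp: represents_def Hinf_torus_def)
    then show ?thesis using False by (simp add: scaleC.zero_right)
  qed
  have "(\<Sum>\<beta>\<in>?B. \<Sum>\<gamma>\<in>?B. torus_monomial (\<lambda>j. \<beta> j - \<gamma> j) \<omega> *\<^sub>C fourier_coeff f (\<lambda>j. \<beta> j - \<gamma> j))
      = (\<Sum>\<beta>\<in>?E. \<Sum>\<gamma>\<in>?E. torus_monomial (\<lambda>j. int (\<beta> j) - int (\<gamma> j)) \<omega> *\<^sub>C fourier_coeff f (\<lambda>j. int (\<beta> j) - int (\<gamma> j)))"
    by (simp add: sum.reindex[OF inj_on_subset[OF inj subset_UNIV]])
  also have "\<dots> = (\<Sum>\<beta>\<in>?E. \<Sum>\<gamma>\<in>?E. if \<gamma> \<le> \<beta> then G (\<lambda>j. \<beta> j - \<gamma> j) else 0)"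
    by (intro sum.cong refl term_eq)
  also have "\<dots> = (\<Sum>\<gamma>\<in>?E. \<Sum>\<beta>\<in>?E. if \<gamma> \<le> \<beta> then G (\<lambda>j. \<beta> j - \<gamma> j) else 0)"
    by (rule sum.swap)
  also have "\<dots> = (\<Sum>\<gamma>\<in>?E. \<Sum>\<delta>\<in>?E. if (\<lambda>j. \<gamma> j + \<delta> j) \<in> ?E then G \<delta> else 0)"
  proof (rule sum.cong[OF refl])
    fix \<gamma> assume \<gamma>: "\<gamma> \<in> ?E"
    have "(\<Sum>\<beta>\<in>{\<beta>\<in>?E. \<gamma> \<le> \<beta>}. G (\<lambda>j. \<beta> j - \<gamma> j)) = (\<Sum>\<delta>\<in>{\<delta>\<in>?E. (\<lambda>j. \<gamma> j + \<delta> j) \<in> ?E}. G \<delta>)"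
      by (rule sum.reindex_bij_witness[of _ "\<lambda>\<delta> j. \<gamma> j + \<delta> j" "\<lambda>\<beta> j. \<beta> j - \<gamma> j"])
         (auto simp: le_fun_def intro: exponent_box_downward_closed)
    then show "(\<Sum>\<beta>\<in>?E. if \<gamma> \<le> \<beta> then G (\<lambda>j. \<beta> j - \<gamma> j) else 0) = (\<Sum>\<delta>\<in>?E. if (\<lambda>j. \<gamma> j + \<delta> j) \<in> ?E then G \<delta> else 0)"
      by (simp add: sum.inter_filter[OF finite_exponent_box])
  qed
  also have "\<dots> = (\<Sum>\<delta>\<in>?E. \<Sum>\<gamma>\<in>?E. if (\<lambda>j. \<gamma> j + \<delta> j) \<in> ?E then G \<delta> else 0)"
    by (rule sum.swap)
  also have "\<dots> = (\<Sum>\<delta>\<in>?E. real (card {\<gamma>\<in>?E. (\<lambda>j. \<gamma> j + \<delta> j) \<in> ?E}) *\<^sub>R G \<delta>)"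
    by (simp add: sum.inter_filter[OF finite_exponent_box, symmetric] sum_constant_scaleR)
  also have "\<dots> = (\<Sum>n\<in>prime_power ` ?E. real (card {\<gamma>\<in>?E. (\<lambda>j. \<gamma> j + prime_exponents n j) \<in> ?E}) *\<^sub>R (dirichlet_character n \<omega> *\<^sub>C b n))"
  proof (subst sum.reindex)
    show "inj_on prime_power ?E"
      by (rule inj_on_inverseI[of _ prime_exponents])
         (simp add: prime_exponents_prime_power exponent_box_eventually_zero)
  qed (auto intro!: sum.cong simp: prime_exponents_prime_power exponent_box_eventually_zero G_def dirichlet_character_def)
  finally have eq: "(\<Sum>\<beta>\<in>?B. \<Sum>\<gamma>\<in>?B. torus_monomial (\<lambda>j. \<beta> j - \<gamma> j) \<omega> *\<^sub>C fourier_coeff f (\<lambda>j. \<beta> j - \<gamma> j))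
      = (\<Sum>n\<in>prime_power ` ?E. real (card {\<gamma>\<in>?E. (\<lambda>j. \<gamma> j + prime_exponents n j) \<in> ?E}) *\<^sub>R (dirichlet_character n \<omega> *\<^sub>C b n))" .
  have card: "card ?B = card ?E" by (rule card_image[OF inj_on_subset[OF inj subset_UNIV]])
  have cpos: "real (card ?E) > 0" by (simp add: card_exponent_box)
  have "norm (\<Sum>n\<in>prime_power ` ?E. real (card {\<gamma>\<in>?E. (\<lambda>j. \<gamma> j + prime_exponents n j) \<in> ?E}) *\<^sub>R (dirichlet_character n \<omega> *\<^sub>C b n))
      \<le> real (card ?E) * C"
    unfolding eq[symmetric] card[symmetric]
    by (rule norm_fourier_box_average_le[OF Linf f(2) _ _ \<omega>]) (use ez finite_exponent_box in auto)
  then have "norm ((1 / real (card ?E)) *\<^sub>R (\<Sum>n\<in>prime_power ` ?E. real (card {\<gamma>\<in>?E. (\<lambda>j. \<gamma> j + prime_exponents n j) \<in> ?E}) *\<^sub>R (dirichlet_character n \<omega> *\<^sub>C b n))) \<le> C"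
    using cpos by (simp add: divide_simps mult.commute)
  also have "(1 / real (card ?E)) *\<^sub>R (\<Sum>n\<in>prime_power ` ?E. real (card {\<gamma>\<in>?E. (\<lambda>j. \<gamma> j + prime_exponents n j) \<in> ?E}) *\<^sub>R (dirichlet_character n \<omega> *\<^sub>C b n))
      = (\<Sum>n\<in>prime_power ` ?E. (fejer_weight m n * dirichlet_character n \<omega>) *\<^sub>C b n)"
    unfolding scaleR_sum_right scaleC_of_real_mult fejer_weight_def by simp
  finally show ?thesis .
qed

lemma norm_fejer_dirichlet_polynomial_le:
  fixes f :: "(nat \<Rightarrow> complex) \<Rightarrow> 'x::complex_banach"
  assumes f: "represents f b" "Linf_norm f = ereal C"
  shows "norm (\<Sum>n\<in>prime_power ` exponent_box m. unit_power t n *\<^sub>C (fejer_weight m n *\<^sub>R b n)) \<le> C"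
proof -
  have "(fejer_weight m n * dirichlet_character n (kronecker_flow t)) *\<^sub>C b n = unit_power t n *\<^sub>C (fejer_weight m n *\<^sub>R b n)"
    if n: "n \<in> prime_power ` exponent_box m" for n
  proof -
    have "n > 0" using n prime_power_pos by auto
    then show ?thesis
      by (simp only: dirichlet_character_flow scaleC_of_real[symmetric, of _ "b n"] scaleC_scaleC mult.commute)
  qed
  then show ?thesis
    using norm_fejer_sum_le[OF f kronecker_flow_in_torus[of t], of m] by simp
qed


section \<open>A summation kernel of small norm\<close>

text \<open>
  An integrable majorant for the kernels below: bounded near 0, and decaying just fast enough at
  infinity.
\<close>

definition cut_power :: "real \<Rightarrow> real \<Rightarrow> real" where
  "cut_power \<delta> t = (if \<bar>t\<bar> \<le> 1 then 1 else \<bar>t\<bar> powr (- 1 - \<delta>))"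

lemma cut_power_nonneg: "0 \<le> cut_power \<delta> t"
  by (simp add: cut_power_def)

lemma integrable_cut_power:
  assumes "\<delta> > 0"
  shows "integrable lborel (cut_power \<delta>)"
proof -
  define v where "v t = (if 1 \<le> t then t powr (- 1 - \<delta>) else 0)" for t :: real
  have "(\<integral>\<^sup>+t. ennreal (t powr (- 1 - \<delta>)) * indicator {1..} t \<partial>lborel) = 0 - (- (1 powr (- \<delta>) / \<delta>))"
  proof (rule nn_integral_FTC_atLeast[where F = "\<lambda>t. - (t powr (- \<delta>) / \<delta>)"])
    show "((\<lambda>t. - (t powr (- \<delta>) / \<delta>)) has_real_derivative t powr (- 1 - \<delta>)) (at t)" if "1 \<le> t" for t
      using that assms by (auto intro!: derivative_eq_intros simp: powr_diff powr_minus field_simps)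
    have "((\<lambda>t. - (t powr (- \<delta>) / \<delta>)) \<longlongrightarrow> - (0 / \<delta>)) at_top"
      by (intro tendsto_minus tendsto_divide tendsto_const tendsto_neg_powr filterlim_ident) (use assms in auto)
    then show "((\<lambda>t. - (t powr (- \<delta>) / \<delta>)) \<longlongrightarrow> 0) at_top" by simp
  qed auto
  then have "(\<integral>\<^sup>+t. ennreal (v t) \<partial>lborel) < \<infinity>"
    by (subst nn_integral_cong[where v = "\<lambda>t. ennreal (t powr (- 1 - \<delta>)) * indicator {1..} t"])
       (auto simp: v_def indicator_def)
  moreover have vm: "v \<in> borel_measurable borel" unfolding v_def by measurable
  ultimately have v: "integrable lborel v"
    by (intro integrableI_nonneg) (auto simp: v_def)
  have "integrable lborel (\<lambda>t. v t + v (0 + (-1) * t) + indicator {-1..1} t)"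
    by (intro Bochner_Integration.integrable_add v lborel_integrable_real_affine) auto
  then show ?thesis
    by (rule Bochner_Integration.integrable_bound)
       (auto simp: cut_power_def[abs_def] v_def indicator_def)
qed

lemma abs_cos_diff_le:
  fixes a b t :: real
  shows "\<bar>cos (a * t) - cos (b * t)\<bar> \<le> \<bar>b - a\<bar> * \<bar>a + b\<bar> * t\<^sup>2 / 2" (is ?A)
  "\<bar>cos (a * t) - cos (b * t)\<bar> \<le> \<bar>b - a\<bar> * \<bar>t\<bar>" (is ?B)
proof -
  have eq: "\<bar>cos (a * t) - cos (b * t)\<bar> = 2 * \<bar>sin ((a + b) * t / 2)\<bar> * \<bar>sin ((b - a) * t / 2)\<bar>"
    by (simp add: cos_diff_cos abs_mult distrib_right left_diff_distrib)
  have "\<bar>sin ((a + b) * t / 2)\<bar> * \<bar>sin ((b - a) * t / 2)\<bar> \<le> \<bar>(a + b) * t / 2\<bar> * \<bar>(b - a) * t / 2\<bar>"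
    by (intro mult_mono abs_sin_x_le_abs_x) auto
  also have "\<dots> = \<bar>b - a\<bar> * \<bar>a + b\<bar> * t\<^sup>2 / 4"
    unfolding power2_abs[of t, symmetric] power2_eq_square by (simp add: abs_mult)
  finally show ?A
    unfolding eq by linarith
  have "\<bar>sin ((a + b) * t / 2)\<bar> * \<bar>sin ((b - a) * t / 2)\<bar> \<le> 1 * \<bar>(b - a) * t / 2\<bar>"
    by (intro mult_mono abs_sin_x_le_abs_x) auto
  then show ?B
    unfolding eq by (simp add: abs_mult)
qed

lemma integrable_one_minus_cos: "integrable lborel (\<lambda>t. (1 - cos t) / t\<^sup>2 :: real)"
proof (rule Bochner_Integration.integrable_bound)
  show "integrable lborel (\<lambda>t. 2 * cut_power 1 t)"
    by (intro integrable_mult_right integrable_cut_power) simp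
  show "AE t in lborel. norm ((1 - cos t) / t\<^sup>2 :: real) \<le> norm (2 * cut_power 1 t)"
  proof (rule AE_I2)
    fix t :: real
    have 1: "\<bar>1 - cos t\<bar> \<le> t\<^sup>2 / 2" using abs_cos_diff_le(1)[of 0 t 1] by simp
    have 2: "\<bar>1 - cos t\<bar> \<le> 2" using cos_le_one[of t] cos_ge_minus_one[of t] by linarith
    show "norm ((1 - cos t) / t\<^sup>2 :: real) \<le> norm (2 * cut_power 1 t)"
    proof (cases "\<bar>t\<bar> \<le> 1")
      case True
      have "\<bar>1 - cos t\<bar> \<le> 2 * t\<^sup>2" using 1 zero_le_power2[of t] by linarith
      then have "\<bar>1 - cos t\<bar> / t\<^sup>2 \<le> 2" by (cases "t = 0") (auto simp: divide_simps)
      then show ?thesis using True by (simp add: cut_power_def)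
    next
      case False
      then have "cut_power 1 t = 1 / t\<^sup>2"
        using powr_minus[of "\<bar>t\<bar>" 2] by (simp add: cut_power_def divide_inverse powr_numeral)
      then show ?thesis using 2 divide_right_mono[OF 2, of "t\<^sup>2"] by simp
    qed
  qed
qed measurable

text \<open>
  Equal to \<open>\<pi>\<close>. It normalises the kernel below.
\<close>

definition cosine_mass :: real where
  "cosine_mass = (\<integral>t. (1 - cos t) / t\<^sup>2 \<partial>lborel)"

lemma cosine_mass_pos: "cosine_mass > 0"
proof -
  have c: "(1 - cos 1) / 4 > (0::real)"
    using cos_monotone_0_pi[of 0 1] pi_gt3 by simp
  have "(1 - cos 1) / 4 = (\<integral>t. (1 - cos (1::real)) / 4 * indicator {1..2::real} t \<partial>lborel)" by simp
  also have "\<dots> \<le> cosine_mass"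
    unfolding cosine_mass_def
  proof (rule integral_mono[OF _ integrable_one_minus_cos])
    fix t :: real
    show "(1 - cos 1) / 4 * indicator {1..2} t \<le> (1 - cos t) / t\<^sup>2"
    proof (cases "t \<in> {1..2}")
      case True
      have "cos t \<le> cos 1" using True pi_gt3 by (intro cos_monotone_0_pi_le) auto
      moreover have "t\<^sup>2 \<le> 2\<^sup>2" using True by (intro power_mono) auto
      moreover have "0 < t\<^sup>2" using True by auto
      ultimately have "(1 - cos 1) / 4 \<le> (1 - cos t) / t\<^sup>2"
        using c by (intro frac_le) auto
      then show ?thesis using True by simp
    next
      case False
      then show ?thesis by (simp add: divide_nonneg_nonneg)
    qed
  qed simp
  finally show ?thesis using c by linarith
qed

text \<open>
  Substituting \<open>x t\<close> for \<open>t\<close> shows that the integral is proportional to \<open>\<bar>x\<bar>\<close>.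
\<close>

lemma has_bochner_integral_one_minus_cos:
  "has_bochner_integral lborel (\<lambda>t. (1 - cos (x * t)) / t\<^sup>2) (\<bar>x\<bar> * cosine_mass)"
proof (cases "x = 0")
  case True
  then show ?thesis by (simp add: has_bochner_integral_zero)
next
  case False
  let ?f = "\<lambda>t::real. (1 - cos t) / t\<^sup>2"
  have "integrable lborel (\<lambda>t. x\<^sup>2 * ?f (0 + x * t))"
    using lborel_integrable_real_affine[OF integrable_one_minus_cos False, of 0] by (intro integrable_mult_right) simp
  moreover have "(\<integral>t. x\<^sup>2 * ?f (0 + x * t) \<partial>lborel) = \<bar>x\<bar> * cosine_mass"
  proof -
    have e1: "cosine_mass = \<bar>x\<bar> *\<^sub>R (\<integral>t. ?f (0 + x * t) \<partial>lborel)"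
      unfolding cosine_mass_def by (rule lborel_integral_real_affine[OF False])
    have e2: "x\<^sup>2 = \<bar>x\<bar> * \<bar>x\<bar>" by (simp add: power2_eq_square)
    have e3: "(\<integral>t. x\<^sup>2 * ?f (0 + x * t) \<partial>lborel) = x\<^sup>2 * (\<integral>t. ?f (0 + x * t) \<partial>lborel)"
      by (rule integral_mult_right_zero)
    show ?thesis unfolding e3 e1 unfolding e2 by simp
  qed
  moreover have "(\<lambda>t. x\<^sup>2 * ?f (0 + x * t)) = (\<lambda>t. (1 - cos (x * t)) / t\<^sup>2)"
    using False by (auto simp: power_mult_distrib)
  ultimately show ?thesis by (simp add: has_bochner_integral_iff)
qed

text \<open>
  On \<open>[0, \<infinity>)\<close> its Fourier transform is 1 up to \<open>a\<close>, 0 from \<open>b\<close> on, and linear in between.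
\<close>

definition trapezoid_kernel :: "real \<Rightarrow> real \<Rightarrow> real \<Rightarrow> real" where
  "trapezoid_kernel a b t = (cos (a * t) - cos (b * t)) / (cosine_mass * (b - a) * t\<^sup>2)"

lemma measurable_trapezoid_kernel [measurable]: "trapezoid_kernel a b \<in> borel_measurable borel"
  unfolding trapezoid_kernel_def by measurable

text \<open>
  The product formula for cosines expresses the integrand through four terms \<open>(1 - cos (x t)) / t\<^sup>2\<close>,
  whose integrals are multiples of \<open>\<bar>x\<bar>\<close>. For \<open>0 \<le> l\<close> the resulting value is 1 if \<open>l \<le> a\<close> and 0 if
  \<open>b \<le> l\<close>, provided that \<open>0 \<le> a\<close>.
\<close>

lemma has_bochner_integral_trapezoid_kernel_cos:
  assumes "a < b"
  shows "has_bochner_integral lborel (\<lambda>t. trapezoid_kernel a b t * cos (l * t))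
    ((\<bar>b + l\<bar> + \<bar>b - l\<bar> - \<bar>a + l\<bar> - \<bar>a - l\<bar>) / (2 * (b - a)))"
proof -
  let ?J = "cosine_mass"
  have J: "?J \<noteq> 0" using cosine_mass_pos by simp
  let ?h = "\<lambda>x t. (1 - cos (x * t)) / t\<^sup>2"
  have "has_bochner_integral lborel
      (\<lambda>t. 1 / (2 * ?J * (b - a)) * (?h (b + l) t + ?h (b - l) t - ?h (a + l) t - ?h (a - l) t))
      (1 / (2 * ?J * (b - a)) * (\<bar>b + l\<bar> * ?J + \<bar>b - l\<bar> * ?J - \<bar>a + l\<bar> * ?J - \<bar>a - l\<bar> * ?J))"
    by (intro has_bochner_integral_mult_right has_bochner_integral_add has_bochner_integral_diff
        has_bochner_integral_one_minus_cos)
  moreover have "1 / (2 * ?J * (b - a)) * (?h (b + l) t + ?h (b - l) t - ?h (a + l) t - ?h (a - l) t)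
      = trapezoid_kernel a b t * cos (l * t)" for t
  proof -
    have c: "cos ((x + l) * t) + cos ((x - l) * t) = 2 * cos (x * t) * cos (l * t)" for x
      by (simp add: distrib_right left_diff_distrib cos_add cos_diff)
    have "?h (b + l) t + ?h (b - l) t - ?h (a + l) t - ?h (a - l) t
        = ((cos ((a + l) * t) + cos ((a - l) * t)) - (cos ((b + l) * t) + cos ((b - l) * t))) / t\<^sup>2"
      by (simp add: add_divide_distrib diff_divide_distrib)
    also have "\<dots> = 2 * (cos (a * t) - cos (b * t)) * cos (l * t) / t\<^sup>2"
      unfolding c by (simp add: algebra_simps)
    finally have eq: "?h (b + l) t + ?h (b - l) t - ?h (a + l) t - ?h (a - l) t
        = 2 * (cos (a * t) - cos (b * t)) * cos (l * t) / t\<^sup>2" .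
    have "1 / (2 * x) * (2 * d * c / s) = d / (x * s) * c" for x d c s :: real by simp
    from this[of "?J * (b - a)"] show ?thesis
      unfolding eq trapezoid_kernel_def by (simp only: mult.assoc)
  qed
  moreover have "1 / (2 * ?J * (b - a)) * (\<bar>b + l\<bar> * ?J + \<bar>b - l\<bar> * ?J - \<bar>a + l\<bar> * ?J - \<bar>a - l\<bar> * ?J)
      = (\<bar>b + l\<bar> + \<bar>b - l\<bar> - \<bar>a + l\<bar> - \<bar>a - l\<bar>) / (2 * (b - a))"
  proof -
    have "\<bar>b + l\<bar> * ?J + \<bar>b - l\<bar> * ?J - \<bar>a + l\<bar> * ?J - \<bar>a - l\<bar> * ?J = (\<bar>b + l\<bar> + \<bar>b - l\<bar> - \<bar>a + l\<bar> - \<bar>a - l\<bar>) * ?J"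
      by (simp add: algebra_simps)
    then show ?thesis using J by simp
  qed
  ultimately show ?thesis by simp
qed

lemma integrable_trapezoid_kernel: "a < b \<Longrightarrow> integrable lborel (trapezoid_kernel a b)"
  using has_bochner_integral_trapezoid_kernel_cos[of a b 0] by (simp add: has_bochner_integral_iff)

lemma has_bochner_integral_trapezoid_kernel_cis:
  assumes "a < b"
  shows "has_bochner_integral lborel (\<lambda>t. of_real (trapezoid_kernel a b t) * cis (- t * l))
    (of_real ((\<bar>b + l\<bar> + \<bar>b - l\<bar> - \<bar>a + l\<bar> - \<bar>a - l\<bar>) / (2 * (b - a))))"
proof -
  \<comment> \<open>The kernel is even, so the imaginary part of the integral vanishes.\<close>
  let ?g = "\<lambda>t. trapezoid_kernel a b t * sin (l * t)"
  have int: "integrable lborel ?g"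
    by (rule Bochner_Integration.integrable_bound[OF integrable_trapezoid_kernel[OF assms]])
       (auto simp: abs_mult intro!: mult_left_le AE_I2)
  have "integral\<^sup>L lborel ?g = (\<integral>t. ?g (0 + (-1) * t) \<partial>lborel)"
    using lborel_integral_real_affine[of "-1" ?g 0] by simp
  also have "\<dots> = - integral\<^sup>L lborel ?g"
    by (simp add: trapezoid_kernel_def)
  finally have g: "has_bochner_integral lborel ?g 0"
    using int by (simp add: has_bochner_integral_iff)
  have c: "has_bochner_integral lborel (\<lambda>t. complex_of_real (trapezoid_kernel a b t * cos (l * t)))
      (of_real ((\<bar>b + l\<bar> + \<bar>b - l\<bar> - \<bar>a + l\<bar> - \<bar>a - l\<bar>) / (2 * (b - a))))"
    by (rule has_bochner_integral_bounded_linear[OF bounded_linear_of_real has_bochner_integral_trapezoid_kernel_cos[OF assms]])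
  have s: "has_bochner_integral lborel (\<lambda>t. \<i> * complex_of_real (?g t)) (\<i> * of_real 0)"
    by (rule has_bochner_integral_mult_right[OF has_bochner_integral_bounded_linear[OF bounded_linear_of_real g]])
  have eq: "of_real (trapezoid_kernel a b t * cos (l * t)) - \<i> * of_real (?g t)
      = of_real (trapezoid_kernel a b t) * cis (- t * l)" for t
    by (simp add: complex_eq_iff mult.commute)
  show ?thesis
    using has_bochner_integral_diff[OF c s] unfolding eq by simp
qed

text \<open>
  Near 0 the difference of cosines is of order \<open>(b\<^sup>2 - a\<^sup>2) t\<^sup>2\<close>. Away from 0 it is at most \<open>2 min(1, s)\<close>
  with \<open>s = (b - a) \<bar>t\<bar>\<close>, and bounding the minimum by \<open>s\<^sup>1\<^sup>-\<^sup>\<delta>\<close> costs only the factor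
  \<open>(b - a)\<^sup>-\<^sup>\<delta>\<close> in the norm, whereas \<open>s\<close> itself would leave a divergent integral.
\<close>

lemma abs_trapezoid_kernel_le:
  assumes ab: "0 \<le> a" "a < b" and \<delta>: "0 < \<delta>" "\<delta> < 1"
  shows "\<bar>trapezoid_kernel a b t\<bar> \<le> (b + 2 * (b - a) powr (- \<delta>)) / cosine_mass * cut_power \<delta> t"
proof -
  let ?J = cosine_mass
  have J: "?J > 0" by (rule cosine_mass_pos)
  have eq: "\<bar>trapezoid_kernel a b t\<bar> = \<bar>cos (a * t) - cos (b * t)\<bar> / t\<^sup>2 / (b - a) / ?J"
    using ab J by (simp add: trapezoid_kernel_def abs_mult)
  show ?thesis
  proof (cases "\<bar>t\<bar> \<le> 1")
    case True
    have "\<bar>cos (a * t) - cos (b * t)\<bar> / t\<^sup>2 \<le> (b - a) * ((a + b) / 2)"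
      using abs_cos_diff_le(1)[of a t b] ab by (cases "t = 0") (auto simp: divide_simps)
    then have "\<bar>cos (a * t) - cos (b * t)\<bar> / t\<^sup>2 / (b - a) \<le> (b - a) * ((a + b) / 2) / (b - a)"
      using ab by (intro divide_right_mono) auto
    also have "\<dots> = (a + b) / 2" by (rule nonzero_mult_div_cancel_left) (use ab in simp)
    also have "\<dots> \<le> b + 2 * (b - a) powr (- \<delta>)"
      using ab by (intro add_increasing2) auto
    finally have le: "\<bar>cos (a * t) - cos (b * t)\<bar> / t\<^sup>2 / (b - a) \<le> b + 2 * (b - a) powr (- \<delta>)" .
    show ?thesis
      using divide_right_mono[OF le less_imp_le[OF J]] True unfolding eq by (simp add: cut_power_def)
  next
    case False
    let ?s = "(b - a) * \<bar>t\<bar>"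
    have s: "?s > 0" using False ab by auto
    have "\<bar>cos (a * t) - cos (b * t)\<bar> \<le> 2"
      using cos_le_one[of "a * t"] cos_ge_minus_one[of "a * t"] cos_le_one[of "b * t"] cos_ge_minus_one[of "b * t"] by linarith
    moreover have "\<bar>cos (a * t) - cos (b * t)\<bar> \<le> ?s"
      using abs_cos_diff_le(2)[of a t b] ab by simp
    ultimately have "\<bar>cos (a * t) - cos (b * t)\<bar> \<le> 2 * min 1 ?s" using s by auto
    also have "min 1 ?s \<le> ?s powr (1 - \<delta>)"
    proof (cases "?s \<le> 1")
      case True
      have "?s powr 1 \<le> ?s powr (1 - \<delta>)" using s True \<delta> by (intro powr_mono') auto
      then show ?thesis using s True by (simp add: powr_one)
    next
      case False
      then have "1 \<le> ?s powr (1 - \<delta>)" using \<delta> by (intro ge_one_powr_ge_zero) auto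
      then show ?thesis using False by simp
    qed
    also have "?s powr (1 - \<delta>) = (b - a) * (b - a) powr (- \<delta>) * (t\<^sup>2 * \<bar>t\<bar> powr (- 1 - \<delta>))"
    proof -
      have sq: "t\<^sup>2 = \<bar>t\<bar> powr 2" using False by (simp add: powr_numeral)
      have "t\<^sup>2 * \<bar>t\<bar> powr (- 1 - \<delta>) = \<bar>t\<bar> powr (2 + (- 1 - \<delta>))"
        by (simp only: sq powr_add)
      also have "2 + (- 1 - \<delta>) = 1 - \<delta>" by simp
      finally have 1: "t\<^sup>2 * \<bar>t\<bar> powr (- 1 - \<delta>) = \<bar>t\<bar> powr (1 - \<delta>)" .
      have 2: "(b - a) * (b - a) powr (- \<delta>) = (b - a) powr (1 - \<delta>)"
        using ab powr_add[of "b - a" 1 "- \<delta>"] by (simp add: powr_one)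
      show ?thesis unfolding 1 2 using ab by (simp add: powr_mult)
    qed
    finally have "\<bar>cos (a * t) - cos (b * t)\<bar> / t\<^sup>2 / (b - a) \<le> 2 * (b - a) powr (- \<delta>) * \<bar>t\<bar> powr (- 1 - \<delta>)"
      using False ab by (simp add: pos_divide_le_eq mult_ac)
    also have "\<dots> \<le> (b + 2 * (b - a) powr (- \<delta>)) * \<bar>t\<bar> powr (- 1 - \<delta>)"
      using ab by (intro mult_right_mono) auto
    finally have le: "\<bar>cos (a * t) - cos (b * t)\<bar> / t\<^sup>2 / (b - a)
        \<le> (b + 2 * (b - a) powr (- \<delta>)) * \<bar>t\<bar> powr (- 1 - \<delta>)" .
    show ?thesis
      using divide_right_mono[OF le less_imp_le[OF J]] False unfolding eq by (simp add: cut_power_def)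
  qed
qed

text \<open>
  The trapezoid with \<open>a = ln N\<close> and \<open>b = ln (N + 1)\<close> separates the frequencies \<open>ln n\<close> with \<open>n \<le> N\<close> from
  the others. Since \<open>b - a\<close> is of order \<open>1/N\<close>, its norm is of order \<open>N\<^sup>\<delta>\<close> at most.
\<close>

lemma summation_kernel_exists:
  assumes \<delta>: "0 < \<delta>" "\<delta> < 1"
  shows "\<exists>C\<ge>0. \<forall>N\<ge>1. \<exists>K. integrable lborel K \<and> (\<integral>t. \<bar>K t\<bar> \<partial>lborel) \<le> C * real N powr \<delta> \<and>
    (\<forall>n\<ge>1. has_bochner_integral lborel (\<lambda>t. complex_of_real (K t) * cis (- t * ln (real n))) (of_bool (n \<le> N)))"
proof -
  define C where "C = (2 / \<delta> + 4) / cosine_mass * integral\<^sup>L lborel (cut_power \<delta>)"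
  have J: "cosine_mass > 0" by (rule cosine_mass_pos)
  have w: "integral\<^sup>L lborel (cut_power \<delta>) \<ge> 0" by (rule Bochner_Integration.integral_nonneg) (simp add: cut_power_nonneg)
  have "C \<ge> 0" using J w \<delta> by (simp add: C_def)
  moreover have "\<exists>K. integrable lborel K \<and> (\<integral>t. \<bar>K t\<bar> \<partial>lborel) \<le> C * real N powr \<delta> \<and>
    (\<forall>n\<ge>1. has_bochner_integral lborel (\<lambda>t. complex_of_real (K t) * cis (- t * ln (real n))) (of_bool (n \<le> N)))"
    if N: "N \<ge> 1" for N :: nat
  proof -
    define a where "a = ln (real N)"
    define b where "b = ln (real (Suc N))"
    have a0: "0 \<le> a" using N by (simp add: a_def)
    have ab: "a < b" using N by (simp add: a_def b_def)
    have Np: "real N powr \<delta> > 0" using N by simp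
    have two: "2 powr \<delta> \<le> (2::real)" using \<delta> powr_mono[of \<delta> 1 2] by simp
    have twoN: "(2 * real N) powr \<delta> \<le> 2 * real N powr \<delta>"
      using two Np by (simp add: powr_mult)
    have "ln (real (Suc N)) \<le> real (Suc N) powr \<delta> / \<delta>"
      using ln_powr_bound[of "real (Suc N)" \<delta>] \<delta> by simp
    also have "real (Suc N) powr \<delta> \<le> (2 * real N) powr \<delta>"
      using N \<delta> by (intro powr_mono2) auto
    finally have b: "b \<le> 2 / \<delta> * real N powr \<delta>"
      using twoN \<delta> unfolding b_def by (simp add: divide_simps mult_ac split: if_splits)
    \<comment> \<open>From \<open>ln (N / (N + 1)) \<le> - 1 / (N + 1)\<close>.\<close>
    have "1 / (2 * real N) \<le> b - a"
    proof -
      have "ln (real N / real (Suc N)) \<le> real N / real (Suc N) - 1"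
        using N by (intro ln_le_minus_one) auto
      then have "1 / real (Suc N) \<le> b - a"
        using N unfolding a_def b_def by (simp add: ln_div field_simps)
      moreover have "1 / (2 * real N) \<le> 1 / real (Suc N)" using N by (intro divide_left_mono) auto
      ultimately show ?thesis by linarith
    qed
    then have "(b - a) powr (- \<delta>) \<le> (1 / (2 * real N)) powr (- \<delta>)"
      using N \<delta> by (intro powr_mono2') auto
    also have "\<dots> = (2 * real N) powr \<delta>"
      using N by (simp add: powr_minus powr_divide)
    finally have "(b - a) powr (- \<delta>) \<le> 2 * real N powr \<delta>" using twoN by linarith
    then have bnd: "b + 2 * (b - a) powr (- \<delta>) \<le> (2 / \<delta> + 4) * real N powr \<delta>"
      using b by (simp add: algebra_simps)
    have "(\<integral>t. \<bar>trapezoid_kernel a b t\<bar> \<partial>lborel)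
        \<le> (\<integral>t. (b + 2 * (b - a) powr (- \<delta>)) / cosine_mass * cut_power \<delta> t \<partial>lborel)"
      by (intro integral_mono abs_trapezoid_kernel_le a0 ab \<delta> integrable_mult_right integrable_cut_power
          integrable_abs integrable_trapezoid_kernel)
    also have "\<dots> = (b + 2 * (b - a) powr (- \<delta>)) * (integral\<^sup>L lborel (cut_power \<delta>) / cosine_mass)" by simp
    also have "\<dots> \<le> (2 / \<delta> + 4) * real N powr \<delta> * (integral\<^sup>L lborel (cut_power \<delta>) / cosine_mass)"
      using bnd w J by (intro mult_right_mono) auto
    also have "\<dots> = C * real N powr \<delta>" by (simp add: C_def)
    finally have "(\<integral>t. \<bar>trapezoid_kernel a b t\<bar> \<partial>lborel) \<le> C * real N powr \<delta>" .
    moreover have "has_bochner_integral lborel (\<lambda>t. complex_of_real (trapezoid_kernel a b t) * cis (- t * ln (real n))) (of_bool (n \<le> N))"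
      if n: "n \<ge> 1" for n
    proof -
      let ?l = "ln (real n)"
      have l0: "?l \<ge> 0" using n by simp
      have v: "(\<bar>b + ?l\<bar> + \<bar>b - ?l\<bar> - \<bar>a + ?l\<bar> - \<bar>a - ?l\<bar>) / (2 * (b - a)) = of_bool (n \<le> N)"
      proof (cases "n \<le> N")
        case True
        then have "?l \<le> a" using n by (simp add: a_def)
        then have "\<bar>b + ?l\<bar> + \<bar>b - ?l\<bar> - \<bar>a + ?l\<bar> - \<bar>a - ?l\<bar> = 2 * (b - a)" using l0 a0 ab by simp
        then show ?thesis using True ab by simp
      next
        case False
        then have "b \<le> ?l" using n by (simp add: b_def)
        then have "\<bar>b + ?l\<bar> + \<bar>b - ?l\<bar> - \<bar>a + ?l\<bar> - \<bar>a - ?l\<bar> = 0" using l0 a0 ab by simp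
        then show ?thesis using False by simp
      qed
      show ?thesis
        using has_bochner_integral_trapezoid_kernel_cis[OF ab, of ?l] unfolding v by (cases "n \<le> N") simp_all
    qed
    ultimately show ?thesis using integrable_trapezoid_kernel[OF ab] by blast
  qed
  ultimately show ?thesis by blast
qed


section \<open>Partial sums of Dirichlet series\<close>

text \<open>
  Integrating the polynomial along the line against the summation kernel deletes exactly the terms with
  \<open>n > N\<close>, and the norm of the result is at most \<open>M\<close> times the norm of the kernel.
\<close>

lemma norm_partial_sum_le_of_bounded_dirichlet_polynomial:
  assumes \<delta>: "0 < \<delta>" "\<delta> < 1"
  shows "\<exists>C\<ge>0. \<forall>(c :: nat \<Rightarrow> 'x::complex_banach) I M N t. finite I \<longrightarrow> 0 \<notin> I \<longrightarrow> 1 \<le> N \<longrightarrow>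
      (\<forall>t. norm (\<Sum>n\<in>I. unit_power t n *\<^sub>C c n) \<le> M) \<longrightarrow>
      norm (\<Sum>n\<in>{n\<in>I. n \<le> N}. unit_power t n *\<^sub>C c n) \<le> C * real N powr \<delta> * M"
proof -
  obtain C where C: "C \<ge> 0" and K: "\<And>N. N \<ge> 1 \<Longrightarrow> \<exists>K. integrable lborel K \<and> (\<integral>t. \<bar>K t\<bar> \<partial>lborel) \<le> C * real N powr \<delta> \<and>
    (\<forall>n\<ge>1. has_bochner_integral lborel (\<lambda>t. complex_of_real (K t) * cis (- t * ln (real n))) (of_bool (n \<le> N)))"
    using summation_kernel_exists[OF \<delta>] by blast
  show ?thesis
  proof (intro exI[of _ C] conjI C allI impI)
    fix c :: "nat \<Rightarrow> 'x" and I M N s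
    assume I: "finite I" "0 \<notin> I" and N: "1 \<le> (N::nat)"
      and "\<forall>t. norm (\<Sum>n\<in>I. unit_power t n *\<^sub>C c n) \<le> M"
    then have M: "\<And>t. norm (\<Sum>n\<in>I. unit_power t n *\<^sub>C c n) \<le> M" by blast
    obtain K where K: "integrable lborel K" "(\<integral>t. \<bar>K t\<bar> \<partial>lborel) \<le> C * real N powr \<delta>"
      "\<And>n. n \<ge> 1 \<Longrightarrow> has_bochner_integral lborel (\<lambda>t. complex_of_real (K t) * cis (- t * ln (real n))) (of_bool (n \<le> N))"
      using K[OF N] by blast
    have M0: "M \<ge> 0" using M[of 0] norm_ge_zero order_trans by blast
    define g where "g n t = complex_of_real (K t) * cis (- t * ln (real n))" for n t
    define e where "e n = unit_power s n *\<^sub>C c n" for n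
    have g: "integrable lborel (g n)" "integral\<^sup>L lborel (g n) = of_bool (n \<le> N)" if "n \<in> I" for n
    proof -
      have "n \<ge> 1" using that I(2) by (cases n) auto
      then have "has_bochner_integral lborel (g n) (of_bool (n \<le> N))"
        unfolding g_def by (rule K(3))
      then show "integrable lborel (g n)" "integral\<^sup>L lborel (g n) = of_bool (n \<le> N)"
        unfolding has_bochner_integral_iff by auto
    qed
    have "norm (\<Sum>n\<in>I. integral\<^sup>L lborel (g n) *\<^sub>C e n) \<le> (\<integral>t. \<bar>K t\<bar> * M \<partial>lborel)"
    proof (rule norm_sum_integral_scaleC_le[OF g(1)])
      show "integrable lborel (\<lambda>t. \<bar>K t\<bar> * M)"
        by (intro integrable_mult_left integrable_abs K(1))
      show "AE t in lborel. norm (\<Sum>n\<in>I. g n t *\<^sub>C e n) \<le> \<bar>K t\<bar> * M"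
      proof (rule AE_I2)
        fix t
        have "g n t *\<^sub>C e n = of_real (K t) *\<^sub>C (cis (- (t + s) * ln (real n)) *\<^sub>C c n)" for n
        proof -
          have "cis (- t * ln (real n)) * cis (- s * ln (real n)) = cis (- (t + s) * ln (real n))"
            by (simp add: cis_mult algebra_simps)
          then show ?thesis by (simp only: g_def e_def scaleC_scaleC mult.assoc)
        qed
        then have "(\<Sum>n\<in>I. g n t *\<^sub>C e n) = of_real (K t) *\<^sub>C (\<Sum>n\<in>I. cis (- (t + s) * ln (real n)) *\<^sub>C c n)"
          by (simp only: scaleC.sum_right)
        then show "norm (\<Sum>n\<in>I. g n t *\<^sub>C e n) \<le> \<bar>K t\<bar> * M"
          using M[of "t + s"] by (simp only: norm_scaleC norm_of_real) (simp add: mult_left_mono)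
      qed
    qed
    also have "\<dots> = (\<integral>t. \<bar>K t\<bar> \<partial>lborel) * M" by simp
    also have "\<dots> \<le> C * real N powr \<delta> * M" by (rule mult_right_mono[OF K(2) M0])
    also have "(\<Sum>n\<in>I. integral\<^sup>L lborel (g n) *\<^sub>C e n) = (\<Sum>n\<in>{n\<in>I. n \<le> N}. e n)"
      unfolding sum.inter_filter[OF I(1)] by (rule sum.cong) (auto simp: g scaleC.zero_left)
    finally show "norm (\<Sum>n\<in>{n\<in>I. n \<le> N}. unit_power s n *\<^sub>C c n) \<le> C * real N powr \<delta> * M"
      unfolding e_def .
  qed
qed

text \<open>
  Mean value inequality for \<open>x\<^sup>-\<^sup>w\<close> on the interval from \<open>n\<close> to \<open>n + 1\<close>.
\<close>

lemma norm_nat_powr_diff_le: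
  assumes "n \<ge> 1" "Re w \<ge> 0"
  shows "cmod (of_nat n powr (- w) - of_nat (Suc n) powr (- w)) \<le> cmod w * real n powr (- Re w - 1)"
proof -
  let ?S = "closed_segment (complex_of_nat n) (of_nat (Suc n))"
  have S: "\<exists>x. z = of_real x \<and> real n \<le> x" if z: "z \<in> ?S" for z
  proof -
    obtain u where u: "z = (1 - u) *\<^sub>R complex_of_nat n + u *\<^sub>R of_nat (Suc n)" "0 \<le> u"
      using z by (auto simp: closed_segment_def)
    have "z = of_real (real n + u)"
      unfolding u by (simp add: scaleR_conv_of_real algebra_simps)
    then show ?thesis using u(2) by (intro exI[of _ "real n + u"]) simp
  qed
  have "cmod (of_nat n powr (- w) - of_nat (Suc n) powr (- w))
      \<le> cmod w * real n powr (- Re w - 1) * cmod (of_nat n - of_nat (Suc n))"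
  proof (rule field_differentiable_bound[where f' = "\<lambda>z. - w * z powr (- w - 1)" and S = ?S])
    fix z assume "z \<in> ?S"
    then obtain x where x: "z = of_real x" "real n \<le> x" using S by blast
    have xp: "x > 0" using x(2) assms(1) by simp
    then have "z \<notin> \<real>\<^sub>\<le>\<^sub>0" unfolding x(1) by (simp add: complex_nonpos_Reals_iff)
    from has_field_derivative_powr[OF this]
    show "((\<lambda>z. z powr - w) has_field_derivative - w * z powr (- w - 1)) (at z within ?S)"
      by (rule has_field_derivative_at_within)
    have "cmod (z powr (- w - 1)) = x powr (- Re w - 1)"
      unfolding x(1) using xp by (subst norm_powr_real_powr) auto
    also have "\<dots> \<le> real n powr (- Re w - 1)"
      using x(2) assms by (intro powr_mono2') auto
    finally show "cmod (- w * z powr (- w - 1)) \<le> cmod w * real n powr (- Re w - 1)"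
      by (simp add: norm_mult mult_left_mono)
  qed auto
  then show ?thesis by (simp add: norm_minus_commute)
qed

lemma norm_nat_powr: "n \<ge> 1 \<Longrightarrow> cmod (of_nat n powr w) = real n powr Re w"
  using norm_powr_real_powr[of "of_nat n" w] by simp

lemma summation_by_parts:
  fixes u :: "nat \<Rightarrow> 'x::complex_banach"
  assumes "m \<le> N"
  shows "(\<Sum>n\<in>{m<..N}. a n *\<^sub>C u n) = a N *\<^sub>C (\<Sum>n=1..N. u n) - a m *\<^sub>C (\<Sum>n=1..m. u n)
    + (\<Sum>k=m..<N. (a k - a (Suc k)) *\<^sub>C (\<Sum>n=1..k. u n))"
  using assms
proof (induction N rule: dec_induct)
  case base
  show ?case by simp
next
  case (step N)
  have "{m<..Suc N} = insert (Suc N) {m<..N}" using step by auto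
  then show ?case using step
    by (simp add: scaleC.diff_left scaleC.add_right)
qed

text \<open>
  Summation by parts. The dependence on \<open>w\<close> is kept explicit: with \<open>\<delta> = 0\<close> the bound shows that the
  partial sums of a convergent Dirichlet series grow at most linearly along vertical lines.
\<close>

lemma norm_dirichlet_segment_le:
  fixes u :: "nat \<Rightarrow> 'x::complex_banach"
  assumes U: "\<And>k. k \<ge> 1 \<Longrightarrow> norm (\<Sum>n=1..k. u n) \<le> C * real k powr \<delta>"
    and C: "C \<ge> 0" and \<delta>: "0 \<le> \<delta>" "\<delta> < Re w" and m: "1 \<le> m" "m \<le> N"
  shows "norm (\<Sum>n\<in>{m<..N}. (of_nat n powr (- w)) *\<^sub>C u n)
    \<le> 2 * C * real m powr (\<delta> - Re w) + C * cmod w * (\<Sum>k=m..<N. real k powr (\<delta> - Re w - 1))"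
proof -
  have end_le: "norm ((of_nat k powr (- w)) *\<^sub>C (\<Sum>n=1..k. u n)) \<le> C * real m powr (\<delta> - Re w)" if "k \<ge> m" for k
  proof -
    have k: "k \<ge> 1" using that m by simp
    have "norm ((of_nat k powr (- w)) *\<^sub>C (\<Sum>n=1..k. u n)) \<le> real k powr (- Re w) * (C * real k powr \<delta>)"
      unfolding norm_scaleC norm_nat_powr[OF k] using U[OF k] by (simp add: mult_left_mono)
    also have "\<dots> = C * real k powr (\<delta> - Re w)" by (simp add: powr_diff powr_minus divide_inverse)
    also have "\<dots> \<le> C * real m powr (\<delta> - Re w)"
      using that m C \<delta> by (intro mult_left_mono powr_mono2') auto
    finally show ?thesis .
  qed
  have mid: "norm ((of_nat k powr (- w) - of_nat (Suc k) powr (- w)) *\<^sub>C (\<Sum>n=1..k. u n))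
      \<le> C * cmod w * real k powr (\<delta> - Re w - 1)" if "k \<in> {m..<N}" for k
  proof -
    have k: "k \<ge> 1" using that m by simp
    have "norm ((of_nat k powr (- w) - of_nat (Suc k) powr (- w)) *\<^sub>C (\<Sum>n=1..k. u n))
        \<le> cmod w * real k powr (- Re w - 1) * (C * real k powr \<delta>)"
      unfolding norm_scaleC using norm_nat_powr_diff_le[OF k, of w] U[OF k] \<delta> by (intro mult_mono) auto
    also have "\<dots> = C * cmod w * (real k powr (- Re w - 1) * real k powr \<delta>)" by simp
    also have "real k powr (- Re w - 1) * real k powr \<delta> = real k powr (\<delta> - Re w - 1)"
      by (simp add: powr_add[symmetric] add.commute diff_diff_eq) (simp add: algebra_simps)
    finally show ?thesis .
  qed
  have "norm (\<Sum>n\<in>{m<..N}. (of_nat n powr (- w)) *\<^sub>C u n)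
      \<le> C * real m powr (\<delta> - Re w) + C * real m powr (\<delta> - Re w) + (\<Sum>k=m..<N. C * cmod w * real k powr (\<delta> - Re w - 1))"
    unfolding summation_by_parts[OF m(2), of "\<lambda>n. of_nat n powr (- w)"]
    by (intro norm_triangle_mono order_trans[OF norm_triangle_ineq4] add_mono end_le sum_norm_le mid m(2) order_refl)
  then show ?thesis by (simp add: sum_distrib_left)
qed

text \<open>
  The point is the order of the quantifiers: \<open>\<tau>\<close> serves all sequences \<open>u\<close> whose partial sums have the
  given growth.
\<close>

lemma uniform_dirichlet_tail_bound:
  assumes C: "C \<ge> 0" and \<delta>: "0 \<le> \<delta>" "\<delta> < Re w"
  shows "\<exists>\<tau> :: nat \<Rightarrow> real. \<tau> \<longlonglongrightarrow> 0 \<and>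
    (\<forall>(u :: nat \<Rightarrow> 'x::complex_banach) m N. (\<forall>k\<ge>1. norm (\<Sum>n=1..k. u n) \<le> C * real k powr \<delta>) \<longrightarrow>
      1 \<le> m \<longrightarrow> m \<le> N \<longrightarrow> norm (\<Sum>n\<in>{m<..N}. (of_nat n powr (- w)) *\<^sub>C u n) \<le> \<tau> m)"
proof -
  define f where "f k = real k powr (\<delta> - Re w - 1)" for k
  have f: "summable f" unfolding f_def by (subst summable_real_powr_iff) (use \<delta> in simp)
  define \<tau> where "\<tau> m = 2 * C * real m powr (\<delta> - Re w) + C * cmod w * (suminf f - (\<Sum>k<m. f k))" for m
  have "\<tau> \<longlonglongrightarrow> 2 * C * 0 + C * cmod w * (suminf f - suminf f)"
    unfolding \<tau>_def
    by (intro tendsto_intros summable_LIMSEQ f tendsto_neg_powr filterlim_real_sequentially) (use \<delta> in simp)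
  then have "\<tau> \<longlonglongrightarrow> 0" by simp
  moreover have "norm (\<Sum>n\<in>{m<..N}. (of_nat n powr (- w)) *\<^sub>C u n) \<le> \<tau> m"
    if U: "\<And>k. k \<ge> 1 \<Longrightarrow> norm (\<Sum>n=1..k. u n) \<le> C * real k powr \<delta>" and m: "1 \<le> m" "m \<le> N"
    for u :: "nat \<Rightarrow> 'x" and m N
  proof -
    have "(\<Sum>k=m..<N. f k) = (\<Sum>k<N. f k) - (\<Sum>k<m. f k)"
      using m(2) sum_diff_nat_ivl[of 0 m N f] by (simp add: atLeast0LessThan)
    also have "\<dots> \<le> suminf f - (\<Sum>k<m. f k)"
      using sum_le_suminf[OF f, of "{..<N}"] by (simp add: f_def)
    finally have "C * cmod w * (\<Sum>k=m..<N. f k) \<le> C * cmod w * (suminf f - (\<Sum>k<m. f k))"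
      using C by (intro mult_left_mono) auto
    then show ?thesis
      using norm_dirichlet_segment_le[OF U C \<delta> m] unfolding \<tau>_def f_def by (meson add_left_mono order_trans)
  qed
  ultimately show ?thesis by blast
qed


section \<open>From Hardy functions to Dirichlet series\<close>

lemma nat_powr_minus_of_real: "n \<ge> 1 \<Longrightarrow> of_nat n powr (- complex_of_real \<epsilon>) = of_real (real n powr (- \<epsilon>))"
  using powr_of_real[of "real n" "- \<epsilon>"] by simp

lemma nat_powr_minus_eq_cis:
  assumes "n \<ge> 1"
  shows "of_nat n powr (- s) = of_real (real n powr (- Re s)) * cis (- Im s * ln (real n))"
proof -
  have s: "- s = of_real (- Re s) + \<i> * of_real (- Im s)" by (simp add: complex_eq_iff)
  have "of_nat n powr (- s) = of_nat n powr of_real (- Re s) * of_nat n powr (\<i> * of_real (- Im s))"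
    unfolding s using assms by (simp only: powr_add)
  also have "of_nat n powr complex_of_real (- Re s) = of_real (real n powr (- Re s))"
    using nat_powr_minus_of_real[OF assms, of "Re s"] by simp
  also have "of_nat n powr (\<i> * of_real (- Im s)) = cis (- Im s * ln (real n))"
  proof -
    have "Ln (complex_of_nat n) = of_real (ln (real n))"
      using Ln_of_real[of "real n"] assms by simp
    then show ?thesis
      using assms by (simp add: powr_def cis_conv_exp mult_ac)
  qed
  finally show ?thesis .
qed

lemma dirichlet_term_eq_translate:
  assumes "n \<ge> 1"
  shows "dirichlet_term a s n = unit_power (Im s) n *\<^sub>C translate (Re s) a n"
proof -
  have "dirichlet_term a s n = (cis (- Im s * ln (real n)) * of_real (real n powr (- Re s))) *\<^sub>C a n"
    unfolding dirichlet_term_def nat_powr_minus_eq_cis[OF assms] by (simp only: mult.commute)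
  also have "\<dots> = unit_power (Im s) n *\<^sub>C ((real n powr (- Re s)) *\<^sub>R a n)"
    unfolding scaleC_scaleC[symmetric] scaleC_of_real ..
  finally show ?thesis by (simp add: translate_def powr_minus)
qed

lemma translate_translate: "translate \<epsilon> (translate \<delta> a) = translate (\<delta> + \<epsilon>) a"
  by (rule ext) (simp add: translate_def powr_add)

lemma dirichlet_term_0: "dirichlet_term a s 0 = 0"
  by (simp add: dirichlet_term_def scaleC.zero_left)

lemma sum_dirichlet_term_eq_lessThan: "(\<Sum>n=1..N. dirichlet_term a s n) = (\<Sum>n<Suc N. dirichlet_term a s n)"
proof -
  have "{..<Suc N} = insert 0 {1..N}" by auto
  then show ?thesis by (simp add: dirichlet_term_0)
qed

lemma nat_powr_scaleC_translate:
  assumes "n \<ge> 1"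
  shows "of_nat n powr (- complex_of_real \<epsilon>) *\<^sub>C z *\<^sub>C x = z *\<^sub>C (x /\<^sub>R real n powr \<epsilon>)"
proof -
  have "of_nat n powr (- complex_of_real \<epsilon>) *\<^sub>C z *\<^sub>C x = (real n powr (- \<epsilon>)) *\<^sub>R (z *\<^sub>C x)"
    unfolding nat_powr_minus_of_real[OF assms] scaleC_of_real ..
  then show ?thesis by (simp only: scaleC.scaleR_right powr_minus)
qed

text \<open>
  The box is closed under passing to smaller exponents, so a shift by exponents outside the box leaves
  it.
\<close>

lemma fejer_weight_eq_0:
  assumes "n > 0" "n \<notin> prime_power ` exponent_box m"
  shows "fejer_weight m n = 0"
proof -
  have "(\<lambda>j. \<gamma> j + prime_exponents n j) \<notin> exponent_box m" for \<gamma>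
  proof
    assume "(\<lambda>j. \<gamma> j + prime_exponents n j) \<in> exponent_box m"
    then have "prime_exponents n \<in> exponent_box m"
      by (rule exponent_box_downward_closed) simp
    then show False
      using assms prime_power_prime_exponents by (metis image_eqI)
  qed
  then show ?thesis by (simp add: fejer_weight_def)
qed

lemma sum_fejer_weight_restrict:
  fixes c :: "nat \<Rightarrow> 'x::complex_banach"
  shows "(\<Sum>n=1..N. z n *\<^sub>C (fejer_weight m n *\<^sub>R c n))
    = (\<Sum>n\<in>{n\<in>prime_power ` exponent_box m. n \<le> N}. z n *\<^sub>C (fejer_weight m n *\<^sub>R c n))"
proof (rule sum.mono_neutral_right)
  show "{n \<in> prime_power ` exponent_box m. n \<le> N} \<subseteq> {1..N}"
    using prime_power_pos by (auto simp: Suc_le_eq)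
  show "\<forall>n\<in>{1..N} - {n \<in> prime_power ` exponent_box m. n \<le> N}. z n *\<^sub>C (fejer_weight m n *\<^sub>R c n) = 0"
  proof
    fix n assume "n \<in> {1..N} - {n \<in> prime_power ` exponent_box m. n \<le> N}"
    then have "fejer_weight m n = 0" by (intro fejer_weight_eq_0) auto
    then show "z n *\<^sub>C (fejer_weight m n *\<^sub>R c n) = 0" by (simp add: scaleC.zero_right)
  qed
qed simp

lemma summable_if_segments_small:
  fixes g :: "nat \<Rightarrow> 'x::banach"
  assumes \<tau>: "\<tau> \<longlonglongrightarrow> (0::real)"
    and le: "\<And>m N. 1 \<le> m \<Longrightarrow> m \<le> N \<Longrightarrow> norm (\<Sum>n\<in>{m<..N}. g n) \<le> \<tau> m"
  shows "summable g"
  unfolding summable_Cauchy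
proof (intro allI impI)
  fix e :: real assume e: "e > 0"
  obtain m0 where m0: "\<And>m. m \<ge> m0 \<Longrightarrow> \<tau> m < e"
    using order_tendstoD(2)[OF \<tau> e] by (auto simp: eventually_sequentially)
  have "norm (sum g {m..<n}) < e" if "m \<ge> m0 + 2" for m n
  proof (cases "m < n")
    case True
    then have "{m..<n} = {m - 1<..n - 1}" using that by auto
    then have "norm (sum g {m..<n}) \<le> \<tau> (m - 1)" using le[of "m - 1" "n - 1"] that True by simp
    also have "\<dots> < e" using m0[of "m - 1"] that by simp
    finally show ?thesis .
  next
    case False
    then show ?thesis using e by simp
  qed
  then show "\<exists>N. \<forall>m\<ge>N. \<forall>n. norm (sum g {m..<n}) < e" by blast
qed

text \<open>
  Half of the real part \<open>2\<epsilon>\<close> is spent on the function \<open>f\<close> for \<open>D\<^sub>\<epsilon>\<close>, whose Fejer means have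
  partial sums of small growth. The other half turns this growth into tails \<open>\<tau>\<close> that are uniform in the
  order \<open>m\<close> of the mean. The function \<open>g\<close> for \<open>D\<^sub>2\<^sub>\<epsilon>\<close> bounds the full means by \<open>M\<close>, hence their partial
  sums up to \<open>N\<close> by \<open>M + \<tau> N\<close>, and this passes to the limits \<open>m \<rightarrow> \<infinity>\<close> and \<open>N \<rightarrow> \<infinity>\<close>.
\<close>

lemma dirichlet_series_converges_of_Hardy:
  fixes a :: "nat \<Rightarrow> 'x::complex_banach"
  assumes \<epsilon>: "\<epsilon> > 0"
    and f: "represents f (translate \<epsilon> a)" "Linf_norm f = ereal A"
    and g: "represents g (translate (2 * \<epsilon>) a)" "Linf_norm g = ereal M"
    and s: "Re s = 2 * \<epsilon>"
  shows "summable (dirichlet_term a s)" "norm (\<Sum>n. dirichlet_term a s n) \<le> M"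
proof -
  \<comment> \<open>The growth exponent has to stay below the shift \<open>\<epsilon>\<close> of the line.\<close>
  define \<delta> where "\<delta> = min (\<epsilon> / 2) (1 / 2)"
  have \<delta>: "0 < \<delta>" "\<delta> < 1" "\<delta> < \<epsilon>" using \<epsilon> by (auto simp: \<delta>_def min_def)
  let ?I = "\<lambda>m. prime_power ` exponent_box m"
  let ?c = "\<lambda>n. cis (- Im s * ln (real n))"
  have I: "finite (?I m)" "0 \<notin> ?I m" for m
    using finite_exponent_box prime_power_pos by (auto simp: image_iff)
  obtain C where C: "C \<ge> 0" and bohr: "\<forall>(c :: nat \<Rightarrow> 'x) I M N t. finite I \<longrightarrow> 0 \<notin> I \<longrightarrow> 1 \<le> N \<longrightarrow>
      (\<forall>t. norm (\<Sum>n\<in>I. unit_power t n *\<^sub>C c n) \<le> M) \<longrightarrow>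
      norm (\<Sum>n\<in>{n\<in>I. n \<le> N}. unit_power t n *\<^sub>C c n) \<le> C * real N powr \<delta> * M"
    using norm_partial_sum_le_of_bounded_dirichlet_polynomial[OF \<delta>(1,2), where ?'x = 'x] by blast
  have A0: "A \<ge> 0"
    using order_trans[OF norm_ge_zero norm_fejer_dirichlet_polynomial_le[OF f, of 0 0]] .
  define u where "u m n = ?c n *\<^sub>C (fejer_weight m n *\<^sub>R translate \<epsilon> a n)" for m n
  have u: "norm (\<Sum>n=1..k. u m n) \<le> C * A * real k powr \<delta>" if "k \<ge> 1" for m k
    using bohr[rule_format, OF I that norm_fejer_dirichlet_polynomial_le[OF f], of "Im s"]
    unfolding u_def sum_fejer_weight_restrict by (simp add: mult_ac)
  have w: "0 \<le> \<delta>" "\<delta> < Re (complex_of_real \<epsilon>)" "C * A \<ge> 0" using \<delta> C A0 by auto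
  obtain \<tau> where \<tau>: "\<tau> \<longlonglongrightarrow> 0"
    and tail: "\<forall>(u :: nat \<Rightarrow> 'x) m N. (\<forall>k\<ge>1. norm (\<Sum>n=1..k. u n) \<le> C * A * real k powr \<delta>) \<longrightarrow>
      1 \<le> m \<longrightarrow> m \<le> N \<longrightarrow> norm (\<Sum>n\<in>{m<..N}. (of_nat n powr (- complex_of_real \<epsilon>)) *\<^sub>C u n) \<le> \<tau> m"
    using uniform_dirichlet_tail_bound[OF w(3) w(1,2), where ?'x = 'x] by blast
  define v where "v m n = ?c n *\<^sub>C (fejer_weight m n *\<^sub>R translate (2 * \<epsilon>) a n)" for m n
  have uv: "of_nat n powr (- complex_of_real \<epsilon>) *\<^sub>C u m n = v m n" if "n \<ge> 1" for m n
  proof -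
    have "translate (2 * \<epsilon>) a n = translate \<epsilon> a n /\<^sub>R real n powr \<epsilon>"
      unfolding mult_2 translate_translate[symmetric] by (rule translate_def)
    then show ?thesis
      unfolding u_def v_def nat_powr_scaleC_translate[OF that] by (metis scaleR_left_commute)
  qed
  have v_tail: "norm (\<Sum>n\<in>{N<..L}. v m n) \<le> \<tau> N" if N: "1 \<le> N" "N \<le> L" for m N L
  proof -
    have "(\<Sum>n\<in>{N<..L}. v m n) = (\<Sum>n\<in>{N<..L}. (of_nat n powr (- complex_of_real \<epsilon>)) *\<^sub>C u m n)"
      using N by (intro sum.cong) (auto simp: uv)
    then show ?thesis using tail[rule_format, OF u N] by simp
  qed
  have v_partial: "norm (\<Sum>n=1..N. v m n) \<le> M + \<tau> N" if N: "N \<ge> 1" for m N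
  proof -
    obtain L where L: "?I m \<subseteq> {..<L}" using finite_nat_bounded[OF I(1)] by blast
    \<comment> \<open>All indices of the polynomial lie below \<open>L'\<close>.\<close>
    define L' where "L' = max N L"
    have "{n\<in>?I m. n \<le> L'} = ?I m" using L by (auto simp: L'_def)
    then have "(\<Sum>n=1..L'. v m n) = (\<Sum>n\<in>?I m. v m n)"
      unfolding v_def sum_fejer_weight_restrict by simp
    then have full: "norm (\<Sum>n=1..L'. v m n) \<le> M"
      using norm_fejer_dirichlet_polynomial_le[OF g, of "Im s" m] by (simp add: v_def)
    have "{1..L'} = {1..N} \<union> {N<..L'}" using N by (auto simp: L'_def)
    then have "(\<Sum>n=1..L'. v m n) = (\<Sum>n=1..N. v m n) + (\<Sum>n\<in>{N<..L'}. v m n)"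
      by (simp add: sum.union_disjoint ivl_disj_int)
    then have "(\<Sum>n=1..N. v m n) = (\<Sum>n=1..L'. v m n) - (\<Sum>n\<in>{N<..L'}. v m n)" by simp
    then show ?thesis
      using full v_tail[OF N, of L' m] norm_triangle_ineq4 by (smt (verit) L'_def max.cobounded1)
  qed
  have lim: "(\<lambda>m. v m n) \<longlonglongrightarrow> dirichlet_term a s n" if n: "n \<ge> 1" for n
  proof -
    have "(\<lambda>m. ?c n *\<^sub>C (fejer_weight m n *\<^sub>R translate (2 * \<epsilon>) a n)) \<longlonglongrightarrow> ?c n *\<^sub>C (1 *\<^sub>R translate (2 * \<epsilon>) a n)"
      using n by (intro scaleC.tendsto tendsto_const tendsto_scaleR fejer_weight_tendsto_1) simp
    then show ?thesis unfolding v_def dirichlet_term_eq_translate[OF n] s by simp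
  qed
  have seg: "norm (\<Sum>n\<in>{m<..N}. dirichlet_term a s n) \<le> \<tau> m" if "1 \<le> m" "m \<le> N" for m N
  proof (rule LIMSEQ_le_const2)
    show "(\<lambda>k. norm (\<Sum>n\<in>{m<..N}. v k n)) \<longlonglongrightarrow> norm (\<Sum>n\<in>{m<..N}. dirichlet_term a s n)"
      by (intro tendsto_norm tendsto_sum lim) auto
  qed (use v_tail[OF that] in auto)
  show sm: "summable (dirichlet_term a s)"
    by (rule summable_if_segments_small[OF \<tau> seg])
  have part: "norm (\<Sum>n=1..N. dirichlet_term a s n) \<le> M + \<tau> N" if "N \<ge> 1" for N
  proof (rule LIMSEQ_le_const2)
    show "(\<lambda>k. norm (\<Sum>n=1..N. v k n)) \<longlonglongrightarrow> norm (\<Sum>n=1..N. dirichlet_term a s n)"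
      by (intro tendsto_norm tendsto_sum lim) auto
  qed (use v_partial[OF that] in auto)
  have "(\<lambda>N. norm (\<Sum>n<Suc N. dirichlet_term a s n)) \<longlonglongrightarrow> norm (\<Sum>n. dirichlet_term a s n)"
    by (intro tendsto_norm LIMSEQ_Suc summable_LIMSEQ sm)
  moreover have "(\<lambda>N. M + \<tau> N) \<longlonglongrightarrow> M + 0" by (intro tendsto_add tendsto_const \<tau>)
  ultimately have "norm (\<Sum>n. dirichlet_term a s n) \<le> M + 0"
    by (rule LIMSEQ_le) (use part[unfolded sum_dirichlet_term_eq_lessThan] in blast)
  then show "norm (\<Sum>n. dirichlet_term a s n) \<le> M" by simp
qed

lemma Hinf_representative:
  assumes "b \<in> Hinf"
  obtains f C where "represents f b" "Linf_norm f = ereal C" "Hinf_norm b = ereal C" "C \<ge> 0"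
proof -
  let ?f = "SOME f. represents f b"
  have r: "represents ?f b"
    using assms someI_ex[of "\<lambda>f. represents f b"] unfolding Hinf_def by blast
  then have "?f \<in> Linf_torus" by (simp add: represents_def Hinf_torus_def)
  then obtain C where "Linf_norm ?f = ereal C" "C \<ge> 0" by (rule Linf_torusD)
  then show ?thesis using that[OF r, of C] by (simp add: Hinf_norm_def)
qed

lemma Hinf_plus_imp_Dinf:
  fixes a :: "nat \<Rightarrow> 'x::complex_banach"
  assumes a: "a \<in> Hinf_plus"
  shows "a \<in> Dinf" "Dinf_norm a \<le> Hinf_plus_norm a"
proof -
  have ds: "a \<in> dirichlet_series" and H: "\<And>\<epsilon>. \<epsilon> > 0 \<Longrightarrow> translate \<epsilon> a \<in> Hinf"
    and fin: "Hinf_plus_norm a < \<infinity>"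
    using a by (auto simp: Hinf_plus_def)
  have main: "summable (dirichlet_term a s) \<and> ereal (norm (\<Sum>n. dirichlet_term a s n)) \<le> Hinf_plus_norm a"
    if s: "Re s > 0" for s
  proof -
    define \<epsilon> where "\<epsilon> = Re s / 2"
    have \<epsilon>: "\<epsilon> > 0" "Re s = 2 * \<epsilon>" using s by (auto simp: \<epsilon>_def)
    obtain f A where f: "represents f (translate \<epsilon> a)" "Linf_norm f = ereal A"
      using Hinf_representative[OF H[OF \<epsilon>(1)]] by metis
    have "2 * \<epsilon> > 0" using \<epsilon> by simp
    then obtain g M where g: "represents g (translate (2 * \<epsilon>) a)" "Linf_norm g = ereal M"
      and M: "Hinf_norm (translate (2 * \<epsilon>) a) = ereal M"
      using Hinf_representative[OF H[of "2 * \<epsilon>"]] by metis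
    have "ereal M \<le> Hinf_plus_norm a"
      unfolding Hinf_plus_norm_def M[symmetric] using \<epsilon> by (intro SUP_upper) auto
    then show ?thesis
      using dirichlet_series_converges_of_Hardy[OF \<epsilon>(1) f g \<epsilon>(2)] by (metis ereal_less_eq(3) order_trans)
  qed
  show le: "Dinf_norm a \<le> Hinf_plus_norm a"
    unfolding Dinf_norm_def by (rule SUP_least) (use main in \<open>auto simp: right_half_plane_def\<close>)
  have "ereal 0 \<le> Hinf_plus_norm a"
    using main[of 1] norm_ge_zero by (metis ereal_less_eq(3) one_complex.sel(1) order_trans zero_less_one)
  then obtain B where B: "Hinf_plus_norm a = ereal B"
    using fin by (cases "Hinf_plus_norm a") auto
  have "bounded ((\<lambda>s. \<Sum>n. dirichlet_term a s n) ` right_half_plane)"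
    unfolding bounded_iff using main unfolding B right_half_plane_def by auto
  then show "a \<in> Dinf"
    using ds main by (auto simp: Dinf_def right_half_plane_def)
qed


section \<open>Gaussian means and uniform convergence on vertical lines\<close>

abbreviation gaussian_weight :: "real \<Rightarrow> nat \<Rightarrow> real" where
  "gaussian_weight \<sigma> n \<equiv> exp (- (\<sigma> * ln (real n))\<^sup>2 / 2)"

lemma dirichlet_term_translate:
  assumes "n \<ge> 1"
  shows "dirichlet_term (translate \<delta> a) s n = dirichlet_term a (s + of_real \<delta>) n"
  unfolding dirichlet_term_eq_translate[OF assms] translate_translate by (simp add: add.commute)

text \<open>
  Convergence at the single point \<open>\<epsilon>/2\<close> bounds the partial sums there. Summation by parts moves this to
  the line \<open>Re s = \<epsilon>\<close> at the cost of a factor of size \<open>\<bar>s\<bar>\<close>, which is integrable against a Gaussian.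
\<close>

lemma dirichlet_partial_sums_linear_growth:
  fixes a :: "nat \<Rightarrow> 'x::complex_banach"
  assumes sm: "summable (dirichlet_term a (of_real (\<epsilon> / 2)))" and \<epsilon>: "\<epsilon> > 0"
  obtains A B where "A \<ge> 0" "B \<ge> 0"
    "\<And>N y. norm (\<Sum>n=1..N. dirichlet_term a (Complex \<epsilon> y) n) \<le> A + B * \<bar>y\<bar>"
proof -
  define u where "u = translate (\<epsilon> / 2) a"
  have u: "dirichlet_term a (of_real (\<epsilon> / 2)) n = u n" if "n \<ge> 1" for n
    using dirichlet_term_eq_translate[OF that, of a "of_real (\<epsilon> / 2)"] by (simp add: u_def)
  have "Bseq (\<lambda>N. \<Sum>n<N. dirichlet_term a (of_real (\<epsilon> / 2)) n)"
    using summable_LIMSEQ[OF sm] by (rule convergentI[THEN convergent_imp_Bseq])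
  then obtain C where C: "C > 0" "\<And>N. norm (\<Sum>n<N. dirichlet_term a (of_real (\<epsilon> / 2)) n) \<le> C"
    by (auto elim: BseqE)
  have U: "norm (\<Sum>n=1..k. u n) \<le> C * real k powr 0" if "k \<ge> 1" for k
  proof -
    have "(\<Sum>n=1..k. u n) = (\<Sum>n=1..k. dirichlet_term a (of_real (\<epsilon> / 2)) n)"
      by (rule sum.cong[OF refl]) (rule u[symmetric], simp)
    also have "\<dots> = (\<Sum>n<Suc k. dirichlet_term a (of_real (\<epsilon> / 2)) n)"
      by (rule sum_dirichlet_term_eq_lessThan)
    finally show ?thesis using C(2)[of "Suc k"] that by simp
  qed
  define f where "f k = real k powr (0 - \<epsilon> / 2 - 1)" for k
  have f: "summable f" unfolding f_def by (subst summable_real_powr_iff) (use \<epsilon> in simp)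
  define Z where "Z = suminf f"
  have Z0: "Z \<ge> 0" unfolding Z_def by (rule suminf_nonneg[OF f]) (simp add: f_def)
  show ?thesis
  proof (rule that[of "3 * C + C * (\<epsilon> / 2) * Z" "C * Z"])
    show "norm (\<Sum>n=1..N. dirichlet_term a (Complex \<epsilon> y) n) \<le> 3 * C + C * (\<epsilon> / 2) * Z + C * Z * \<bar>y\<bar>" for N y
    proof (cases "N \<ge> 1")
      case False
      then have "N = 0" by simp
      then show ?thesis using C Z0 \<epsilon> by simp
    next
      case True
      let ?w = "Complex (\<epsilon> / 2) y"
      have term_eq: "dirichlet_term a (Complex \<epsilon> y) n = (of_nat n powr (- ?w)) *\<^sub>C u n" if "n \<ge> 1" for n
      proof -
        have "Complex \<epsilon> y = ?w + of_real (\<epsilon> / 2)" by (simp add: complex_eq_iff)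
        then show ?thesis
          using dirichlet_term_translate[OF that, of "\<epsilon> / 2" a ?w] by (simp add: dirichlet_term_def u_def)
      qed
      have "(\<Sum>n=1..N. dirichlet_term a (Complex \<epsilon> y) n) = (\<Sum>n=1..N. (of_nat n powr (- ?w)) *\<^sub>C u n)"
        by (rule sum.cong) (simp_all add: term_eq)
      also have "{1..N} = insert 1 {1<..N}" using True by auto
      then have "(\<Sum>n=1..N. (of_nat n powr (- ?w)) *\<^sub>C u n) = u 1 + (\<Sum>n\<in>{1<..N}. (of_nat n powr (- ?w)) *\<^sub>C u n)"
        by simp
      finally have eq: "(\<Sum>n=1..N. dirichlet_term a (Complex \<epsilon> y) n) = u 1 + (\<Sum>n\<in>{1<..N}. (of_nat n powr (- ?w)) *\<^sub>C u n)" .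
      have 1: "norm (u 1) \<le> C" using U[of 1] by simp
      have "norm (\<Sum>n\<in>{1<..N}. (of_nat n powr (- ?w)) *\<^sub>C u n)
          \<le> 2 * C * real 1 powr (0 - Re ?w) + C * cmod ?w * (\<Sum>k=1..<N. real k powr (0 - Re ?w - 1))"
        by (rule norm_dirichlet_segment_le[OF U]) (use C \<epsilon> True in auto)
      also have "(\<Sum>k=1..<N. real k powr (0 - Re ?w - 1)) \<le> Z"
        unfolding Z_def using sum_le_suminf[OF f, of "{1..<N}"] by (simp add: f_def)
      also have "cmod ?w \<le> \<epsilon> / 2 + \<bar>y\<bar>"
        using cmod_le[of ?w] \<epsilon> by simp
      finally have 2: "norm (\<Sum>n\<in>{1<..N}. (of_nat n powr (- ?w)) *\<^sub>C u n) \<le> 2 * C + C * (\<epsilon> / 2 + \<bar>y\<bar>) * Z"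
        using C Z0 by (simp add: mult_left_mono mult_right_mono)
      have "norm (u 1 + (\<Sum>n\<in>{1<..N}. (of_nat n powr (- ?w)) *\<^sub>C u n)) \<le> C + (2 * C + C * (\<epsilon> / 2 + \<bar>y\<bar>) * Z)"
        by (rule norm_triangle_mono[OF 1 2])
      then show ?thesis unfolding eq by (simp add: algebra_simps)
    qed
  qed (use C Z0 \<epsilon> in auto)
qed

lemma has_bochner_integral_cis_std_normal:
  "has_bochner_integral std_normal_distribution (\<lambda>z. cis (- (\<sigma> * z) * l)) (of_real (exp (- (\<sigma> * l)\<^sup>2 / 2)))"
proof -
  interpret real_distribution std_normal_distribution by (rule real_dist_normal_dist)
  have "integrable std_normal_distribution (\<lambda>z. cis (- (\<sigma> * z) * l))"
    by (rule integrable_const_bound[where B = 1]) (auto intro!: borel_measurable_continuous_onI continuous_intros)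
  moreover have "(\<integral>z. cis (- (\<sigma> * z) * l) \<partial>std_normal_distribution) = char std_normal_distribution (- (\<sigma> * l))"
    unfolding char_def by (rule Bochner_Integration.integral_cong) (simp_all add: cis_conv_exp mult_ac)
  ultimately show ?thesis
    by (simp add: has_bochner_integral_iff char_std_normal_distribution)
qed

text \<open>
  The weighted partial sum is the mean of the partial sums at \<open>\<epsilon> + i (t + \<sigma> z)\<close> over a standard normal
  \<open>z\<close>. By dominated convergence the mean of their norms tends to that of the norm of the limit function,
  which is at most \<open>M\<close>.
\<close>

lemma gaussian_mean_eventually_le:
  fixes a :: "nat \<Rightarrow> 'x::complex_banach"
  assumes sm: "\<And>s. Re s > 0 \<Longrightarrow> summable (dirichlet_term a s)"
    and M: "\<And>s. Re s > 0 \<Longrightarrow> norm (\<Sum>n. dirichlet_term a s n) \<le> M" and \<epsilon>: "\<epsilon> > 0"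
  shows "eventually (\<lambda>N. norm (\<Sum>n=1..N. unit_power t n *\<^sub>C
    (gaussian_weight \<sigma> n *\<^sub>R translate \<epsilon> a n)) \<le> M + 1) sequentially"
proof -
  let ?G = std_normal_distribution
  interpret real_distribution ?G by (rule real_dist_normal_dist)
  define s where "s z = Complex \<epsilon> (t + \<sigma> * z)" for z
  define h where "h N z = norm (\<Sum>n=1..N. dirichlet_term a (s z) n)" for N z
  define H where "H z = norm (\<Sum>n. dirichlet_term a (s z) n)" for z
  obtain A B where AB: "A \<ge> 0" "B \<ge> 0"
    "\<And>N y. norm (\<Sum>n=1..N. dirichlet_term a (Complex \<epsilon> y) n) \<le> A + B * \<bar>y\<bar>"
    using dirichlet_partial_sums_linear_growth[OF sm \<epsilon>] \<epsilon> by auto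
  have term_eq: "dirichlet_term a (s z) n = unit_power (\<sigma> * z) n *\<^sub>C (unit_power t n *\<^sub>C translate \<epsilon> a n)"
    if "n \<ge> 1" for n z
    unfolding dirichlet_term_eq_translate[OF that] scaleC_scaleC by (simp add: s_def cis_mult algebra_simps)
  have hm [measurable]: "h N \<in> borel_measurable ?G" for N
  proof -
    have "(\<lambda>z. norm (\<Sum>n=1..N. unit_power (\<sigma> * z) n *\<^sub>C (unit_power t n *\<^sub>C translate \<epsilon> a n))) \<in> borel_measurable ?G"
      by (intro borel_measurable_norm_strongly_measurable strongly_measurable_sum strongly_measurable_scaleC
          strongly_measurable_const) (auto intro!: borel_measurable_continuous_onI continuous_intros)
    moreover have "h N z = norm (\<Sum>n=1..N. unit_power (\<sigma> * z) n *\<^sub>C (unit_power t n *\<^sub>C translate \<epsilon> a n))" for z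
      unfolding h_def by (rule arg_cong[where f = norm], rule sum.cong) (simp_all add: term_eq)
    ultimately show ?thesis by presburger
  qed
  have lim: "(\<lambda>N. h N z) \<longlonglongrightarrow> H z" for z
    unfolding h_def H_def sum_dirichlet_term_eq_lessThan
    by (intro tendsto_norm LIMSEQ_Suc summable_LIMSEQ sm) (simp add: s_def \<epsilon>)
  have Hm [measurable]: "H \<in> borel_measurable ?G"
    by (rule borel_measurable_LIMSEQ_real[OF lim hm])
  define W where "W z = A + B * (\<bar>t\<bar> + \<bar>\<sigma>\<bar> * \<bar>z\<bar>)" for z
  have hW: "h N z \<le> W z" for N z
  proof -
    have "h N z \<le> A + B * \<bar>t + \<sigma> * z\<bar>" unfolding h_def s_def by (rule AB)
    also have "\<dots> \<le> W z"
      unfolding W_def using AB abs_triangle_ineq[of t "\<sigma> * z"] by (intro add_left_mono mult_left_mono) (auto simp: abs_mult)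
    finally show ?thesis .
  qed
  have absint: "integrable ?G (\<lambda>z. \<bar>z\<bar>)"
    using integrable_abs[OF integrable_std_normal_distribution_moment[of 1]] by simp
  have W: "integrable ?G W"
    unfolding W_def by (intro Bochner_Integration.integrable_add integrable_mult_right absint) auto
  have hN: "integrable ?G (h N)" for N
    by (rule Bochner_Integration.integrable_bound[OF W hm])
       (use hW in \<open>auto intro!: AE_I2 order_trans[OF _ abs_ge_self] simp: h_def\<close>)
  have AElim: "AE z in ?G. (\<lambda>N. h N z) \<longlonglongrightarrow> H z" by (rule AE_I2) (rule lim)
  have AEle: "AE z in ?G. norm (h N z) \<le> W z" for N
    using hW by (auto simp: h_def)
  have H: "integrable ?G H"
    by (rule integrable_dominated_convergence[where s = h, OF Hm hm W AElim AEle])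
  have conv: "(\<lambda>N. integral\<^sup>L ?G (h N)) \<longlonglongrightarrow> integral\<^sup>L ?G H"
    by (rule integral_dominated_convergence[where s = h, OF Hm hm W AElim AEle])
  have "integral\<^sup>L ?G H \<le> M"
    by (rule integral_le_const[OF H]) (auto simp: H_def s_def intro!: M \<epsilon>)
  then have "eventually (\<lambda>N. integral\<^sup>L ?G (h N) < M + 1) sequentially"
    by (intro order_tendstoD(2)[OF conv]) simp
  then show ?thesis
  proof eventually_elim
    case (elim N)
    have "norm (\<Sum>n\<in>{1..N}. (\<integral>z. cis (- (\<sigma> * z) * ln (real n)) \<partial>?G) *\<^sub>C (unit_power t n *\<^sub>C translate \<epsilon> a n))
        \<le> integral\<^sup>L ?G (h N)"
    proof (rule norm_sum_integral_scaleC_le[OF _ hN])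
      show "integrable ?G (\<lambda>z. cis (- (\<sigma> * z) * ln (real n)))" for n
        using has_bochner_integral_cis_std_normal by (rule integrable.intros)
      have "norm (\<Sum>n=1..N. unit_power (\<sigma> * z) n *\<^sub>C (unit_power t n *\<^sub>C translate \<epsilon> a n)) \<le> h N z" for z
        unfolding h_def by (rule eq_refl, rule arg_cong[where f = norm], rule sum.cong) (simp_all add: term_eq)
      then show "AE z in ?G. norm (\<Sum>n=1..N. unit_power (\<sigma> * z) n *\<^sub>C (unit_power t n *\<^sub>C translate \<epsilon> a n)) \<le> h N z"
        by simp
    qed
    moreover have "(\<integral>z. cis (- (\<sigma> * z) * ln (real n)) \<partial>?G) *\<^sub>C (unit_power t n *\<^sub>C translate \<epsilon> a n)
        = unit_power t n *\<^sub>C (gaussian_weight \<sigma> n *\<^sub>R translate \<epsilon> a n)" for n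
      unfolding has_bochner_integral_integral_eq[OF has_bochner_integral_cis_std_normal] scaleC_of_real
      by (simp only: scaleC.scaleR_right)
    ultimately show ?case using elim by simp
  qed
qed

lemma summable_gaussian_weight:
  assumes "\<sigma> \<noteq> 0"
  shows "summable (\<lambda>n. gaussian_weight \<sigma> n)"
proof (rule summable_comparison_test_ev)
  show "summable (\<lambda>n. real n powr (-2))" by (subst summable_real_powr_iff) simp
  have s2: "\<sigma>\<^sup>2 > 0" using assms by simp
  have "filterlim (\<lambda>n. ln (real n)) at_top sequentially"
    by (rule filterlim_compose[OF ln_at_top filterlim_real_sequentially])
  then have "eventually (\<lambda>n. ln (real n) \<ge> 4 / \<sigma>\<^sup>2) sequentially"
    unfolding filterlim_at_top by blast
  moreover have "eventually (\<lambda>n. n \<ge> (1::nat)) sequentially" by (rule eventually_ge_at_top)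
  ultimately show "eventually (\<lambda>n. norm (gaussian_weight \<sigma> n) \<le> real n powr (-2)) sequentially"
  proof eventually_elim
    case (elim n)
    have "4 \<le> \<sigma>\<^sup>2 * ln (real n)" using elim(1) s2 by (simp add: pos_divide_le_eq mult.commute)
    then have "4 * ln (real n) \<le> \<sigma>\<^sup>2 * ln (real n) * ln (real n)"
      using elim(2) by (intro mult_right_mono) auto
    then have "- (\<sigma> * ln (real n))\<^sup>2 / 2 \<le> - 2 * ln (real n)"
      by (simp add: power2_eq_square mult_ac)
    then show ?case using elim(2) by (simp add: powr_def)
  qed
qed

text \<open>
  The preceding bound holds from an index on that depends on \<open>t\<close>. The Gaussian weights make the series
  absolutely convergent, so the tails are small uniformly in \<open>t\<close> and one index serves all \<open>t\<close>.
\<close>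

lemma gaussian_mean_uniformly_le:
  fixes a :: "nat \<Rightarrow> 'x::complex_banach"
  assumes sm: "\<And>s. Re s > 0 \<Longrightarrow> summable (dirichlet_term a s)"
    and M: "\<And>s. Re s > 0 \<Longrightarrow> norm (\<Sum>n. dirichlet_term a s n) \<le> M" and \<epsilon>: "\<epsilon> > 0" and \<sigma>: "\<sigma> \<noteq> 0"
  shows "\<exists>L0. \<forall>L\<ge>L0. \<forall>t. norm (\<Sum>n=1..L. unit_power t n *\<^sub>C
    (gaussian_weight \<sigma> n *\<^sub>R translate \<epsilon> a n)) \<le> M + 2"
proof -
  have "dirichlet_term a (of_real \<epsilon>) \<longlonglongrightarrow> 0" by (rule summable_LIMSEQ_zero[OF sm]) (simp add: \<epsilon>)
  then have "Bseq (dirichlet_term a (of_real \<epsilon>))" by (rule convergentI[THEN convergent_imp_Bseq])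
  then obtain K where K: "K > 0" "\<And>n. norm (dirichlet_term a (of_real \<epsilon>) n) \<le> K" by (auto elim: BseqE)
  have aK: "norm (translate \<epsilon> a n) \<le> K" if "n \<ge> 1" for n
    using K(2)[of n] dirichlet_term_eq_translate[OF that, of a "of_real \<epsilon>"] by simp
  define e where "e n = gaussian_weight \<sigma> n * K" for n
  have "summable e" unfolding e_def by (intro summable_mult2 summable_gaussian_weight \<sigma>)
  then obtain L0 where L0: "\<And>m n. m \<ge> L0 \<Longrightarrow> norm (sum e {m..<n}) < 1"
    unfolding summable_Cauchy using zero_less_one by blast
  define b where "b t n = unit_power t n *\<^sub>C (gaussian_weight \<sigma> n *\<^sub>R translate \<epsilon> a n)" for t n
  have "norm (\<Sum>n=1..L. b t n) \<le> M + 2" if L: "L \<ge> L0" for L t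
  proof -
    have "eventually (\<lambda>N. norm (\<Sum>n=1..N. b t n) \<le> M + 1 \<and> N \<ge> L) sequentially"
      unfolding b_def by (intro eventually_conj gaussian_mean_eventually_le sm M \<epsilon> eventually_ge_at_top)
    then obtain N where N: "norm (\<Sum>n=1..N. b t n) \<le> M + 1" "N \<ge> L"
      by (auto dest: eventually_happens'[OF sequentially_bot])
    have "norm (\<Sum>n\<in>{L<..N}. b t n) \<le> (\<Sum>n\<in>{L<..N}. e n)"
      by (rule sum_norm_le) (use aK in \<open>auto simp: b_def e_def norm_scaleC intro!: mult_left_mono\<close>)
    also have "\<dots> = sum e {Suc L..<Suc N}" by (rule sum.cong) auto
    also have "\<dots> \<le> 1" using L0[of "Suc L" "Suc N"] L by auto
    finally have tail: "norm (\<Sum>n\<in>{L<..N}. b t n) \<le> 1" .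
    have "{1..N} = {1..L} \<union> {L<..N}" using N(2) by auto
    then have "(\<Sum>n=1..N. b t n) = (\<Sum>n=1..L. b t n) + (\<Sum>n\<in>{L<..N}. b t n)"
      by (simp add: sum.union_disjoint ivl_disj_int)
    then have "(\<Sum>n=1..L. b t n) = (\<Sum>n=1..N. b t n) - (\<Sum>n\<in>{L<..N}. b t n)" by simp
    then have "norm (\<Sum>n=1..L. b t n) \<le> norm (\<Sum>n=1..N. b t n) + norm (\<Sum>n\<in>{L<..N}. b t n)"
      by (metis norm_triangle_ineq4)
    then show ?thesis using N(1) tail by linarith
  qed
  then show ?thesis unfolding b_def by blast
qed

text \<open>
  The estimate for polynomials applies to the Gaussian means with constants independent of the width
  \<open>\<sigma>\<close>. As \<open>\<sigma>\<close> tends to 0 the weights of finitely many terms tend to 1.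
\<close>

lemma dirichlet_partial_sums_small_growth:
  fixes a :: "nat \<Rightarrow> 'x::complex_banach"
  assumes sm: "\<And>s. Re s > 0 \<Longrightarrow> summable (dirichlet_term a s)"
    and M: "\<And>s. Re s > 0 \<Longrightarrow> norm (\<Sum>n. dirichlet_term a s n) \<le> M" and \<epsilon>: "\<epsilon> > 0" and \<delta>: "0 < \<delta>" "\<delta> < 1"
  shows "\<exists>A\<ge>0. \<forall>N\<ge>1. \<forall>t. norm (\<Sum>n=1..N. unit_power t n *\<^sub>C translate \<epsilon> a n) \<le> A * real N powr \<delta>"
proof -
  obtain C where C: "C \<ge> 0" and bohr: "\<forall>(c :: nat \<Rightarrow> 'x) I M N t. finite I \<longrightarrow> 0 \<notin> I \<longrightarrow> 1 \<le> N \<longrightarrow>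
      (\<forall>t. norm (\<Sum>n\<in>I. unit_power t n *\<^sub>C c n) \<le> M) \<longrightarrow>
      norm (\<Sum>n\<in>{n\<in>I. n \<le> N}. unit_power t n *\<^sub>C c n) \<le> C * real N powr \<delta> * M"
    using norm_partial_sum_le_of_bounded_dirichlet_polynomial[OF \<delta>, where ?'x = 'x] by blast
  have M0: "M \<ge> 0" using order_trans[OF norm_ge_zero M[of 1]] by simp
  have g: "norm (\<Sum>n=1..N. unit_power t n *\<^sub>C (gaussian_weight \<sigma> n *\<^sub>R translate \<epsilon> a n))
      \<le> C * real N powr \<delta> * (M + 2)" if N: "N \<ge> 1" and \<sigma>: "\<sigma> \<noteq> 0" for N t \<sigma>
  proof -
    obtain L0 where L0: "\<And>L t. L \<ge> L0 \<Longrightarrow> norm (\<Sum>n=1..L. unit_power t n *\<^sub>C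
      (gaussian_weight \<sigma> n *\<^sub>R translate \<epsilon> a n)) \<le> M + 2"
      using gaussian_mean_uniformly_le[OF sm M \<epsilon> \<sigma>] by blast
    define L where "L = max L0 N"
    have "{n\<in>{1..L}. n \<le> N} = {1..N}" by (auto simp: L_def)
    then show ?thesis
      using bohr[rule_format, OF _ _ N, of "{1..L}" "\<lambda>n. gaussian_weight \<sigma> n *\<^sub>R translate \<epsilon> a n" "M + 2" t] L0[of L]
      by (simp add: L_def)
  qed
  have "norm (\<Sum>n=1..N. unit_power t n *\<^sub>C translate \<epsilon> a n) \<le> C * (M + 2) * real N powr \<delta>" if N: "N \<ge> 1" for N t
  proof (rule LIMSEQ_le_const2)
    have "(\<lambda>k. gaussian_weight (1 / real (Suc k)) n) \<longlonglongrightarrow> exp (- (0 * ln (real n))\<^sup>2 / 2)" for n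
      by (intro tendsto_exp tendsto_divide tendsto_minus tendsto_power tendsto_mult tendsto_const LIMSEQ_Suc[OF lim_1_over_n]) simp
    then have "(\<lambda>k. gaussian_weight (1 / real (Suc k)) n) \<longlonglongrightarrow> 1" for n by simp
    then have "(\<lambda>k. norm (\<Sum>n=1..N. unit_power t n *\<^sub>C (gaussian_weight (1 / real (Suc k)) n *\<^sub>R translate \<epsilon> a n)))
        \<longlonglongrightarrow> norm (\<Sum>n=1..N. unit_power t n *\<^sub>C (1 *\<^sub>R translate \<epsilon> a n))"
      by (intro tendsto_norm tendsto_sum scaleC.tendsto tendsto_const tendsto_scaleR)
    then show "(\<lambda>k. norm (\<Sum>n=1..N. unit_power t n *\<^sub>C (gaussian_weight (1 / real (Suc k)) n *\<^sub>R translate \<epsilon> a n)))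
        \<longlonglongrightarrow> norm (\<Sum>n=1..N. unit_power t n *\<^sub>C translate \<epsilon> a n)" by simp
    have "norm (\<Sum>n=1..N. unit_power t n *\<^sub>C (gaussian_weight (1 / real (Suc k)) n *\<^sub>R translate \<epsilon> a n))
        \<le> C * (M + 2) * real N powr \<delta>" for k
      using g[OF N, of "1 / real (Suc k)" t] by (simp only: mult_ac) simp
    then show "\<exists>k0. \<forall>k\<ge>k0. norm (\<Sum>n=1..N. unit_power t n *\<^sub>C (gaussian_weight (1 / real (Suc k)) n *\<^sub>R translate \<epsilon> a n))
        \<le> C * (M + 2) * real N powr \<delta>" by blast
  qed
  moreover have "C * (M + 2) \<ge> 0" using C M0 by simp
  ultimately show ?thesis by blast
qed

lemma dirichlet_series_uniform_tails:
  fixes a :: "nat \<Rightarrow> 'x::complex_banach"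
  assumes sm: "\<And>s. Re s > 0 \<Longrightarrow> summable (dirichlet_term a s)"
    and M: "\<And>s. Re s > 0 \<Longrightarrow> norm (\<Sum>n. dirichlet_term a s n) \<le> M" and \<epsilon>: "\<epsilon> > 0"
  shows "\<exists>\<tau>. \<tau> \<longlonglongrightarrow> 0 \<and> (\<forall>t m N. 1 \<le> m \<longrightarrow> m \<le> N \<longrightarrow>
    norm (\<Sum>n\<in>{m<..N}. unit_power t n *\<^sub>C translate \<epsilon> a n) \<le> \<tau> m)"
proof -
  define \<eta> where "\<eta> = \<epsilon> / 2"
  define \<delta> where "\<delta> = min (\<eta> / 2) (1 / 2)"
  have \<eta>: "\<eta> > 0" "\<epsilon> = \<eta> + \<eta>" and \<delta>: "0 < \<delta>" "\<delta> < 1" "\<delta> < Re (complex_of_real \<eta>)"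
    using \<epsilon> by (auto simp: \<eta>_def \<delta>_def min_def)
  obtain A where A: "A \<ge> 0"
    "\<And>N t. N \<ge> 1 \<Longrightarrow> norm (\<Sum>n=1..N. unit_power t n *\<^sub>C translate \<eta> a n) \<le> A * real N powr \<delta>"
    using dirichlet_partial_sums_small_growth[OF sm M \<eta>(1) \<delta>(1,2)] by blast
  obtain \<tau> where \<tau>: "\<tau> \<longlonglongrightarrow> 0"
    and tail: "\<forall>(u :: nat \<Rightarrow> 'x) m N. (\<forall>k\<ge>1. norm (\<Sum>n=1..k. u n) \<le> A * real k powr \<delta>) \<longrightarrow>
      1 \<le> m \<longrightarrow> m \<le> N \<longrightarrow> norm (\<Sum>n\<in>{m<..N}. (of_nat n powr (- complex_of_real \<eta>)) *\<^sub>C u n) \<le> \<tau> m"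
    using uniform_dirichlet_tail_bound[OF A(1) less_imp_le[OF \<delta>(1)] \<delta>(3), where ?'x = 'x] by blast
  have "norm (\<Sum>n\<in>{m<..N}. unit_power t n *\<^sub>C translate \<epsilon> a n) \<le> \<tau> m" if mN: "1 \<le> m" "m \<le> N" for t m N
  proof -
    have "(\<Sum>n\<in>{m<..N}. unit_power t n *\<^sub>C translate \<epsilon> a n)
        = (\<Sum>n\<in>{m<..N}. (of_nat n powr (- complex_of_real \<eta>)) *\<^sub>C (unit_power t n *\<^sub>C translate \<eta> a n))"
    proof (rule sum.cong[OF refl])
      fix n assume "n \<in> {m<..N}"
      then have n: "n \<ge> 1" by auto
      show "unit_power t n *\<^sub>C translate \<epsilon> a n
          = (of_nat n powr (- complex_of_real \<eta>)) *\<^sub>C (unit_power t n *\<^sub>C translate \<eta> a n)"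
        unfolding nat_powr_scaleC_translate[OF n] \<eta>(2) translate_translate[symmetric] translate_def[of \<eta> "translate \<eta> a"] ..
    qed
    then show ?thesis using tail[rule_format, OF A(2) mN] by simp
  qed
  then show ?thesis using \<tau> by blast
qed


section \<open>From Dirichlet series to Hardy functions\<close>

text \<open>
  Rounding real and imaginary parts down to multiples of \<open>e/2\<close>.
\<close>

lemma uniform_simple_approximation:
  fixes g :: "'a \<Rightarrow> complex"
  assumes g [measurable]: "g \<in> borel_measurable M" and bd: "\<And>x. x \<in> space M \<Longrightarrow> cmod (g x) \<le> B" and e: "e > 0"
  shows "\<exists>s. simple_function M s \<and> (\<forall>x\<in>space M. cmod (g x - s x) \<le> e)"
proof -
  define q where "q r = real_of_int \<lfloor>r / (e / 2)\<rfloor> * (e / 2)" for r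
  have q: "\<bar>r - q r\<bar> \<le> e / 2" for r
  proof -
    have "\<bar>r / (e / 2) - real_of_int \<lfloor>r / (e / 2)\<rfloor>\<bar> \<le> 1" by linarith
    then have "\<bar>r / (e / 2) - real_of_int \<lfloor>r / (e / 2)\<rfloor>\<bar> * (e / 2) \<le> 1 * (e / 2)"
      using e by (intro mult_right_mono) auto
    also have "\<bar>r / (e / 2) - real_of_int \<lfloor>r / (e / 2)\<rfloor>\<bar> * (e / 2) = \<bar>(r / (e / 2) - real_of_int \<lfloor>r / (e / 2)\<rfloor>) * (e / 2)\<bar>"
      using e by (simp add: abs_mult)
    also have "(r / (e / 2) - real_of_int \<lfloor>r / (e / 2)\<rfloor>) * (e / 2) = r - q r"
      using e by (simp add: q_def left_diff_distrib)
    finally show ?thesis by simp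
  qed
  define s where "s x = of_real (q (Re (g x))) + \<i> * of_real (q (Im (g x)))" for x
  define F where "F = (\<lambda>k::int. real_of_int k * (e / 2)) ` {\<lfloor>- B / (e / 2)\<rfloor>..\<lfloor>B / (e / 2)\<rfloor>}"
  have qF: "q r \<in> F" if "\<bar>r\<bar> \<le> B" for r
  proof -
    have "- B \<le> r" "r \<le> B" using that by auto
    then have "\<lfloor>- B / (e / 2)\<rfloor> \<le> \<lfloor>r / (e / 2)\<rfloor>" "\<lfloor>r / (e / 2)\<rfloor> \<le> \<lfloor>B / (e / 2)\<rfloor>"
      using e by (intro floor_mono divide_right_mono; simp)+
    then show ?thesis by (auto simp: F_def q_def)
  qed
  have "s ` space M \<subseteq> (\<lambda>(x, y). of_real x + \<i> * of_real y) ` (F \<times> F)"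
  proof
    fix z assume "z \<in> s ` space M"
    then obtain x where x: "x \<in> space M" "z = s x" by blast
    have "\<bar>Re (g x)\<bar> \<le> B" "\<bar>Im (g x)\<bar> \<le> B"
      using bd[OF x(1)] abs_Re_le_cmod[of "g x"] abs_Im_le_cmod[of "g x"] by auto
    then show "z \<in> (\<lambda>(x, y). of_real x + \<i> * of_real y) ` (F \<times> F)"
      unfolding x(2) s_def using qF by force
  qed
  then have fin: "finite (s ` space M)" by (rule finite_subset) (simp add: F_def)
  have "s \<in> borel_measurable M" unfolding s_def q_def by measurable
  then have "simple_function M s" using fin by (rule simple_function_borel_measurable)
  moreover have "cmod (g x - s x) \<le> e" for x
  proof -
    have "cmod (g x - s x) \<le> \<bar>Re (g x - s x)\<bar> + \<bar>Im (g x - s x)\<bar>" by (rule cmod_le)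
    also have "\<dots> \<le> e / 2 + e / 2" using q[of "Re (g x)"] q[of "Im (g x)"] by (intro add_mono) (simp_all add: s_def)
    finally show ?thesis by simp
  qed
  ultimately show ?thesis by blast
qed

text \<open>
  Each partial sum has bounded scalar factors, so it is within \<open>1 / (N + 1)\<close> of a simple function
  everywhere. These simple functions have the same pointwise limit as the partial sums.
\<close>

lemma strongly_measurable_uniform_limit_of_polynomials:
  fixes f :: "'a \<Rightarrow> 'x::complex_banach" and c :: "nat \<Rightarrow> 'x"
  assumes g: "\<And>n. g n \<in> borel_measurable M" "\<And>n x. x \<in> space M \<Longrightarrow> cmod (g n x) \<le> 1"
    and lim: "\<And>x. x \<in> space M \<Longrightarrow> (\<lambda>N. \<Sum>n=1..N. g n x *\<^sub>C c n) \<longlonglongrightarrow> f x"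
  shows "strongly_measurable M f"
proof -
  have "\<exists>S. simple_function M S \<and> (\<forall>x\<in>space M. norm ((\<Sum>n=1..N. g n x *\<^sub>C c n) - S x) \<le> 1 / Suc N)" for N
  proof -
    define K where "K = 1 + (\<Sum>n=1..N. norm (c n))"
    have K: "K > 0" unfolding K_def by (intro add_pos_nonneg sum_nonneg) auto
    define e where "e = 1 / (real (Suc N) * K)"
    have e: "e > 0" using K by (simp add: e_def)
    have "\<exists>s. simple_function M s \<and> (\<forall>x\<in>space M. cmod (g n x - s x) \<le> e)" for n
      by (rule uniform_simple_approximation[OF g e])
    then obtain s where s: "\<And>n. simple_function M (s n)" "\<And>n x. x \<in> space M \<Longrightarrow> cmod (g n x - s n x) \<le> e"
      by metis
    define S where "S x = (\<Sum>n=1..N. s n x *\<^sub>C c n)" for x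
    have "simple_function M (\<lambda>x. \<Sum>n\<in>{1..N}. s n x *\<^sub>C c n)"
    proof (rule simple_function_sum)
      show "simple_function M (\<lambda>x. s n x *\<^sub>C c n)" for n
        by (rule simple_function_compose1[OF s(1), where g = "\<lambda>z. z *\<^sub>C c n"])
    qed
    moreover have "norm ((\<Sum>n=1..N. g n x *\<^sub>C c n) - S x) \<le> 1 / Suc N" if x: "x \<in> space M" for x
    proof -
      have "(\<Sum>n=1..N. g n x *\<^sub>C c n) - S x = (\<Sum>n=1..N. (g n x - s n x) *\<^sub>C c n)"
        by (simp add: S_def scaleC.diff_left sum_subtractf)
      also have "norm \<dots> \<le> (\<Sum>n=1..N. e * norm (c n))"
        by (rule sum_norm_le) (use s(2)[OF x] in \<open>auto simp: norm_scaleC intro!: mult_right_mono\<close>)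
      also have "\<dots> \<le> e * K" using e by (simp add: K_def flip: sum_distrib_left)
      also have "\<dots> = 1 / Suc N" using K by (simp add: e_def)
      finally show ?thesis .
    qed
    ultimately show ?thesis unfolding S_def by blast
  qed
  then obtain S where S: "\<And>N. simple_function M (S N)"
    "\<And>N x. x \<in> space M \<Longrightarrow> norm ((\<Sum>n=1..N. g n x *\<^sub>C c n) - S N x) \<le> 1 / Suc N" by metis
  have "(\<lambda>N. S N x) \<longlonglongrightarrow> f x" if x: "x \<in> space M" for x
  proof -
    have L: "(\<lambda>N. 1 / real (Suc N)) \<longlonglongrightarrow> 0" by (rule LIMSEQ_Suc[OF lim_1_over_n])
    have "(\<lambda>N. (\<Sum>n=1..N. g n x *\<^sub>C c n) - S N x) \<longlonglongrightarrow> 0"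
      by (rule Lim_null_comparison[OF _ L]) (use S(2)[OF x] in auto)
    from tendsto_diff[OF lim[OF x] this] show ?thesis by simp
  qed
  then show ?thesis unfolding strongly_measurable_def using S(1) by blast
qed

lemma dirichlet_character_fourier:
  assumes "\<alpha> \<in> eventually_zero" "n > 0"
  shows "has_bochner_integral torus (\<lambda>\<omega>. torus_monomial (\<lambda>j. - \<alpha> j) \<omega> * dirichlet_character n \<omega>)
    (if \<alpha> = (\<lambda>j. int (prime_exponents n j)) then 1 else 0)"
proof -
  let ?\<beta> = "\<lambda>j. - \<alpha> j + int (prime_exponents n j)"
  have n: "(\<lambda>j. int (prime_exponents n j)) \<in> eventually_zero"
    using prime_exponents_eventually_zero[OF assms(2)] by (simp add: eventually_zero_def)
  have m: "(\<lambda>j. - \<alpha> j) \<in> eventually_zero" using assms(1) by (simp add: eventually_zero_def)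
  have \<beta>: "?\<beta> \<in> eventually_zero"
    using m n unfolding eventually_zero_def mem_Collect_eq by (rule eventually_elim2) simp
  have iff: "?\<beta> = (\<lambda>_. 0) \<longleftrightarrow> \<alpha> = (\<lambda>j. int (prime_exponents n j))"
    by (auto simp: fun_eq_iff)
  have int: "has_bochner_integral torus (torus_monomial ?\<beta>) (if \<alpha> = (\<lambda>j. int (prime_exponents n j)) then 1 else 0)"
    using has_bochner_integral_integrable[OF integrable_torus_monomial, of ?\<beta>]
    unfolding integral_torus_monomial[OF \<beta>] iff .
  have eq: "torus_monomial ?\<beta> \<omega> = torus_monomial (\<lambda>j. - \<alpha> j) \<omega> * dirichlet_character n \<omega>"
    if "\<omega> \<in> space torus" for \<omega>
    unfolding dirichlet_character_def by (rule torus_monomial_add[OF m n that])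
  show ?thesis
    by (rule has_bochner_integral_cong[OF refl eq refl, THEN iffD1, OF _ int])
qed

text \<open>
  Density of the flow carries the tail bound from the line to the torus. So the polynomials converge
  uniformly there, and each Fourier coefficient of the limit is the limit of those of the
  polynomials, which are eventually constant.
\<close>

lemma torus_series_represents:
  fixes c :: "nat \<Rightarrow> 'x::complex_banach"
  assumes \<tau>: "\<tau> \<longlonglongrightarrow> (0::real)"
    and tail: "\<And>t m N. 1 \<le> m \<Longrightarrow> m \<le> N \<Longrightarrow> norm (\<Sum>n\<in>{m<..N}. unit_power t n *\<^sub>C c n) \<le> \<tau> m"
    and c0: "c 0 = 0"
    and M: "\<And>t. norm (\<Sum>n. unit_power t n *\<^sub>C c n) \<le> M"
  obtains f where "represents f c" "Linf_norm f \<le> ereal M"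
proof -
  let ?\<chi> = dirichlet_character
  have conv: "(\<lambda>N. \<Sum>n=1..N. z n *\<^sub>C c n) \<longlonglongrightarrow> (\<Sum>n. z n *\<^sub>C c n)"
    if "summable (\<lambda>n. z n *\<^sub>C c n)" for z
  proof -
    have "(\<Sum>n=1..N. z n *\<^sub>C c n) = (\<Sum>n<Suc N. z n *\<^sub>C c n)" for N
    proof -
      have "{..<Suc N} = insert 0 {1..N}" by auto
      then show ?thesis by (simp add: c0 scaleC.zero_right)
    qed
    then show ?thesis using LIMSEQ_Suc[OF summable_LIMSEQ[OF that]] by simp
  qed
  have tailT: "norm (\<Sum>n\<in>{m<..N}. ?\<chi> n \<omega> *\<^sub>C c n) \<le> \<tau> m" if "1 \<le> m" "m \<le> N" "\<omega> \<in> space torus" for m N \<omega>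
    by (rule norm_torus_polynomial_le[OF _ _ tail[OF that(1,2)] that(3)]) auto
  have smT: "summable (\<lambda>n. ?\<chi> n \<omega> *\<^sub>C c n)" if "\<omega> \<in> space torus" for \<omega>
    by (rule summable_if_segments_small[OF \<tau> tailT]) (use that in auto)
  define P where "P N \<omega> = (\<Sum>n=1..N. ?\<chi> n \<omega> *\<^sub>C c n)" for N \<omega>
  define f where "f \<omega> = (\<Sum>n. ?\<chi> n \<omega> *\<^sub>C c n)" for \<omega>
  have limP: "(\<lambda>N. P N \<omega>) \<longlonglongrightarrow> f \<omega>" if "\<omega> \<in> space torus" for \<omega>
    unfolding P_def f_def by (rule conv[OF smT[OF that]])
  have split: "(\<Sum>n=1..L. z n) = (\<Sum>n=1..N. z n) + (\<Sum>n\<in>{N<..L}. z n)" if "N \<le> L" for z :: "nat \<Rightarrow> 'x" and N L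
  proof -
    have "{1..L} = {1..N} \<union> {N<..L}" using that by auto
    then show ?thesis by (simp add: sum.union_disjoint ivl_disj_int)
  qed
  have fP: "norm (f \<omega> - P N \<omega>) \<le> \<tau> N" if N: "N \<ge> 1" and \<omega>: "\<omega> \<in> space torus" for N \<omega>
  proof (rule LIMSEQ_le_const2)
    show "(\<lambda>L. norm (P L \<omega> - P N \<omega>)) \<longlonglongrightarrow> norm (f \<omega> - P N \<omega>)"
      by (intro tendsto_norm tendsto_diff limP \<omega> tendsto_const)
    have "norm (P L \<omega> - P N \<omega>) \<le> \<tau> N" if L: "L \<ge> N" for L
    proof -
      have "P L \<omega> - P N \<omega> = (\<Sum>n\<in>{N<..L}. ?\<chi> n \<omega> *\<^sub>C c n)"
        unfolding P_def split[OF L] by simp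
      then show ?thesis using tailT[OF N L \<omega>] by simp
    qed
    then show "\<exists>L0. \<forall>L\<ge>L0. norm (P L \<omega> - P N \<omega>) \<le> \<tau> N" by blast
  qed
  have line: "norm (\<Sum>n=1..N. unit_power t n *\<^sub>C c n) \<le> M + \<tau> N" if N: "N \<ge> 1" for t N
  proof -
    let ?z = "\<lambda>n. unit_power t n *\<^sub>C c n"
    have "summable ?z" by (rule summable_if_segments_small[OF \<tau> tail])
    from conv[OF this] have "(\<lambda>L. norm (\<Sum>n=1..L. ?z n) + \<tau> N) \<longlonglongrightarrow> norm (\<Sum>n. ?z n) + \<tau> N"
      by (intro tendsto_add tendsto_norm tendsto_const)
    moreover have "norm (\<Sum>n=1..N. ?z n) \<le> norm (\<Sum>n=1..L. ?z n) + \<tau> N" if L: "L \<ge> N" for L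
    proof -
      have eq: "(\<Sum>n=1..N. ?z n) = (\<Sum>n=1..L. ?z n) - (\<Sum>n\<in>{N<..L}. ?z n)" using split[OF L, of ?z] by simp
      have "norm (\<Sum>n=1..N. ?z n) \<le> norm (\<Sum>n=1..L. ?z n) + norm (\<Sum>n\<in>{N<..L}. ?z n)"
        unfolding eq by (rule norm_triangle_ineq4)
      then show ?thesis using tail[OF N L, of t] by linarith
    qed
    ultimately have "norm (\<Sum>n=1..N. ?z n) \<le> norm (\<Sum>n. ?z n) + \<tau> N"
      by (intro LIMSEQ_le_const) blast+
    then show ?thesis using M[of t] by linarith
  qed
  have PM: "norm (P N \<omega>) \<le> M + \<tau> N" if N: "N \<ge> 1" and \<omega>: "\<omega> \<in> space torus" for N \<omega>
    unfolding P_def by (rule norm_torus_polynomial_le[OF _ _ line[OF N] \<omega>]) auto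
  have fM: "norm (f \<omega>) \<le> M" if \<omega>: "\<omega> \<in> space torus" for \<omega>
  proof -
    have "(\<lambda>N. M + \<tau> N) \<longlonglongrightarrow> M + 0" by (intro tendsto_add tendsto_const \<tau>)
    with tendsto_norm[OF limP[OF \<omega>]] have "norm (f \<omega>) \<le> M + 0"
      by (rule LIMSEQ_le) (use PM[OF _ \<omega>] in blast)
    then show ?thesis by simp
  qed
  have \<chi>m: "?\<chi> n \<in> borel_measurable torus" for n unfolding dirichlet_character_def[abs_def] by measurable
  have sm: "strongly_measurable torus f"
    by (rule strongly_measurable_uniform_limit_of_polynomials[OF \<chi>m _ limP[unfolded P_def]])
       (simp_all add: dirichlet_character_def norm_torus_monomial)
  have bound: "Linf_norm f \<le> ereal M"
    unfolding Linf_norm_def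
    by (rule esssup_I) (use borel_measurable_norm_strongly_measurable[OF sm] fM in \<open>auto intro!: AE_I2\<close>)
  then have Linf: "f \<in> Linf_torus" using sm by (auto simp: Linf_torus_def)
  have coeff: "norm (fourier_coeff f \<alpha> - (\<Sum>n=1..N. (if \<alpha> = (\<lambda>j. int (prime_exponents n j)) then 1 else 0) *\<^sub>C c n)) \<le> \<tau> N"
    if \<alpha>: "\<alpha> \<in> eventually_zero" and N: "N \<ge> 1" for \<alpha> N
  proof -
    have "has_strong_integral torus (\<lambda>\<omega>. (torus_monomial (\<lambda>j. - \<alpha> j) \<omega> * ?\<chi> n \<omega>) *\<^sub>C c n)
        ((if \<alpha> = (\<lambda>j. int (prime_exponents n j)) then 1 else 0) *\<^sub>C c n)" if "n \<in> {1..N}" for n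
      using has_strong_integral_scalar[of torus "\<lambda>\<omega>. torus_monomial (\<lambda>j. - \<alpha> j) \<omega> * ?\<chi> n \<omega>" "c n"]
        dirichlet_character_fourier[OF \<alpha>, of n] that
      unfolding has_bochner_integral_iff by (auto simp: Suc_le_eq)
    from has_strong_integral_diff[OF has_strong_integral_fourier_coeff[OF Linf] has_strong_integral_sum[OF this]]
    have hsi: "has_strong_integral torus (\<lambda>\<omega>. torus_monomial (\<lambda>j. - \<alpha> j) \<omega> *\<^sub>C f \<omega>
          - (\<Sum>n=1..N. (torus_monomial (\<lambda>j. - \<alpha> j) \<omega> * ?\<chi> n \<omega>) *\<^sub>C c n))
        (fourier_coeff f \<alpha> - (\<Sum>n=1..N. (if \<alpha> = (\<lambda>j. int (prime_exponents n j)) then 1 else 0) *\<^sub>C c n))" .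
    have eq: "torus_monomial (\<lambda>j. - \<alpha> j) \<omega> *\<^sub>C f \<omega> - (\<Sum>n=1..N. (torus_monomial (\<lambda>j. - \<alpha> j) \<omega> * ?\<chi> n \<omega>) *\<^sub>C c n)
        = torus_monomial (\<lambda>j. - \<alpha> j) \<omega> *\<^sub>C (f \<omega> - P N \<omega>)" for \<omega>
      by (simp only: P_def scaleC.diff_right scaleC.sum_right scaleC_scaleC)
    interpret prob_space torus by (rule prob_space_torus)
    have "norm (fourier_coeff f \<alpha> - (\<Sum>n=1..N. (if \<alpha> = (\<lambda>j. int (prime_exponents n j)) then 1 else 0) *\<^sub>C c n))
        \<le> (\<integral>\<omega>. \<tau> N \<partial>torus)"
      by (rule has_strong_integral_norm_le_integral[OF hsi[unfolded eq]])
         (use fP[OF N] in \<open>auto intro!: AE_I2 simp: norm_scaleC norm_torus_monomial\<close>)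
    then show ?thesis by (simp add: prob_space)
  qed
  have coeff_eq: "fourier_coeff f \<alpha> = y"
    if \<alpha>: "\<alpha> \<in> eventually_zero" and y: "\<And>N. N \<ge> N0 \<Longrightarrow> (\<Sum>n=1..N. (if \<alpha> = (\<lambda>j. int (prime_exponents n j)) then 1 else 0) *\<^sub>C c n) = y"
    for \<alpha> y N0
  proof -
    have "norm (fourier_coeff f \<alpha> - y) \<le> \<tau> N" if "N \<ge> max 1 N0" for N
      using coeff[OF \<alpha>, of N] y[of N] that by simp
    then have "norm (fourier_coeff f \<alpha> - y) \<le> 0"
      by (intro LIMSEQ_le_const[OF \<tau>]) blast
    then show ?thesis by simp
  qed
  have "represents f c"
    unfolding represents_def Hinf_torus_def
  proof (intro conjI CollectI ballI impI Linf)
    fix \<alpha> :: "nat \<Rightarrow> int" assume \<alpha>: "\<alpha> \<in> eventually_zero" and neg: "\<exists>j. \<alpha> j < 0"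
    have "\<alpha> \<noteq> (\<lambda>j. int (prime_exponents n j))" for n using neg by auto
    then show "fourier_coeff f \<alpha> = 0" by (intro coeff_eq[OF \<alpha>, of 0]) (simp add: scaleC.zero_left)
  next
    fix \<beta> :: "nat \<Rightarrow> nat" assume \<beta>: "\<beta> \<in> eventually_zero"
    have ez: "(\<lambda>j. int (\<beta> j)) \<in> eventually_zero" using \<beta> by (simp add: eventually_zero_def)
    have iff: "(\<lambda>j. int (\<beta> j)) = (\<lambda>j. int (prime_exponents n j)) \<longleftrightarrow> n = prime_power \<beta>" if "n > 0" for n
    proof -
      have "(\<lambda>j. int (\<beta> j)) = (\<lambda>j. int (prime_exponents n j)) \<longleftrightarrow> \<beta> = prime_exponents n"
        by (auto simp: fun_eq_iff)
      also have "\<dots> \<longleftrightarrow> n = prime_power \<beta>"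
        using prime_exponents_prime_power[OF \<beta>] prime_power_prime_exponents[OF that] by auto
      finally show ?thesis .
    qed
    show "fourier_coeff f (\<lambda>j. int (\<beta> j)) = c (prime_power \<beta>)"
    proof (rule coeff_eq[OF ez])
      fix N assume N: "N \<ge> prime_power \<beta>"
      have "(\<Sum>n=1..N. (if (\<lambda>j. int (\<beta> j)) = (\<lambda>j. int (prime_exponents n j)) then 1 else 0) *\<^sub>C c n)
          = (\<Sum>n=1..N. if n = prime_power \<beta> then c n else 0)"
        by (rule sum.cong) (auto simp: iff scaleC.zero_left Suc_le_eq)
      also have "\<dots> = c (prime_power \<beta>)"
        using N prime_power_pos[of \<beta>] by (simp add: Suc_le_eq)
      finally show "(\<Sum>n=1..N. (if (\<lambda>j. int (\<beta> j)) = (\<lambda>j. int (prime_exponents n j)) then 1 else 0) *\<^sub>C c n)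
          = c (prime_power \<beta>)" .
    qed
  qed
  then show ?thesis using bound by (rule that)
qed

lemma Hinf_norm_eq:
  assumes f: "represents f b"
  shows "Hinf_norm b = Linf_norm f"
proof -
  let ?g = "SOME g. represents g b"
  have g: "represents ?g b" using someI[of "\<lambda>g. represents g b", OF f] .
  have "fourier_coeff ?g \<alpha> = fourier_coeff f \<alpha>" if \<alpha>: "\<alpha> \<in> eventually_zero" for \<alpha>
  proof (cases "\<exists>j. \<alpha> j < 0")
    case True
    then show ?thesis using f g \<alpha> by (simp add: represents_def Hinf_torus_def)
  next
    case False
    define \<beta> where "\<beta> j = nat (\<alpha> j)" for j
    have \<alpha>\<beta>: "\<alpha> = (\<lambda>j. int (\<beta> j))" using False by (auto simp: \<beta>_def not_less)
    have "\<beta> \<in> eventually_zero"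
      using \<alpha> by (auto simp: eventually_zero_def \<beta>_def elim: eventually_mono)
    then show ?thesis using f g unfolding represents_def \<alpha>\<beta> by simp
  qed
  then show ?thesis
    unfolding Hinf_norm_def using f g
    by (intro Linf_norm_eqI_fourier_coeff) (auto simp: represents_def Hinf_torus_def)
qed

text \<open>
  The uniform tails of the series on the line \<open>Re s = \<epsilon>\<close> provide a function that represents \<open>D\<^sub>\<epsilon>\<close> and is
  bounded by the norm of \<open>D\<close>.
\<close>

lemma Dinf_imp_Hinf_plus:
  fixes a :: "nat \<Rightarrow> 'x::complex_banach"
  assumes a: "a \<in> Dinf"
  shows "a \<in> Hinf_plus" "Hinf_plus_norm a \<le> Dinf_norm a"
proof -
  have ds: "a \<in> dirichlet_series" and sm: "\<And>s. Re s > 0 \<Longrightarrow> summable (dirichlet_term a s)"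
    and bd: "bounded ((\<lambda>s. \<Sum>n. dirichlet_term a s n) ` right_half_plane)"
    using a by (auto simp: Dinf_def right_half_plane_def)
  obtain B where B: "\<And>s. Re s > 0 \<Longrightarrow> norm (\<Sum>n. dirichlet_term a s n) \<le> B"
    using bd unfolding bounded_iff right_half_plane_def by auto
  have up: "ereal (norm (\<Sum>n. dirichlet_term a s n)) \<le> Dinf_norm a" if "Re s > 0" for s
    unfolding Dinf_norm_def by (rule SUP_upper) (simp add: right_half_plane_def that)
  have "Dinf_norm a \<le> ereal B"
    unfolding Dinf_norm_def by (rule SUP_least) (simp add: right_half_plane_def B)
  moreover have "ereal 0 \<le> Dinf_norm a"
    by (rule order_trans[OF _ up[of 1]]) auto
  ultimately obtain M where M: "Dinf_norm a = ereal M" by (cases "Dinf_norm a") auto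
  have norm_le: "norm (\<Sum>n. dirichlet_term a s n) \<le> M" if "Re s > 0" for s
    using up[OF that] M by simp
  have main: "translate \<epsilon> a \<in> Hinf \<and> Hinf_norm (translate \<epsilon> a) \<le> ereal M" if \<epsilon>: "\<epsilon> > 0" for \<epsilon>
  proof -
    obtain \<tau> where \<tau>: "\<tau> \<longlonglongrightarrow> 0" and tail: "\<And>t m N. 1 \<le> m \<Longrightarrow> m \<le> N \<Longrightarrow>
      norm (\<Sum>n\<in>{m<..N}. unit_power t n *\<^sub>C translate \<epsilon> a n) \<le> \<tau> m"
      using dirichlet_series_uniform_tails[OF sm norm_le \<epsilon>] by blast
    have 0: "translate \<epsilon> a 0 = 0" using ds by (simp add: translate_def dirichlet_series_def)
    have "norm (\<Sum>n. unit_power t n *\<^sub>C translate \<epsilon> a n) \<le> M" for t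
    proof -
      have "unit_power t n *\<^sub>C translate \<epsilon> a n = dirichlet_term a (Complex \<epsilon> t) n" for n
      proof (cases "n \<ge> 1")
        case True
        then show ?thesis by (simp add: dirichlet_term_eq_translate)
      next
        case False
        then have "n = 0" by simp
        then show ?thesis using 0 by (simp add: dirichlet_term_0 scaleC.zero_right)
      qed
      then show ?thesis using norm_le[of "Complex \<epsilon> t"] \<epsilon> by simp
    qed
    from torus_series_represents[OF \<tau> tail 0 this]
    obtain f where f: "represents f (translate \<epsilon> a)" "Linf_norm f \<le> ereal M" .
    then show ?thesis
      using 0 by (auto simp: Hinf_def dirichlet_series_def Hinf_norm_eq)
  qed
  show le: "Hinf_plus_norm a \<le> Dinf_norm a"
    unfolding Hinf_plus_norm_def M by (rule SUP_least) (use main in auto)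
  show "a \<in> Hinf_plus"
    unfolding Hinf_plus_def using ds main le M by auto
qed

theorem corollary3p5:
  shows "(Hinf_plus :: (nat \<Rightarrow> 'x::complex_banach) set) = Dinf \<and>
         (\<forall>D \<in> (Hinf_plus :: (nat \<Rightarrow> 'x) set). Hinf_plus_norm D = Dinf_norm D)"
  using Hinf_plus_imp_Dinf Dinf_imp_Hinf_plus by (blast intro: antisym)

end
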